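(* Let $\mathbb{K}$ be a field, let $D$ be a weighted oriented graph such that every vertex of $V^+$ is a sink, and let $I=I(D)$ be its edge ideal. Then $$\operatorname{reg}(I^{(k)})\le \operatorname{reg}(I^k)\quad\text{for } k=2,3 .$$
   Context: A weighted oriented graph is a triple $D=(V(D),E(D),w)$ with finite vertex set $V(D)=\{x_1,\dots,x_n\}$, a set $E(D)$ of directed edges (where $(u,v)$ is an edge from $u$ to $v$), without loops or parallel edges (at most one of $(u,v),(v,u)$ is in $E(D)$), and a weight function $w$ from $V(D)$ to the positive integers. A vertex $v$ is a source if no edge ends at $v$, and a sink if no edge starts at $v$; by convention $w(v)=1$ whenever $v$ is a source. $V^+=\{x\in V(D): w(x)\ge 2\}$. The edge ideal of $D$ is $I(D)=(x_ix_j^{w(x_j)} : (x_i,x_j)\in E(D))\subset R=\mathbb{K}[x_1,\dots,x_n]$. For an ideal $I$ of $R$, the $k$-th symbolic power is $I^{(k)}=\bigcap_{P\in \operatorname{Ass}(R/I)}(I^kR_P\cap R)$. For a homogeneous ideal $I$, $\operatorname{reg}(I)=\max\{j-i : \beta_{i,j}(I)\ne 0\}$ is the Castelnuovo–Mumford regularity. *)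

theory Defs
  imports "HOL-Library.Poly_Mapping" "HOL-Library.Extended_Real"
begin

section \<open>Polynomials\<close>

text \<open>
  The polynomial ring over the field \<open>'k\<close> in the variables \<open>x\<^sub>v\<close> indexed by the type \<open>'v\<close>: a monomial is
  a finitely supported exponent vector, and multiplication is the convolution product of
  finitely supported functions.
\<close>

type_synonym ('v, 'k) mpoly = "('v \<Rightarrow>\<^sub>0 nat) \<Rightarrow>\<^sub>0 'k"

definition indet :: "'v \<Rightarrow> ('v, 'k::field) mpoly" where
  "indet v = Poly_Mapping.single (Poly_Mapping.single v 1) 1"

definition mdeg :: "('v \<Rightarrow>\<^sub>0 nat) \<Rightarrow> nat" where
  "mdeg m = (\<Sum>v\<in>Poly_Mapping.keys m. Poly_Mapping.lookup m v)"

section \<open>Ideals\<close>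

text \<open>
  A commutative ring is a module over itself, so its ideals are the submodules for the scalar
  multiplication \<open>(*)\<close>, and generated ideals are spans.
\<close>

definition is_ideal :: "'a::comm_ring_1 set \<Rightarrow> bool" where
  "is_ideal I \<longleftrightarrow> module.subspace (*) I"

definition ideal_gen :: "'a::comm_ring_1 set \<Rightarrow> 'a set" where
  "ideal_gen S = module.span (*) S"

definition is_prime_ideal :: "'a::comm_ring_1 set \<Rightarrow> bool" where
  "is_prime_ideal P \<longleftrightarrow>
     is_ideal P \<and> P \<noteq> UNIV \<and> (\<forall>a b. a * b \<in> P \<longrightarrow> a \<in> P \<or> b \<in> P)"

definition ideal_mult :: "'a::comm_ring_1 set \<Rightarrow> 'a set \<Rightarrow> 'a set" where
  "ideal_mult I J = ideal_gen {a * b | a b. a \<in> I \<and> b \<in> J}"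

primrec ideal_pow :: "'a::comm_ring_1 set \<Rightarrow> nat \<Rightarrow> 'a set" where
  "ideal_pow I 0 = UNIV"
| "ideal_pow I (Suc k) = ideal_mult I (ideal_pow I k)"

text \<open>
  The associated primes of \<open>R/I\<close>: prime ideals which are the annihilator of a residue class
  \<open>f + I\<close>.
\<close>

definition Ass_quot :: "'a::comm_ring_1 set \<Rightarrow> 'a set set" where
  "Ass_quot I = {P. is_prime_ideal P \<and> (\<exists>f. P = {g. g * f \<in> I})}"

section \<open>Localization at a prime and symbolic powers\<close>

text \<open>
  The elements of \<open>R\<^sub>P\<close> are the classes of pairs \<open>(a, s)\<close> with \<open>s \<notin> P\<close>, written \<open>a/s\<close>, under the
  usual equality of fractions.  The extension \<open>J R\<^sub>P\<close> consists of the fractions with numerator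
  in \<open>J\<close>, and \<open>J R\<^sub>P \<inter> R\<close> is its preimage under \<open>f \<mapsto> f/1\<close>.
\<close>

definition frac_rel :: "'a::comm_ring_1 set \<Rightarrow> (('a \<times> 'a) \<times> ('a \<times> 'a)) set" where
  "frac_rel P = {((a, s), (b, t)). s \<notin> P \<and> t \<notin> P \<and> (\<exists>u. u \<notin> P \<and> u * (a * t - b * s) = 0)}"

definition frac :: "'a::comm_ring_1 set \<Rightarrow> 'a \<Rightarrow> 'a \<Rightarrow> ('a \<times> 'a) set" where
  "frac P a s = frac_rel P `` {(a, s)}"

definition loc_extension :: "'a::comm_ring_1 set \<Rightarrow> 'a set \<Rightarrow> ('a \<times> 'a) set set" where
  "loc_extension P J = {frac P a s | a s. a \<in> J \<and> s \<notin> P}"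

definition loc_contraction :: "'a::comm_ring_1 set \<Rightarrow> ('a \<times> 'a) set set \<Rightarrow> 'a set" where
  "loc_contraction P L = {f. frac P f 1 \<in> L}"

definition symbolic_pow :: "'a::comm_ring_1 set \<Rightarrow> nat \<Rightarrow> 'a set" where
  "symbolic_pow I k =
     (\<Inter>P\<in>Ass_quot I. loc_contraction P (loc_extension P (ideal_pow I k)))"

section \<open>Minimal graded free resolutions and regularity\<close>

text \<open>
  Numerical data of a complex \<open>\<dots> \<rightarrow> F\<^sub>1 \<rightarrow> F\<^sub>0 \<rightarrow> R\<close> of graded free modules of finite rank.
  \<open>F\<^sub>i\<close> has basis elements numbered \<open>0, \<dots>, rk i - 1\<close>, the \<open>b\<close>-th one of degree \<open>sh i b\<close>, that is,
  \<open>F\<^sub>i\<close> is the direct sum of the \<open>R(-sh i b)\<close>.  \<open>aug b\<close> is the image in \<open>R\<close> of the \<open>b\<close>-th basis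
  element of \<open>F\<^sub>0\<close>, and \<open>mat i a b\<close> is the \<open>a\<close>-th coordinate of the image in \<open>F\<^sub>i\<close> of the \<open>b\<close>-th
  basis element of \<open>F\<^bsub>i+1\<^esub>\<close>.  Values at out-of-range indices are irrelevant.  The degrees may be
  taken in the natural numbers because only minimal resolutions of ideals of \<open>R\<close> are considered.
\<close>

record 'r graded_free_complex =
  rk :: "nat \<Rightarrow> nat"
  sh :: "nat \<Rightarrow> nat \<Rightarrow> nat"
  aug :: "nat \<Rightarrow> 'r"
  mat :: "nat \<Rightarrow> nat \<Rightarrow> nat \<Rightarrow> 'r"

definition free_module :: "nat \<Rightarrow> (nat \<Rightarrow> 'a::comm_ring_1) set" where
  "free_module r = {u. \<forall>b\<ge>r. u b = 0}"

definition aug_map ::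
  "'r::comm_ring_1 graded_free_complex \<Rightarrow> (nat \<Rightarrow> 'r) \<Rightarrow> 'r" where
  "aug_map F u = (\<Sum>b<rk F 0. u b * aug F b)"

definition diff_map ::
  "'r::comm_ring_1 graded_free_complex \<Rightarrow> nat \<Rightarrow> (nat \<Rightarrow> 'r) \<Rightarrow> (nat \<Rightarrow> 'r)" where
  "diff_map F i u = (\<lambda>a. if a < rk F i then \<Sum>b<rk F (Suc i). mat F i a b * u b else 0)"

text \<open>
  The first two conditions say that all maps are homogeneous of degree \<open>0\<close>; the others that
  \<open>\<dots> \<rightarrow> F\<^sub>1 \<rightarrow> F\<^sub>0 \<rightarrow> I \<rightarrow> 0\<close> is exact.
\<close>

definition graded_free_resolution ::
  "('v, 'k::field) mpoly graded_free_complex \<Rightarrow> ('v, 'k) mpoly set \<Rightarrow> bool" where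
  "graded_free_resolution F I \<longleftrightarrow>
     (\<forall>b<rk F 0. \<forall>m\<in>Poly_Mapping.keys (aug F b). mdeg m = sh F 0 b) \<and>
     (\<forall>i. \<forall>a<rk F i. \<forall>b<rk F (Suc i). \<forall>m\<in>Poly_Mapping.keys (mat F i a b).
        mdeg m + sh F i a = sh F (Suc i) b) \<and>
     aug_map F ` free_module (rk F 0) = I \<and>
     diff_map F 0 ` free_module (rk F 1) = {u \<in> free_module (rk F 0). aug_map F u = 0} \<and>
     (\<forall>i. diff_map F (Suc i) ` free_module (rk F (Suc (Suc i))) =
        {u \<in> free_module (rk F (Suc i)). diff_map F i u = (\<lambda>_. 0)})"

text \<open>Minimality: the image of \<open>F\<^bsub>i+1\<^esub>\<close> is contained in \<open>(x\<^sub>v : v) F\<^sub>i\<close>.\<close>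

definition minimal_graded_free_resolution ::
  "('v, 'k::field) mpoly graded_free_complex \<Rightarrow> ('v, 'k) mpoly set \<Rightarrow> bool" where
  "minimal_graded_free_resolution F I \<longleftrightarrow>
     graded_free_resolution F I \<and>
     (\<forall>i. \<forall>a<rk F i. \<forall>b<rk F (Suc i). mat F i a b \<in> ideal_gen (range indet))"

text \<open>
  For finitely many variables and homogeneous \<open>I\<close>, the choice is immaterial: a minimal graded
  free resolution exists and is unique up to isomorphism.
\<close>

definition graded_betti :: "('v, 'k::field) mpoly set \<Rightarrow> nat \<Rightarrow> nat \<Rightarrow> nat" where
  "graded_betti I i j =
     (let F = (SOME F. minimal_graded_free_resolution F I) in card {b. b < rk F i \<and> sh F i b = j})"

text \<open>
  The set below is finite, so the supremum is a maximum unless \<open>I\<close> is the zero ideal, whose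
  regularity is \<open>-\<infinity>\<close>.
\<close>

definition reg :: "('v, 'k::field) mpoly set \<Rightarrow> ereal" where
  "reg I = Sup {ereal (real j - real i) | i j. graded_betti I i j \<noteq> 0}"

section \<open>Weighted oriented graphs\<close>

text \<open>The vertex set is the whole of the type \<open>'v\<close>.\<close>

definition is_source :: "('v \<times> 'v) set \<Rightarrow> 'v \<Rightarrow> bool" where
  "is_source E v \<longleftrightarrow> (\<nexists>u. (u, v) \<in> E)"

definition is_sink :: "('v \<times> 'v) set \<Rightarrow> 'v \<Rightarrow> bool" where
  "is_sink E v \<longleftrightarrow> (\<nexists>u. (v, u) \<in> E)"

definition weighted_oriented_graph :: "('v::finite \<times> 'v) set \<Rightarrow> ('v \<Rightarrow> nat) \<Rightarrow> bool" where
  "weighted_oriented_graph E w \<longleftrightarrow>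
     (\<forall>v. (v, v) \<notin> E) \<and>
     (\<forall>u v. (u, v) \<in> E \<longrightarrow> (v, u) \<notin> E) \<and>
     (\<forall>v. w v \<ge> 1) \<and>
     (\<forall>v. is_source E v \<longrightarrow> w v = 1)"

definition V_plus :: "('v \<Rightarrow> nat) \<Rightarrow> 'v set" where
  "V_plus w = {v. w v \<ge> 2}"

definition edge_ideal :: "('v::finite \<times> 'v) set \<Rightarrow> ('v \<Rightarrow> nat) \<Rightarrow> ('v, 'k::field) mpoly set" where
  "edge_ideal E w = ideal_gen {indet u * indet v ^ w v | u v. (u, v) \<in> E}"

end

theory Submission
  imports Defs "HOL-Library.Function_Algebras" "HOL-Library.FuncSet"
begin

text \<open>
  For a monomial ideal \<open>J\<close>, the Koszul homology in multidegree \<open>a\<close>, and hence the multigraded Betti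
  number, is the homology of the complex of those \<open>\<tau>\<close> for which the corner \<open>a - \<tau>\<close> of the unit
  cube below \<open>a\<close> is an exponent of \<open>J\<close>.  Now replace, one coordinate at a time, the step from
  \<open>a\<^sub>j - 1\<close> to \<open>a\<^sub>j\<close> by a step from \<open>b\<^sub>j\<close> up to a bound \<open>N\<^sub>j\<close> beyond which membership in \<open>J\<close> is constant,
  which ends with local cohomology in degree \<open>b\<close>.  The exact triangle for a composite of two
  inclusions shows that non-vanishing homology in homological degree \<open>i\<close> survives with the same
  value of \<open>\<bar>b\<bar> - i\<close>; on the way back this value does not decrease.  So \<open>reg J \<le> reg J'\<close>
  as soon as every long cube with homology for \<open>J\<close> also has homology for \<open>J'\<close>.

  Since vertices of weight \<open>\<ge> 2\<close> are sinks, membership of \<open>x\<^sup>m\<close> in \<open>I\<^sup>k\<close> and in the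
  symbolic power depends only on \<open>\<lfloor>m / w\<rfloor>\<close>: it has to contain \<open>k\<close> edges, respectively to have
  degree at least \<open>k\<close> on every vertex cover.  If the complexes of the two ideals on a long cube
  differ, then either the one of the symbolic power is a full simplex, or \<open>k = 3\<close> and \<open>\<lfloor>b / w\<rfloor>\<close>
  contains a triangle and a further vertex \<open>y\<close>, and then it is a cone with apex \<open>y\<close>.

  The Betti numbers of a resolution are related to Koszul homology by dimension shifting; the
  vanishing of Koszul homology in large degrees also shows that the syzygies are finitely
  generated, so that a minimal resolution exists.
\<close>

section \<open>The Koszul differential\<close>

text \<open>The two ideals are compared on long cubes because there a coordinate off \<tau> sits at
  \<open>k * w v\<close> and counts as \<open>k\<close> after division by the weight: such a vertex
  can serve \<open>k\<close> edges. A neighbour of it in the support can then be matched away, which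
  lowers \<open>k\<close> by one for edges and for covers alike. This explains the range of
  \<open>k\<close>. At \<open>k = 1\<close> covers and edges impose the same condition; at
  \<open>k = 2\<close> the only discrepancy is a triangle whose vertices have value 1. One such step
  leads from 2 to the first situation and from 3 to the second.

  Since \<open>graded_betti\<close> refers to an arbitrarily chosen minimal resolution, its shifts
  have to be computed for every minimal resolution, and one has to be produced. Only non-vanishing
  of Betti numbers enters \<open>reg\<close>; therefore homology appears as a predicate on cycles,
  and no homology groups are formed. The homotopy \<open>wdg\<close> is behind both vanishing
  principles: exactness of the Koszul complex of a free module and acyclicity of cones.\<close>

text \<open>An arbitrary numbering of the variables, fixing the signs.\<close>

definition vidx :: "'v::finite \<Rightarrow> nat" where
  "vidx = (SOME f. inj f)"

lemma inj_vidx: "inj (vidx :: 'v::finite \<Rightarrow> nat)"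
  unfolding vidx_def using finite_imp_inj_to_nat_seg[OF finite_UNIV] by (metis (mono_tags) someI)

lemma vidx_eq_iff [simp]: "vidx u = vidx v \<longleftrightarrow> u = v"
  by (rule inj_eq[OF inj_vidx])

definition esgn :: "'v::finite \<Rightarrow> 'v set \<Rightarrow> 'r::comm_ring_1" where
  "esgn v \<tau> = (-1) ^ card {u \<in> \<tau>. vidx u < vidx v}"

text \<open>The coefficients \<open>X\<close> are kept abstract: \<open>X = indet\<close> gives the
  Koszul differential, \<open>X = 1\<close> the simplicial boundary.\<close>

definition bd :: "('v::finite \<Rightarrow> 'r::comm_ring_1) \<Rightarrow> ('v set \<Rightarrow> 'r) \<Rightarrow> 'v set \<Rightarrow> 'r" where
  "bd X c \<tau> = (\<Sum>v\<in>-\<tau>. esgn v \<tau> * X v * c (insert v \<tau>))"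

text \<open>Exterior multiplication by the basis vector of \<open>j\<close>, on coefficient
  functions.\<close>

definition wdg :: "'v::finite \<Rightarrow> ('v set \<Rightarrow> 'r::comm_ring_1) \<Rightarrow> 'v set \<Rightarrow> 'r" where
  "wdg j c \<tau> = (if j \<in> \<tau> then esgn j (\<tau> - {j}) * c (\<tau> - {j}) else 0)"

lemma esgn_sq [simp]: "esgn v \<tau> * esgn v \<tau> = 1"
  by (simp add: esgn_def flip: power_mult_distrib)

lemma esgn_sq' [simp]: "esgn v \<tau> * (esgn v \<tau> * x) = x"
  by (simp flip: mult.assoc)

lemma esgn_insert:
  assumes "u \<notin> \<tau>"
  shows "esgn v (insert u \<tau>) = (if vidx u < vidx v then - esgn v \<tau> else esgn v \<tau>)"
proof -
  have "{w \<in> insert u \<tau>. vidx w < vidx v} =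
      (if vidx u < vidx v then insert u {w \<in> \<tau>. vidx w < vidx v} else {w \<in> \<tau>. vidx w < vidx v})"
    by auto
  then show ?thesis using assms by (simp add: esgn_def)
qed

lemma esgn_swap:
  assumes "u \<noteq> v" "u \<notin> \<tau>" "v \<notin> \<tau>"
  shows "esgn v \<tau> * esgn u (insert v \<tau>) = - (esgn u \<tau> * esgn v (insert u \<tau>))"
    and "esgn v (insert u \<tau>) * esgn u (insert v \<tau>) = - (esgn u \<tau> * esgn v \<tau>)"
proof -
  have "vidx u \<noteq> vidx v" using assms(1) by simp
  then show "esgn v \<tau> * esgn u (insert v \<tau>) = - (esgn u \<tau> * esgn v (insert u \<tau>))"
    and "esgn v (insert u \<tau>) * esgn u (insert v \<tau>) = - (esgn u \<tau> * esgn v \<tau>)"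
    using assms by (auto simp: esgn_insert)
qed

text \<open>Removing two vertices in either order gives opposite signs; the numbering splits the
  ordered pairs into two halves that cancel term by term.\<close>

lemma bd_bd: "bd X (bd X c) = 0"
proof
  fix \<tau>
  define F where "F v u = (esgn v \<tau> * esgn u (insert v \<tau>)) * (X v * X u * c (insert u (insert v \<tau>)))" for u v
  have F: "F v u = - F u v" if "u \<noteq> v" "u \<notin> \<tau>" "v \<notin> \<tau>" for u v
    unfolding F_def esgn_swap(1)[OF that] by (simp add: insert_commute mult.commute[of "X v"])
  let ?S = "\<lambda>P. {(v, u). v \<notin> \<tau> \<and> u \<notin> \<tau> \<and> P (vidx v) (vidx u)}"
  have "bd X (bd X c) \<tau> = (\<Sum>v\<in>-\<tau>. \<Sum>u\<in>-insert v \<tau>. F v u)"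
    by (simp add: bd_def F_def sum_distrib_left mult_ac)
  also have "\<dots> = (\<Sum>(v, u)\<in>(SIGMA v:-\<tau>. -insert v \<tau>). F v u)"
    by (rule sum.Sigma) auto
  also have "(SIGMA v:-\<tau>. -insert v \<tau>) = ?S (<) \<union> ?S (>)"
    by (auto simp: set_eq_iff) (metis vidx_eq_iff nat_neq_iff)
  also have "(\<Sum>(v, u)\<in>\<dots>. F v u) = (\<Sum>(v, u)\<in>?S (<). F v u) + (\<Sum>(v, u)\<in>?S (>). F v u)"
    by (rule sum.union_disjoint) auto
  also have "(\<Sum>(v, u)\<in>?S (>). F v u) = (\<Sum>(v, u)\<in>?S (<). F u v)"
    by (rule sum.reindex_bij_witness[where i = "\<lambda>(u, v). (v, u)" and j = "\<lambda>(u, v). (v, u)"]) auto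
  also have "(\<Sum>(v, u)\<in>?S (<). F v u) + \<dots> = (\<Sum>(v, u)\<in>?S (<). F v u + F u v)"
    by (simp add: sum.distrib case_prod_beta)
  also have "\<dots> = 0"
  proof (rule sum.neutral, safe)
    fix v u assume "v \<notin> \<tau>" "u \<notin> \<tau>" "vidx v < vidx u"
    then have "F v u = - F u v" by (intro F) auto
    then show "F v u + F u v = 0" by simp
  qed
  finally show "bd X (bd X c) \<tau> = 0 \<tau>" by simp
qed

text \<open>The Koszul homotopy formula. Where \<open>X j\<close> acts invertibly,
  \<open>wdg j\<close> contracts the complex; with \<open>X = 1\<close> every \<open>j\<close>
  qualifies.\<close>

lemma bd_wdg: "bd X (wdg j c) + wdg j (bd X c) = (\<lambda>\<tau>. X j * c \<tau>)"
proof
  fix \<tau>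
  show "(bd X (wdg j c) + wdg j (bd X c)) \<tau> = X j * c \<tau>"
  proof (cases "j \<in> \<tau>")
    case True
    define \<sigma> where "\<sigma> = \<tau> - {j}"
    have \<sigma>: "\<tau> = insert j \<sigma>" "j \<notin> \<sigma>" using True by (auto simp: \<sigma>_def)
    have 1: "bd X (wdg j c) \<tau> = (\<Sum>v\<in>-\<tau>. esgn v \<tau> * X v * (esgn j (insert v \<sigma>) * c (insert v \<sigma>)))"
      unfolding bd_def
    proof (rule sum.cong)
      fix v assume "v \<in> -\<tau>"
      then have "insert v \<tau> - {j} = insert v \<sigma>" using \<sigma> by auto
      then show "esgn v \<tau> * X v * wdg j c (insert v \<tau>) = esgn v \<tau> * X v * (esgn j (insert v \<sigma>) * c (insert v \<sigma>))"
        using True by (simp add: wdg_def)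
    qed simp
    have "-\<sigma> = insert j (-\<tau>)" using \<sigma> by auto
    then have 2: "wdg j (bd X c) \<tau> = esgn j \<sigma> * (esgn j \<sigma> * X j * c \<tau>
        + (\<Sum>v\<in>-\<tau>. esgn v \<sigma> * X v * c (insert v \<sigma>)))"
      using True \<sigma> by (simp add: wdg_def bd_def)
    have "(\<Sum>v\<in>-\<tau>. esgn v \<tau> * X v * (esgn j (insert v \<sigma>) * c (insert v \<sigma>))) =
       - (esgn j \<sigma> * (\<Sum>v\<in>-\<tau>. esgn v \<sigma> * X v * c (insert v \<sigma>)))"
      unfolding sum_distrib_left sum_negf[symmetric]
    proof (rule sum.cong)
      fix v assume "v \<in> -\<tau>"
      then have "esgn v \<tau> * esgn j (insert v \<sigma>) = - (esgn j \<sigma> * esgn v \<sigma> :: 'b)"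
        using esgn_swap(2)[of j v \<sigma>] \<sigma> by auto
      then show "esgn v \<tau> * X v * (esgn j (insert v \<sigma>) * c (insert v \<sigma>)) =
         - (esgn j \<sigma> * (esgn v \<sigma> * X v * c (insert v \<sigma>)))"
        by (metis (no_types, opaque_lifting) mult.assoc mult.commute mult_minus_left)
    qed simp
    then show ?thesis using 1 2 by (simp add: algebra_simps)
  next
    case False
    have "bd X (wdg j c) \<tau> = (\<Sum>v\<in>-\<tau>. if v = j then X j * c \<tau> else 0)"
      unfolding bd_def by (rule sum.cong) (use False in \<open>auto simp: wdg_def mult_ac\<close>)
    then show ?thesis using False by (simp add: wdg_def)
  qed
qed

lemma bd_wdg_one: "bd 1 (wdg j c) = c - wdg j (bd 1 c)"
  using bd_wdg[of 1 j c] by (simp add: eq_diff_eq)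

lemma bd_add: "bd X (c + c') = bd X c + bd X c'"
  by (rule ext) (simp add: bd_def distrib_left sum.distrib)

lemma bd_diff: "bd X (c - c') = bd X c - bd X c'"
  by (rule ext) (simp add: bd_def right_diff_distrib sum_subtractf)

lemma bd_zero [simp]: "bd X 0 = 0"
  by (auto simp: bd_def fun_eq_iff)

lemma wdg_zero [simp]: "wdg j 0 = 0"
  by (auto simp: wdg_def fun_eq_iff)

section \<open>Homology of simplicial complexes\<close>

text \<open>Graded by cardinality, with the empty set as a face: this is the reduced chain complex
  with its index shifted by one.\<close>

definition chn :: "'v set set \<Rightarrow> nat \<Rightarrow> ('v set \<Rightarrow> 'k::field) set" where
  "chn D i = {c. \<forall>\<tau>. c \<tau> \<noteq> 0 \<longrightarrow> \<tau> \<in> D \<and> card \<tau> = i}"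

text \<open>The type argument records the field, on whose characteristic the homology may
  depend.\<close>

definition hnz :: "'k::field itself \<Rightarrow> 'v::finite set set \<Rightarrow> nat \<Rightarrow> bool" where
  "hnz _ D i \<longleftrightarrow> (\<exists>z\<in>chn D i. bd 1 z = (0 :: 'v set \<Rightarrow> 'k) \<and> (\<forall>y\<in>chn D (Suc i). bd 1 y \<noteq> z))"

lemma chn_add: "c \<in> chn D i \<Longrightarrow> c' \<in> chn D i \<Longrightarrow> c + c' \<in> chn D i"
  unfolding chn_def by simp (metis add.right_neutral)

lemma chn_diff: "c \<in> chn D i \<Longrightarrow> c' \<in> chn D i \<Longrightarrow> c - c' \<in> chn D i"
  unfolding chn_def by simp (metis diff_zero)

lemma chn_mono: "c \<in> chn D i \<Longrightarrow> D \<subseteq> D' \<Longrightarrow> c \<in> chn D' i"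
  by (auto simp: chn_def)

lemma bd_chn:
  assumes "c \<in> chn D (Suc i)" "\<And>\<sigma> \<tau>. \<tau> \<in> D \<Longrightarrow> \<sigma> \<subseteq> \<tau> \<Longrightarrow> \<sigma> \<in> D"
  shows "bd X c \<in> chn D i"
  unfolding chn_def
proof safe
  fix \<tau> assume "bd X c \<tau> \<noteq> 0"
  then obtain v where "v \<in> -\<tau>" "esgn v \<tau> * X v * c (insert v \<tau>) \<noteq> 0"
    unfolding bd_def by (rule sum.not_neutral_contains_not_neutral)
  then have v: "v \<notin> \<tau>" "c (insert v \<tau>) \<noteq> 0" by auto
  then have "insert v \<tau> \<in> D" "card (insert v \<tau>) = Suc i" using assms(1) by (auto simp: chn_def)
  then show "\<tau> \<in> D" "card \<tau> = i" using assms(2) v(1) by auto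
qed

text \<open>A cycle \<open>z\<close> is bounded by \<open>wdg j z\<close>. Only closure under adding
  \<open>j\<close> is assumed, so the empty family is covered as well.\<close>

lemma hnz_cone:
  assumes "\<And>\<tau>. \<tau> \<in> D \<Longrightarrow> insert j \<tau> \<in> D"
  shows "\<not> hnz TYPE('k::field) D i"
proof
  assume "hnz TYPE('k) D i"
  then obtain z :: "'a set \<Rightarrow> 'k" where z: "z \<in> chn D i" "bd 1 z = 0" "\<And>y. y \<in> chn D (Suc i) \<Longrightarrow> bd 1 y \<noteq> z"
    unfolding hnz_def by blast
  have "wdg j z \<in> chn D (Suc i)"
    unfolding chn_def
  proof safe
    fix \<tau> assume "wdg j z \<tau> \<noteq> 0"
    then have *: "j \<in> \<tau>" "z (\<tau> - {j}) \<noteq> 0" unfolding wdg_def by (metis mult_zero_right)+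
    then have "\<tau> - {j} \<in> D" "card (\<tau> - {j}) = i" using z(1) by (auto simp: chn_def)
    with * assms show "\<tau> \<in> D" "card \<tau> = Suc i"
      by (metis insert_Diff, metis card_Suc_Diff1 finite)
  qed
  moreover have "bd 1 (wdg j z) = z" using bd_wdg[of 1 j z] z(2) by simp
  ultimately show False using z(3) by blast
qed

section \<open>Mapping cones of inclusions of slices\<close>

definition jn :: "'v \<Rightarrow> 'v set set \<Rightarrow> 'v set set \<Rightarrow> 'v set set" where
  "jn j X Y = {\<tau>. if j \<in> \<tau> then \<tau> - {j} \<in> X else \<tau> \<in> Y}"

lemma jn_down:
  assumes "\<tau> \<in> jn j X Y" "\<sigma> \<subseteq> \<tau>" "X \<subseteq> Y"
    and dX: "\<And>\<sigma> \<tau>. \<tau> \<in> X \<Longrightarrow> \<sigma> \<subseteq> \<tau> \<Longrightarrow> \<sigma> \<in> X"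
    and dY: "\<And>\<sigma> \<tau>. \<tau> \<in> Y \<Longrightarrow> \<sigma> \<subseteq> \<tau> \<Longrightarrow> \<sigma> \<in> Y"
  shows "\<sigma> \<in> jn j X Y"
proof (cases "j \<in> \<tau>")
  case True
  then have "\<tau> - {j} \<in> X" using assms(1) by (simp add: jn_def)
  then have "\<sigma> - {j} \<in> X" by (rule dX) (use assms(2) in auto)
  then show ?thesis using assms(3) by (cases "j \<in> \<sigma>") (auto simp: jn_def)
next
  case False
  then have "j \<notin> \<sigma>" "\<tau> \<in> Y" using assms(1,2) by (auto simp: jn_def)
  then show ?thesis using dY assms(2) by (simp add: jn_def)
qed

text \<open>\<open>jn\<close> never consults members of the slices that contain \<open>j\<close>;
  hence both components are taken over sets avoiding \<open>j\<close>.\<close>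

lemma chn_decomp:
  assumes "y \<in> chn (jn j X Y) (Suc i)"
  obtains y1 y2 where "y = y1 + wdg j y2" "y1 \<in> chn {\<tau>\<in>Y. j \<notin> \<tau>} (Suc i)" "y2 \<in> chn {\<tau>\<in>X. j \<notin> \<tau>} i"
proof
  define y1 where "y1 \<tau> = (if j \<in> \<tau> then 0 else y \<tau>)" for \<tau>
  define y2 where "y2 \<tau> = (if j \<in> \<tau> then 0 else esgn j \<tau> * y (insert j \<tau>))" for \<tau>
  show "y = y1 + wdg j y2"
    by (auto simp: fun_eq_iff y1_def wdg_def y2_def insert_absorb)
  show "y1 \<in> chn {\<tau>\<in>Y. j \<notin> \<tau>} (Suc i)" using assms
    by (auto simp: chn_def y1_def jn_def split: if_splits)
  show "y2 \<in> chn {\<tau>\<in>X. j \<notin> \<tau>} i" unfolding chn_def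
  proof safe
    fix \<tau> assume "y2 \<tau> \<noteq> 0"
    then have *: "j \<notin> \<tau>" "y (insert j \<tau>) \<noteq> 0" unfolding y2_def by (metis mult_zero_right)+
    then have "insert j \<tau> \<in> jn j X Y" "card (insert j \<tau>) = Suc i" using assms by (auto simp: chn_def)
    with * show "\<tau> \<in> X" "card \<tau> = i" by (auto simp: jn_def)
    assume "j \<in> \<tau>" with * show False by simp
  qed
qed

lemma wdg_chn:
  assumes "c \<in> chn X i" 
  shows "wdg j c \<in> chn (jn j X Y) (Suc i)"
  unfolding chn_def
proof safe
  fix \<tau> assume "wdg j c \<tau> \<noteq> 0"
  then have "j \<in> \<tau>" "c (\<tau> - {j}) \<noteq> 0" unfolding wdg_def by (metis mult_zero_right)+
  then show "\<tau> \<in> jn j X Y" "card \<tau> = Suc i"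
    using assms by (auto simp: chn_def jn_def) (metis card_Suc_Diff1 finite)
qed

lemma chn_jn_base: "c \<in> chn {\<tau>\<in>Y. j \<notin> \<tau>} i \<Longrightarrow> c \<in> chn (jn j X Y) i"
  by (auto simp: chn_def jn_def)

lemma bd_avoid:
  assumes "c \<in> chn {\<tau>\<in>Y. j \<notin> \<tau>} i" "j \<in> \<tau>"
  shows "bd X c \<tau> = 0"
  unfolding bd_def by (rule sum.neutral) (use assms in \<open>auto simp: chn_def\<close>)

text \<open>
  Writing \<open>X\<close>, \<open>Y\<close>, \<open>Z\<close> for the slices, \<open>jn j X Y\<close> is the mapping cone of \<open>X \<subseteq> Y\<close>; the
  next two lemmas are parts of the exact triangle for the composite \<open>X \<subseteq> Y \<subseteq> Z\<close>.
\<close>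

lemma hnz_outer:
  assumes "X \<subseteq> Y" "Y \<subseteq> Z"
    and dX: "\<And>\<sigma> \<tau>. \<tau> \<in> X \<Longrightarrow> \<sigma> \<subseteq> \<tau> \<Longrightarrow> \<sigma> \<in> X"
    and dY: "\<And>\<sigma> \<tau>. \<tau> \<in> Y \<Longrightarrow> \<sigma> \<subseteq> \<tau> \<Longrightarrow> \<sigma> \<in> Y"
    and dZ: "\<And>\<sigma> \<tau>. \<tau> \<in> Z \<Longrightarrow> \<sigma> \<subseteq> \<tau> \<Longrightarrow> \<sigma> \<in> Z"
    and "hnz TYPE('k::field) (jn j X Z) i"
  shows "hnz TYPE('k) (jn j X Y) i \<or> hnz TYPE('k) (jn j Y Z) i"
proof (rule ccontr)
  assume neg: "\<not> ?thesis"
  obtain z :: "'a set \<Rightarrow> 'k" where z: "z \<in> chn (jn j X Z) i" "bd 1 z = 0"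
    "\<And>y. y \<in> chn (jn j X Z) (Suc i) \<Longrightarrow> bd 1 y \<noteq> z"
    using assms(6) unfolding hnz_def by blast
  have "jn j X Z \<subseteq> jn j Y Z" using assms(1) by (auto simp: jn_def)
  with z(1) have "z \<in> chn (jn j Y Z) i" by (rule chn_mono)
  with neg z(2) obtain y where y: "y \<in> chn (jn j Y Z) (Suc i)" "bd 1 y = z"
    unfolding hnz_def by blast
  from chn_decomp[OF y(1)] obtain y1 y2 where y12: "y = y1 + wdg j y2"
    "y1 \<in> chn {\<tau>\<in>Z. j \<notin> \<tau>} (Suc i)" "y2 \<in> chn {\<tau>\<in>Y. j \<notin> \<tau>} i" by blast
  \<comment> \<open>Subtracting the boundary of \<open>y1\<close> does not change the class in the
    cone of X in Z, and it leaves \<open>y2\<close> as the part without \<open>j\<close>, which lies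
    in Y.\<close>
  define z' where "z' = z - bd 1 y1"
  have z': "z' = y2 - wdg j (bd 1 y2)"
    using y(2) by (simp add: z'_def y12(1) bd_add bd_wdg_one flip: y(2))
  have "z' \<in> chn (jn j X Y) i" unfolding chn_def
  proof safe
    fix \<tau> assume nz: "z' \<tau> \<noteq> 0"
    have "z' \<in> chn (jn j X Z) i" unfolding z'_def
    proof (rule chn_diff[OF z(1)])
      have "y1 \<in> chn (jn j X Z) (Suc i)" using y12(2) by (rule chn_jn_base)
      moreover have "\<sigma> \<in> jn j X Z" if "\<tau> \<in> jn j X Z" "\<sigma> \<subseteq> \<tau>" for \<sigma> \<tau>
        using assms(1,2) by (intro jn_down[OF that]) (auto intro: dX dZ)
      ultimately show "bd 1 y1 \<in> chn (jn j X Z) i" by (intro bd_chn)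
    qed
    then have *: "\<tau> \<in> jn j X Z" "card \<tau> = i" using nz by (auto simp: chn_def)
    then show "card \<tau> = i" by simp
    show "\<tau> \<in> jn j X Y"
    proof (cases "j \<in> \<tau>")
      case True then show ?thesis using * by (auto simp: jn_def)
    next
      case False
      then have "y2 \<tau> \<noteq> 0" using nz by (auto simp: z' wdg_def)
      then show ?thesis using y12(3) False by (auto simp: jn_def chn_def)
    qed
  qed
  moreover have "bd 1 z' = 0" by (simp add: z'_def bd_diff z(2) bd_bd)
  ultimately obtain x where x: "x \<in> chn (jn j X Y) (Suc i)" "bd 1 x = z'"
    using neg unfolding hnz_def by blast
  have "jn j X Y \<subseteq> jn j X Z" using assms(2) by (auto simp: jn_def)
  then have "x + y1 \<in> chn (jn j X Z) (Suc i)"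
    by (intro chn_add[OF chn_mono[OF x(1)]] chn_jn_base[OF y12(2)])
  moreover have "bd 1 (x + y1) = z" by (simp add: bd_add x(2) z'_def)
  ultimately show False using z(3) by blast
qed

lemma hnz_inner:
  assumes "X \<subseteq> Y" "Y \<subseteq> Z"
    and dX: "\<And>\<sigma> \<tau>. \<tau> \<in> X \<Longrightarrow> \<sigma> \<subseteq> \<tau> \<Longrightarrow> \<sigma> \<in> X"
    and dY: "\<And>\<sigma> \<tau>. \<tau> \<in> Y \<Longrightarrow> \<sigma> \<subseteq> \<tau> \<Longrightarrow> \<sigma> \<in> Y"
    and dZ: "\<And>\<sigma> \<tau>. \<tau> \<in> Z \<Longrightarrow> \<sigma> \<subseteq> \<tau> \<Longrightarrow> \<sigma> \<in> Z"
    and "hnz TYPE('k::field) (jn j X Y) i"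
  shows "hnz TYPE('k) (jn j X Z) i \<or> hnz TYPE('k) (jn j Y Z) (Suc i)"
proof (rule ccontr)
  assume neg: "\<not> ?thesis"
  obtain z :: "'a set \<Rightarrow> 'k" where z: "z \<in> chn (jn j X Y) i" "bd 1 z = 0"
    "\<And>y. y \<in> chn (jn j X Y) (Suc i) \<Longrightarrow> bd 1 y \<noteq> z"
    using assms(6) unfolding hnz_def by blast
  have "jn j X Y \<subseteq> jn j X Z" using assms(2) by (auto simp: jn_def)
  with z(1) have "z \<in> chn (jn j X Z) i" by (rule chn_mono)
  with neg z(2) obtain y where y: "y \<in> chn (jn j X Z) (Suc i)" "bd 1 y = z"
    unfolding hnz_def by blast
  from chn_decomp[OF y(1)] obtain y1 y2 where y12: "y = y1 + wdg j y2"
    "y1 \<in> chn {\<tau>\<in>Z. j \<notin> \<tau>} (Suc i)" "y2 \<in> chn {\<tau>\<in>X. j \<notin> \<tau>} i" by blast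
  have e: "bd 1 y1 = z - y2 + wdg j (bd 1 y2)"
    by (simp add: y12(1) bd_add bd_wdg_one flip: y(2))
  have b1: "bd 1 y1 \<in> chn {\<tau>\<in>Y. j \<notin> \<tau>} i" unfolding chn_def
  proof safe
    fix \<tau> assume nz: "bd 1 y1 \<tau> \<noteq> 0"
    show j: False if "j \<in> \<tau>"
      using nz bd_avoid[OF y12(2) that] by simp
    have "bd 1 y1 \<in> chn {\<tau>\<in>Z. j \<notin> \<tau>} i" using y12(2) dZ by (intro bd_chn) auto
    then show "card \<tau> = i" using nz by (auto simp: chn_def)
    have "z \<tau> \<noteq> 0 \<or> y2 \<tau> \<noteq> 0" using nz j by (cases "j \<in> \<tau>") (auto simp: wdg_def e)
    then show "\<tau> \<in> Y" using z(1) y12(3) assms(1) j by (cases "j \<in> \<tau>") (auto simp: jn_def chn_def)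
  qed
  \<comment> \<open>The connecting map in reverse: \<open>y1\<close> has its boundary in Y, so it
    gives a cycle of the cone of Y in Z, one index higher.\<close>
  define c where "c = y1 - wdg j (bd 1 y1)"
  have "c \<in> chn (jn j Y Z) (Suc i)" unfolding c_def
    using y12(2) b1 by (intro chn_diff wdg_chn chn_jn_base) (auto simp: chn_def)
  moreover have "bd 1 c = 0"
    by (simp add: c_def bd_diff bd_bd bd_wdg_one)
  ultimately obtain u where u: "u \<in> chn (jn j Y Z) (Suc (Suc i))" "bd 1 u = c"
    using neg unfolding hnz_def by blast
  from chn_decomp[OF u(1)] obtain u1 u2 where u12: "u = u1 + wdg j u2"
    "u1 \<in> chn {\<tau>\<in>Z. j \<notin> \<tau>} (Suc (Suc i))" "u2 \<in> chn {\<tau>\<in>Y. j \<notin> \<tau>} (Suc i)" by blast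
  \<comment> \<open>These are the parts without \<open>j\<close> of the equation
    \<open>bd 1 u = c\<close>.\<close>
  have y1: "y1 = bd 1 u1 + u2"
  proof
    fix \<tau>
    show "y1 \<tau> = (bd 1 u1 + u2) \<tau>"
    proof (cases "j \<in> \<tau>")
      case True
      then have "y1 \<tau> = 0" "u2 \<tau> = 0" using y12(2) u12(3) by (auto simp: chn_def)
      then show ?thesis using bd_avoid[OF u12(2) True] by simp
    next
      case False
      have "bd 1 u1 + u2 - wdg j (bd 1 u2) = y1 - wdg j (bd 1 y1)"
        using u(2) by (simp add: c_def u12(1) bd_add bd_wdg_one algebra_simps)
      from fun_cong[OF this, of \<tau>] show ?thesis using False by (simp add: wdg_def)
    qed
  qed
  \<comment> \<open>In \<open>y\<close>, the summand \<open>y1\<close> may be replaced by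
    \<open>u2\<close>, since they differ by a boundary. As \<open>u2\<close> lives in Y, the filling
    of \<open>z\<close> now lies in the cone of X in Y.\<close>
  have "u2 + wdg j y2 \<in> chn (jn j X Y) (Suc i)"
    using u12(3) y12(3) by (intro chn_add wdg_chn chn_jn_base) (auto simp: chn_def)
  moreover have "bd 1 (u2 + wdg j y2) = z"
    using y(2) by (simp add: y12(1) bd_add y1 bd_bd)
  ultimately show False using z(3) by blast
qed


section \<open>Cubes in an up-set of exponent vectors\<close>

definition upset :: "('v \<Rightarrow> 'a::order) set \<Rightarrow> bool" where
  "upset A \<longleftrightarrow> (\<forall>x\<in>A. \<forall>y. (\<forall>v. x v \<le> y v) \<longrightarrow> y \<in> A)"

text \<open>For an up-set \<open>A\<close> and \<open>p \<le> q\<close> this is a simplicial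
  complex, since shrinking \<tau> moves the corner up.\<close>

definition cube :: "('v \<Rightarrow> int) set \<Rightarrow> ('v \<Rightarrow> int) \<Rightarrow> ('v \<Rightarrow> int) \<Rightarrow> 'v set set" where
  "cube A p q = {\<tau>. (\<lambda>v. if v \<in> \<tau> then p v else q v) \<in> A}"

lemma upsetD: "upset A \<Longrightarrow> x \<in> A \<Longrightarrow> (\<And>v. x v \<le> y v) \<Longrightarrow> y \<in> A"
  by (auto simp: upset_def)

text \<open>Coordinate \<open>j\<close> is overridden by \<open>t\<close>, so membership of
  \<open>j\<close> in \<tau> has no influence; this fits \<open>jn\<close>.\<close>

definition slice :: "('v \<Rightarrow> int) set \<Rightarrow> ('v \<Rightarrow> int) \<Rightarrow> ('v \<Rightarrow> int) \<Rightarrow> 'v \<Rightarrow> int \<Rightarrow> 'v set set" where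
  "slice A p q j t = {\<tau>. (\<lambda>v. if v = j then t else if v \<in> \<tau> then p v else q v) \<in> A}"

lemma cube_jn: "cube A p q = jn j (slice A p q j (p j)) (slice A p q j (q j))"
proof -
  have "(\<lambda>v. if v \<in> \<tau> then p v else q v) =
     (\<lambda>v. if v = j then p j else if v \<in> \<tau> - {j} then p v else q v)" if "j \<in> \<tau>" for \<tau>
    using that by auto
  moreover have "(\<lambda>v. if v \<in> \<tau> then p v else q v) =
     (\<lambda>v. if v = j then q j else if v \<in> \<tau> then p v else q v)" if "j \<notin> \<tau>" for \<tau>
    using that by auto
  ultimately have "\<tau> \<in> cube A p q \<longleftrightarrow> \<tau> \<in> jn j (slice A p q j (p j)) (slice A p q j (q j))" for \<tau>
    by (cases "j \<in> \<tau>") (simp_all add: cube_def jn_def slice_def)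
  then show ?thesis by blast
qed

lemma slice_upd [simp]:
  "slice A (p(j := s)) q j t = slice A p q j t" "slice A p (q(j := s)) j t = slice A p q j t"
  by (simp_all add: slice_def cong: if_cong)

lemma slice_mono: "upset A \<Longrightarrow> s \<le> t \<Longrightarrow> slice A p q j s \<subseteq> slice A p q j t"
  unfolding slice_def by clarify (erule (1) upsetD, simp)

lemma slice_down:
  assumes "upset A" "\<And>v. p v \<le> q v" "\<tau> \<in> slice A p q j t" "\<sigma> \<subseteq> \<tau>"
  shows "\<sigma> \<in> slice A p q j t"
  using assms(3) unfolding slice_def mem_Collect_eq
  by (rule upsetD[OF assms(1)]) (use assms(2,4) in auto)

context
  fixes A :: "('v::finite \<Rightarrow> int) set" and p q :: "'v \<Rightarrow> int" and j :: 'v and r :: int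
  assumes A: "upset A" and pq: "\<And>v. p v \<le> q v" and r: "p j \<le> r" "r \<le> q j"
begin

lemma cube_upd:
  "cube A (p(j := s)) (q(j := t)) = jn j (slice A p q j s) (slice A p q j t)"
  by (subst cube_jn[of _ _ _ j]) simp

text \<open>The step from \<open>p j\<close> to \<open>q j\<close> is the composite of two steps
  meeting at \<open>r\<close>; this is exactness at the cone of the composite.\<close>

lemma hnz_cube_split:
  assumes "hnz TYPE('k::field) (cube A p q) i"
  shows "hnz TYPE('k) (cube A p (q(j := r))) i \<or> hnz TYPE('k) (cube A (p(j := r)) q) i"
  using hnz_outer[where X = "slice A p q j (p j)" and Y = "slice A p q j r" and Z = "slice A p q j (q j)" and j = j and i = i,
      OF slice_mono[OF A r(1)] slice_mono[OF A r(2)] slice_down[OF A pq] slice_down[OF A pq] slice_down[OF A pq]] assms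
    cube_upd[of "p j" "r"] cube_upd[of "p j" "q j"] cube_upd[of r "q j"] by simp

text \<open>Either the step can be lengthened at the same index, or the remaining step carries
  homology one index higher. A unit of degree is thus traded for a unit of index.\<close>

lemma hnz_cube_extend:
  assumes "hnz TYPE('k::field) (cube A p (q(j := r))) i"
  shows "hnz TYPE('k) (cube A p q) i \<or> hnz TYPE('k) (cube A (p(j := r)) q) (Suc i)"
  using hnz_inner[where X = "slice A p q j (p j)" and Y = "slice A p q j r" and Z = "slice A p q j (q j)" and j = j and i = i,
      OF slice_mono[OF A r(1)] slice_mono[OF A r(2)] slice_down[OF A pq] slice_down[OF A pq] slice_down[OF A pq]] assms
    cube_upd[of "p j" "r"] cube_upd[of "p j" "q j"] cube_upd[of r "q j"] by simp

end

lemma not_hnz_cube_eq: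
  assumes "p j = q j"
  shows "\<not> hnz TYPE('k::field) (cube A p q) i"
proof (rule hnz_cone)
  fix \<tau> assume "\<tau> \<in> cube A p q"
  moreover have "(\<lambda>v. if v \<in> insert j \<tau> then p v else q v) = (\<lambda>v. if v \<in> \<tau> then p v else q v)"
    using assms by auto
  ultimately show "insert j \<tau> \<in> cube A p q" by (simp add: cube_def)
qed

text \<open>
  The passage between Koszul homology (unit cubes) and the Cech complex, whose cubes reach up
  to a bound \<open>N\<close> beyond which membership in \<open>A\<close> no longer changes.
\<close>

lemma hnz_unit_to_long:
  fixes A :: "('v::finite \<Rightarrow> int) set"
  assumes A: "upset A" and "hnz TYPE('k::field) (cube A (\<lambda>v. a v - 1) a) i" and aN: "\<And>v. a v \<le> N v"
  shows "\<exists>b i'. (\<forall>v. b v \<le> N v) \<and> hnz TYPE('k) (cube A b N) i' \<and>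
     (\<Sum>v\<in>UNIV. b v) + int (card (UNIV :: 'v set)) + int i = (\<Sum>v\<in>UNIV. a v) + int i'"
proof -
  \<comment> \<open>\<open>T\<close> holds the coordinates already lengthened. Treating
    \<open>j\<close> leaves either \<open>b j = a j - 1\<close> and the same index, or
    \<open>b j = a j\<close> and the index raised by one; the difference of degree and index is the
    same in both cases.\<close>
  define Q where "Q T \<longleftrightarrow> (\<exists>b i'. (\<forall>v\<in>T. b v \<le> N v) \<and> (\<forall>v. v \<notin> T \<longrightarrow> b v = a v - 1) \<and>
     hnz TYPE('k) (cube A b (\<lambda>v. if v \<in> T then N v else a v)) i' \<and>
     (\<Sum>v\<in>T. b v) + int (card T) + int i = (\<Sum>v\<in>T. a v) + int i')" for T
  have "finite (UNIV :: 'v set)" by simp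
  then have "Q UNIV"
  proof induct
    case empty
    show ?case unfolding Q_def using assms(2) by (intro exI[of _ "\<lambda>v. a v - 1"] exI[of _ i]) simp
  next
    case (insert j T)
    then obtain b i' where b: "\<And>v. v \<in> T \<Longrightarrow> b v \<le> N v" "\<And>v. v \<notin> T \<Longrightarrow> b v = a v - 1"
      "hnz TYPE('k) (cube A b (\<lambda>v. if v \<in> T then N v else a v)) i'"
      "(\<Sum>v\<in>T. b v) + int (card T) + int i = (\<Sum>v\<in>T. a v) + int i'" unfolding Q_def by blast
    define q where "q = (\<lambda>v. if v \<in> insert j T then N v else a v)"
    have q: "(\<lambda>v. if v \<in> T then N v else a v) = q(j := a j)" using insert(2) by (auto simp: q_def)
    have bj: "b j = a j - 1" using b(2) insert(2) by simp
    have "b v \<le> q v" for v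
      using b(1,2)[of v] aN[of v] bj by (auto simp: q_def)
    from hnz_cube_extend[where 'k = 'k and i = i' and j = j and r = "a j", OF A this] b(3) q aN bj
    consider "hnz TYPE('k) (cube A b q) i'" | "hnz TYPE('k) (cube A (b(j := a j)) q) (Suc i')"
      by (force simp: q_def)
    then show ?case
    proof cases
      case 1
      then show ?thesis unfolding Q_def using b aN[of j] bj insert(1,2)
        by (intro exI[of _ b] exI[of _ i']) (auto simp: q_def)
    next
      case 2
      have "(\<Sum>v\<in>T. (b(j := a j)) v) = (\<Sum>v\<in>T. b v)" using insert(2) by (intro sum.cong) auto
      then show ?thesis unfolding Q_def using b aN[of j] bj insert(1,2) 2
        by (intro exI[of _ "b(j := a j)"] exI[of _ "Suc i'"]) (auto simp: q_def)
    qed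
  qed
  then show ?thesis unfolding Q_def by auto
qed

text \<open>Cutting off the lowest unit step repeatedly traps the homology in a single unit step, at
  the same index. The step cannot shrink to length zero, since the cube would become a cone.\<close>

lemma hnz_long_to_unit_at:
  fixes A :: "('v::finite \<Rightarrow> int) set"
  assumes A: "upset A" and "hnz TYPE('k::field) (cube A p q) i" and pq: "\<And>v. p v \<le> q v"
  shows "\<exists>c. p j < c \<and> c \<le> q j \<and> hnz TYPE('k) (cube A (p(j := c - 1)) (q(j := c))) i"
  using assms(2,3)
proof (induction "nat (q j - p j)" arbitrary: p)
  case 0
  then have "p j = q j" using 0(3)[of j] by simp
  then show ?case using not_hnz_cube_eq 0(2) by blast
next
  case (Suc n)
  then have lt: "p j < q j" by simp
  from hnz_cube_split[where j = j and r = "p j + 1", OF A Suc(4) _ _ Suc(3)] lt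
  consider "hnz TYPE('k) (cube A p (q(j := p j + 1))) i" | "hnz TYPE('k) (cube A (p(j := p j + 1)) q) i"
    by force
  then show ?case
  proof cases
    case 1
    then show ?thesis using lt by (intro exI[of _ "p j + 1"]) auto
  next
    case 2
    have "\<exists>c. (p(j := p j + 1)) j < c \<and> c \<le> q j \<and>
        hnz TYPE('k) (cube A ((p(j := p j + 1))(j := c - 1)) (q(j := c))) i"
      by (rule Suc(1)[OF _ 2]) (use lt Suc(2,4) in auto)
    then show ?thesis by force
  qed
qed

text \<open>Strictness of \<open>p v < c v\<close> is what keeps the value from decreasing: it
  yields one unit of degree for every variable.\<close>

lemma hnz_long_to_unit:
  fixes A :: "('v::finite \<Rightarrow> int) set"
  assumes A: "upset A" and "hnz TYPE('k::field) (cube A p q) i" and pq: "\<And>v. p v \<le> q v"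
  shows "\<exists>c. (\<forall>v. p v < c v \<and> c v \<le> q v) \<and> hnz TYPE('k) (cube A (\<lambda>v. c v - 1) c) i"
proof -
  define Q where "Q T \<longleftrightarrow> (\<exists>c. (\<forall>v. p v < c v \<and> c v \<le> q v) \<and>
     hnz TYPE('k) (cube A (\<lambda>v. if v \<in> T then c v - 1 else p v) (\<lambda>v. if v \<in> T then c v else q v)) i)" for T
  have lt: "p v < q v" for v
    using not_hnz_cube_eq[of p v q] assms(2) pq[of v] by force
  have "finite (UNIV :: 'v set)" by simp
  then have "Q UNIV"
  proof induct
    case empty
    show ?case unfolding Q_def using assms(2) lt by (intro exI[of _ q]) simp
  next
    case (insert j T)
    then obtain c where c: "\<And>v. p v < c v" "\<And>v. c v \<le> q v"
      "hnz TYPE('k) (cube A (\<lambda>v. if v \<in> T then c v - 1 else p v) (\<lambda>v. if v \<in> T then c v else q v)) i"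
      unfolding Q_def by blast
    have "(if v \<in> T then c v - 1 else p v) \<le> (if v \<in> T then c v else q v)" for v
      using pq by simp
    from hnz_long_to_unit_at[OF A c(3) this, of j] insert(2) obtain t where t: "p j < t" "t \<le> q j"
      "hnz TYPE('k) (cube A ((\<lambda>v. if v \<in> T then c v - 1 else p v)(j := t - 1))
          ((\<lambda>v. if v \<in> T then c v else q v)(j := t))) i" by auto
    have "(\<lambda>v. if v \<in> insert j T then (c(j := t)) v - 1 else p v) = (\<lambda>v. if v \<in> T then c v - 1 else p v)(j := t - 1)"
      "(\<lambda>v. if v \<in> insert j T then (c(j := t)) v else q v) = (\<lambda>v. if v \<in> T then c v else q v)(j := t)"
      using insert(2) by auto
    then show ?case unfolding Q_def using t c(1,2) by (intro exI[of _ "c(j := t)"]) auto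
  qed
  then show ?thesis unfolding Q_def by simp
qed


section \<open>Multigraded pieces of polynomial chains\<close>

abbreviation "keys \<equiv> Poly_Mapping.keys"
abbreviation "lookup \<equiv> Poly_Mapping.lookup"
abbreviation "monom1 v \<equiv> Poly_Mapping.single v (1::nat)"

definition mon :: "('v::finite \<Rightarrow> nat) \<Rightarrow> 'v \<Rightarrow>\<^sub>0 nat" where
  "mon = Poly_Mapping.Abs_poly_mapping"

lemma lookup_mon [simp]: "lookup (mon f) = f"
  by (simp add: mon_def)

lemma mon_lookup [simp]: "mon (lookup m) = m"
  by (simp add: mon_def)

lemma mdeg_alt: "mdeg (m :: 'v::finite \<Rightarrow>\<^sub>0 nat) = (\<Sum>v\<in>UNIV. lookup m v)"
  unfolding mdeg_def by (rule sum.mono_neutral_left) (auto simp: in_keys_iff)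

lemma mdeg_add: "mdeg (m + m' :: 'v::finite \<Rightarrow>\<^sub>0 nat) = mdeg m + mdeg m'"
  by (simp add: mdeg_alt lookup_add sum.distrib)

lemma mdeg_zero [simp]: "mdeg 0 = 0"
  by (simp add: mdeg_def)

lemma mdeg_eq_0_iff [simp]: "mdeg (m :: 'v::finite \<Rightarrow>\<^sub>0 nat) = 0 \<longleftrightarrow> m = 0"
  by (auto simp: mdeg_alt intro: poly_mapping_eqI)

lemma mdeg_monom1 [simp]: "mdeg (Poly_Mapping.single v (Suc 0)) = Suc 0"
  by (simp add: mdeg_def)

lemma poly_expand: "f = (\<Sum>m\<in>keys f. Poly_Mapping.single m (lookup f m))"
  by (rule poly_mapping_eqI) (simp add: lookup_sum lookup_single when_def in_keys_iff)

lemma lookup_times: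
  fixes f g :: "('v \<Rightarrow>\<^sub>0 nat) \<Rightarrow>\<^sub>0 'k::comm_ring_1"
  shows "lookup (f * g) n = (\<Sum>m\<in>keys f. \<Sum>m'\<in>keys g. if m + m' = n then lookup f m * lookup g m' else 0)"
proof -
  have "f * g = (\<Sum>m\<in>keys f. \<Sum>m'\<in>keys g. Poly_Mapping.single (m + m') (lookup f m * lookup g m'))"
    by (subst (1) poly_expand, subst (2) poly_expand) (simp add: sum_product mult_single)
  then show ?thesis by (simp add: lookup_sum lookup_single when_def)
qed

lemma lookup_single_times:
  fixes f :: "('v \<Rightarrow>\<^sub>0 nat) \<Rightarrow>\<^sub>0 'k::comm_ring_1"
  shows "lookup (Poly_Mapping.single k c * f) (k + m) = c * lookup f m"
proof -
  have "lookup (Poly_Mapping.single k c * f) (k + m) = (\<Sum>m'\<in>keys f. if m' = m then c * lookup f m' else 0)"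
    by (auto simp: lookup_times intro!: sum.cong)
  then show ?thesis by (simp add: in_keys_iff)
qed

lemma keys_single_times:
  fixes f :: "('v \<Rightarrow>\<^sub>0 nat) \<Rightarrow>\<^sub>0 'k::comm_ring_1"
  assumes "n \<in> keys (Poly_Mapping.single k c * f)"
  obtains m where "m \<in> keys f" "n = k + m"
  using keys_mult[of "Poly_Mapping.single k c" f] assms by (auto split: if_splits)

lemma lookup_indet_times:
  fixes f :: "('v::finite, 'k::field) mpoly"
  shows "lookup (indet v * f) (mon x) = (if x v \<ge> 1 then lookup f (mon (x(v := x v - 1))) else 0)"
proof (cases "x v \<ge> 1")
  case True
  then have "mon x = monom1 v + mon (x(v := x v - 1))"
    by (intro poly_mapping_eqI) (auto simp: lookup_add lookup_single when_def)
  then show ?thesis using True lookup_single_times[of "monom1 v" "1::'k" f "mon (x(v := x v - 1))"]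
    by (simp add: indet_def)
next
  case False
  have "mon x \<notin> keys (indet v * f)"
  proof
    assume "mon x \<in> keys (indet v * f)"
    then obtain m where "mon x = monom1 v + m" unfolding indet_def by (rule keys_single_times)
    then have "x v = 1 + lookup m v" by (metis lookup_mon lookup_add lookup_single_eq)
    then show False using False by simp
  qed
  then show ?thesis using False by (simp add: in_keys_iff)
qed

lemma keys_indet_times:
  assumes "n \<in> keys (indet v * f)"
  obtains m where "m \<in> keys f" "n = monom1 v + m"
  using assms unfolding indet_def by (rule keys_single_times)



lemma lookup_esgn_times:
  "lookup (esgn v \<tau> * f) m = esgn v \<tau> * lookup (f :: ('v::finite, 'k::field) mpoly) m"
  unfolding esgn_def by (cases "even (card {u \<in> \<tau>. vidx u < vidx v})") auto

lemma keys_esgn_times [simp]: "keys (esgn v \<tau> * f) = keys (f :: ('v::finite, 'k::field) mpoly)"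
  unfolding esgn_def by (cases "even (card {u \<in> \<tau>. vidx u < vidx v})") (auto simp: in_keys_iff)

text \<open>Subtraction is truncated, so this is the intended corner only where \<open>a\<close> is
  positive on \<tau>; \<open>mpart\<close> carries that guard.\<close>

definition lower :: "'v set \<Rightarrow> ('v \<Rightarrow> nat) \<Rightarrow> 'v \<Rightarrow> nat" where
  "lower \<tau> a v = (if v \<in> \<tau> then a v - 1 else a v)"

definition raise :: "'v set \<Rightarrow> ('v \<Rightarrow> nat) \<Rightarrow> 'v \<Rightarrow> nat" where
  "raise \<tau> a v = (if v \<in> \<tau> then a v + 1 else a v)"

lemma lower_raise [simp]: "lower \<tau> (raise \<tau> a) = a"
  by (auto simp: lower_def raise_def)

lemma raise_lower: "(\<And>v. v \<in> \<tau> \<Longrightarrow> a v \<ge> 1) \<Longrightarrow> raise \<tau> (lower \<tau> a) = a"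
  by (fastforce simp: lower_def raise_def)

lemma lower_insert: "v \<notin> \<tau> \<Longrightarrow> (lower \<tau> a)(v := a v - 1) = lower (insert v \<tau>) a"
  by (auto simp: lower_def)

lemma raise_ge: "v \<in> \<tau> \<Longrightarrow> raise \<tau> a v \<ge> Suc 0"
  by (auto simp: raise_def)

text \<open>
  The component in degree \<open>a\<close> of a chain in the Koszul complex, where the basis element of \<open>\<tau>\<close>
  has degree the indicator function of \<open>\<tau>\<close>.
\<close>

definition mpart :: "('v::finite set \<Rightarrow> ('v, 'k::field) mpoly) \<Rightarrow> ('v \<Rightarrow> nat) \<Rightarrow> 'v set \<Rightarrow> 'k" where
  "mpart c a \<tau> = (if \<forall>v\<in>\<tau>. a v \<ge> 1 then lookup (c \<tau>) (mon (lower \<tau> a)) else 0)"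

text \<open>Glues a family of multigraded components to a polynomial chain, inverting
  \<open>mpart\<close>. It is meaningful when only finitely many components are nonzero.\<close>

definition unpart :: "(('v::finite \<Rightarrow> nat) \<Rightarrow> 'v set \<Rightarrow> 'k::field) \<Rightarrow> 'v set \<Rightarrow> ('v, 'k) mpoly" where
  "unpart g \<tau> = Poly_Mapping.Abs_poly_mapping (\<lambda>m. g (raise \<tau> (lookup m)) \<tau>)"

lemma lookup_mpart: "lookup (c \<tau>) m = mpart c (raise \<tau> (lookup m)) \<tau>"
  by (auto simp: mpart_def raise_ge)

lemma mpart_inject: "(\<And>a. mpart c a = mpart c' a) \<Longrightarrow> c = c'"
  by (intro ext poly_mapping_eqI) (metis lookup_mpart)

lemma lookup_unpart:
  assumes "finite {a. g a \<noteq> 0}"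
  shows "lookup (unpart g \<tau>) m = g (raise \<tau> (lookup m)) \<tau>"
proof -
  have "{m. g (raise \<tau> (lookup m)) \<tau> \<noteq> 0} \<subseteq> (\<lambda>a. mon (lower \<tau> a)) ` {a. g a \<noteq> 0}"
    by (force simp: image_iff intro: exI[of _ "raise \<tau> (lookup _)"])
  then have "finite {m. g (raise \<tau> (lookup m)) \<tau> \<noteq> 0}"
    using assms finite_surj by blast
  then show ?thesis unfolding unpart_def by simp
qed

lemma mpart_unpart:
  assumes "finite {a. g a \<noteq> 0}" "\<And>a \<tau> v. g a \<tau> \<noteq> 0 \<Longrightarrow> v \<in> \<tau> \<Longrightarrow> a v \<ge> 1"
  shows "mpart (unpart g) a = g a"
proof
  fix \<tau>
  show "mpart (unpart g) a \<tau> = g a \<tau>"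
    using assms(2)[of a \<tau>] by (auto simp: mpart_def lookup_unpart[OF assms(1)] raise_lower)
qed

lemma finite_mpart: "finite {a. mpart c a \<noteq> 0}"
proof -
  have "{a. mpart c a \<noteq> 0} \<subseteq> (\<Union>\<tau>\<in>UNIV. (\<lambda>m. raise \<tau> (lookup m)) ` keys (c \<tau>))"
  proof
    fix a assume "a \<in> {a. mpart c a \<noteq> 0}"
    then obtain \<tau> where "mpart c a \<tau> \<noteq> 0" by (auto simp: fun_eq_iff)
    then have "mon (lower \<tau> a) \<in> keys (c \<tau>)" "raise \<tau> (lower \<tau> a) = a"
      by (auto simp: mpart_def in_keys_iff raise_lower split: if_splits)
    then show "a \<in> (\<Union>\<tau>\<in>UNIV. (\<lambda>m. raise \<tau> (lookup m)) ` keys (c \<tau>))"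
      by (metis (mono_tags, lifting) UN_iff UNIV_I image_iff lookup_mon)
  qed
  then show ?thesis by (rule finite_subset) auto
qed

text \<open>Multiplication by \<open>indet v\<close> shifts the multidegree exactly as the basis
  vector of \<open>v\<close> does, so in a fixed multidegree every variable becomes 1.\<close>

lemma mpart_bd: "mpart (bd indet c) a = bd 1 (mpart c a)"
proof
  fix \<tau> :: "'a set"
  show "mpart (bd indet c) a \<tau> = bd 1 (mpart c a) \<tau>"
  proof (cases "\<forall>v\<in>\<tau>. a v \<ge> 1")
    case True
    have "mpart (bd indet c) a \<tau> = (\<Sum>v\<in>-\<tau>. esgn v \<tau> * lookup (indet v * c (insert v \<tau>)) (mon (lower \<tau> a)))"
      using True by (simp add: mpart_def bd_def lookup_sum mult.assoc lookup_esgn_times)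
    also have "\<dots> = (\<Sum>v\<in>-\<tau>. esgn v \<tau> * 1 v * mpart c a (insert v \<tau>))"
      using True by (intro sum.cong) (simp_all add: lookup_indet_times lower_insert[symmetric] mpart_def, simp add: lower_def)
    finally show ?thesis by (simp add: bd_def)
  next
    case False
    then have "mpart c a (insert v \<tau>) = 0" for v by (auto simp: mpart_def)
    then show ?thesis using False by (simp add: bd_def) (auto simp: mpart_def)
  qed
qed

lemma wdg_nz: "wdg j c \<tau> \<noteq> 0 \<Longrightarrow> j \<in> \<tau> \<and> c (\<tau> - {j}) \<noteq> 0"
  by (auto simp: wdg_def split: if_splits)

text \<open>In multidegree \<open>a \<noteq> 0\<close> the homotopy \<open>wdg j\<close> works for
  any \<open>j\<close> with \<open>a j \<ge> 1\<close>; in multidegree 0 only the constant term at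
  the empty set could survive. The second conclusion, that terms of \<open>y\<close> arise from
  terms of \<open>c\<close> by dividing by a variable, preserves degrees and zero
  coordinates.\<close>

lemma koszul_exact:
  fixes c :: "'v::finite set \<Rightarrow> ('v, 'k::field) mpoly"
  assumes "bd indet c = 0" "lookup (c {}) 0 = 0"
  obtains y where "bd indet y = c"
    "\<And>\<tau> m. m \<in> keys (y \<tau>) \<Longrightarrow> \<exists>v\<in>\<tau>. monom1 v + m \<in> keys (c (\<tau> - {v}))"
proof
  define j where "j a = (SOME v. a v \<ge> (1::nat))" for a :: "'v \<Rightarrow> nat"
  define g where "g a = (if a = (\<lambda>_. 0) then 0 else wdg (j a) (mpart c a))" for a
  have j: "a (j a) \<ge> 1" if "a \<noteq> (\<lambda>_. 0)" for a
  proof -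
    have "\<exists>v. a v \<ge> 1" using that by (auto simp: fun_eq_iff Suc_le_eq)
    then show ?thesis unfolding j_def by (rule someI_ex)
  qed
  have fin: "finite {a. g a \<noteq> 0}"
    by (rule finite_subset[OF _ finite_mpart[of c]]) (auto simp: g_def split: if_splits)
  have supp: "a v \<ge> 1" if "g a \<tau> \<noteq> 0" "v \<in> \<tau>" for a \<tau> v
  proof -
    have "a \<noteq> (\<lambda>_. 0)" and "j a \<in> \<tau> \<and> mpart c a (\<tau> - {j a}) \<noteq> 0"
      using that wdg_nz[of "j a" "mpart c a" \<tau>] by (auto simp: g_def split: if_splits)
    then show ?thesis using j[of a] that(2) by (cases "v = j a") (auto simp: mpart_def split: if_splits)
  qed
  have mp: "mpart (unpart g) a = g a" for a by (rule mpart_unpart[OF fin]) (rule supp)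
  show "bd indet (unpart g) = c"
  proof (rule mpart_inject)
    fix a
    show "mpart (bd indet (unpart g)) a = mpart c a"
    proof (cases "a = (\<lambda>_. 0)")
      case True
      have "mpart c a = 0"
      proof
        fix \<tau>
        have "mon (lower {} (\<lambda>_. 0)) = (0 :: 'v \<Rightarrow>\<^sub>0 nat)" by (rule poly_mapping_eqI) (simp add: lower_def)
        then show "mpart c a \<tau> = 0 \<tau>" using assms(2) True
          by (cases "\<tau> = {}") (auto simp: mpart_def)
      qed
      then show ?thesis using True by (simp add: mpart_bd mp g_def)
    next
      case False
      have "bd 1 (mpart c a) = 0"
        unfolding mpart_bd[symmetric] assms(1) by (auto simp: mpart_def fun_eq_iff)
      then show ?thesis using False by (simp add: mpart_bd mp g_def bd_wdg_one)
    qed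
  qed
  fix \<tau> m assume "m \<in> keys (unpart g \<tau>)"
  then have nz: "g (raise \<tau> (lookup m)) \<tau> \<noteq> 0" by (simp add: in_keys_iff lookup_unpart[OF fin])
  define a where "a = raise \<tau> (lookup m)"
  have *: "j a \<in> \<tau>" "mpart c a (\<tau> - {j a}) \<noteq> 0"
    using nz wdg_nz[of "j a" "mpart c a" \<tau>] by (auto simp: g_def a_def[symmetric] split: if_splits)
  have "mon (lower (\<tau> - {j a}) a) = monom1 (j a) + m"
    using *(1) by (intro poly_mapping_eqI) (auto simp: lookup_add lower_def a_def raise_def lookup_single when_def)
  then have "monom1 (j a) + m \<in> keys (c (\<tau> - {j a}))"
    using *(2) by (auto simp: mpart_def in_keys_iff split: if_splits)
  then show "\<exists>v\<in>\<tau>. monom1 v + m \<in> keys (c (\<tau> - {v}))" using *(1) by blast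
qed


section \<open>Graded Koszul homology of submodules of free modules\<close>

definition submod :: "(nat \<Rightarrow> 'a::comm_ring_1) set \<Rightarrow> bool" where
  "submod M \<longleftrightarrow> 0 \<in> M \<and> (\<forall>u\<in>M. \<forall>u'\<in>M. u + u' \<in> M) \<and> (\<forall>f. \<forall>u\<in>M. (\<lambda>b. f * u b) \<in> M)"

lemma submod_sum:
  assumes "submod M" "\<And>x. x \<in> X \<Longrightarrow> h x \<in> M"
  shows "(\<lambda>b. \<Sum>x\<in>X. f x * h x b) \<in> M"
proof -
  have 0: "(\<lambda>b. 0) \<in> M" using assms(1) by (simp add: submod_def zero_fun_def)
  show ?thesis using assms(2)
  proof (induct X rule: infinite_finite_induct)
    case (insert x X)
    then have "(\<lambda>b. f x * h x b) \<in> M" "(\<lambda>b. \<Sum>x\<in>X. f x * h x b) \<in> M"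
      using assms(1) by (auto simp: submod_def)
    then have "(\<lambda>b. f x * h x b) + (\<lambda>b. \<Sum>x\<in>X. f x * h x b) \<in> M"
      using assms(1) by (auto simp: submod_def)
    then show ?case using insert(1,2) by (simp add: plus_fun_def)
  qed (use 0 in simp_all)
qed

lemma submod_diff:
  assumes "submod M" "u \<in> M" "u' \<in> M"
  shows "u - u' \<in> M"
proof -
  have "(\<lambda>b. (-1) * u' b) \<in> M" using assms unfolding submod_def by blast
  then have "u + (\<lambda>b. (-1) * u' b) \<in> M" using assms unfolding submod_def by blast
  also have "u + (\<lambda>b. (-1) * u' b) = u - u'" by auto
  finally show ?thesis .
qed

lemma submod_free [simp]: "submod (free_module r)"
  by (auto simp: submod_def free_module_def)

definition kbd :: "('v::finite set \<Rightarrow> nat \<Rightarrow> ('v, 'k::field) mpoly) \<Rightarrow> 'v set \<Rightarrow> nat \<Rightarrow> ('v, 'k) mpoly" where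
  "kbd c = (\<lambda>\<tau> b. bd indet (\<lambda>\<sigma>. c \<sigma> b) \<tau>)"

text \<open>
  \<open>kchn M s p d\<close> is the degree \<open>d\<close> part of the \<open>p\<close>-th term of the Koszul complex of \<open>M\<close>, where
  \<open>M\<close> is a submodule of a free module whose \<open>b\<close>-th basis element has degree \<open>s b\<close>.
\<close>

definition kchn :: "(nat \<Rightarrow> ('v::finite, 'k::field) mpoly) set \<Rightarrow> (nat \<Rightarrow> nat) \<Rightarrow> nat \<Rightarrow> nat \<Rightarrow>
    ('v set \<Rightarrow> nat \<Rightarrow> ('v, 'k) mpoly) set" where
  "kchn M s p d = {c. \<forall>\<tau>. c \<tau> \<in> M \<and> (\<forall>b. \<forall>m\<in>keys (c \<tau> b). card \<tau> = p \<and> mdeg m + p + s b = d)}"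

text \<open>Non-vanishing of the degree \<open>d\<close> part of Tor of index \<open>p\<close> of
  \<open>M\<close> with the residue field.\<close>

definition knz :: "(nat \<Rightarrow> ('v::finite, 'k::field) mpoly) set \<Rightarrow> (nat \<Rightarrow> nat) \<Rightarrow> nat \<Rightarrow> nat \<Rightarrow> bool" where
  "knz M s p d \<longleftrightarrow> (\<exists>z\<in>kchn M s p d. kbd z = 0 \<and> (\<forall>y\<in>kchn M s (Suc p) d. kbd y \<noteq> z))"

lemma kbd_kbd: "kbd (kbd c) = 0"
proof (intro ext)
  fix \<tau> b
  have "kbd (kbd c) \<tau> b = bd indet (bd indet (\<lambda>\<sigma>. c \<sigma> b)) \<tau>" by (simp add: kbd_def)
  then show "kbd (kbd c) \<tau> b = 0 \<tau> b" by (simp add: bd_bd)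
qed

lemma kbd_diff: "kbd (c - c') = kbd c - kbd c'"
proof (intro ext)
  fix \<tau> b
  have "(\<lambda>\<sigma>. (c - c') \<sigma> b) = (\<lambda>\<sigma>. c \<sigma> b) - (\<lambda>\<sigma>. c' \<sigma> b)" by auto
  then show "kbd (c - c') \<tau> b = (kbd c - kbd c') \<tau> b"
    by (simp add: kbd_def bd_diff)
qed

lemma kbd_in:
  assumes "submod M" "\<And>\<tau>. c \<tau> \<in> M"
  shows "kbd c \<tau> \<in> M"
  using submod_sum[OF assms(1), of "-\<tau>" "\<lambda>v. c (insert v \<tau>)" "\<lambda>v. esgn v \<tau> * indet v"] assms(2)
  by (simp add: kbd_def bd_def)

lemma keys_kbd:
  assumes "m \<in> keys (kbd c \<tau> b)"
  obtains v m' where "v \<notin> \<tau>" "m' \<in> keys (c (insert v \<tau>) b)" "m = monom1 v + m'"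
proof -
  have "m \<in> (\<Union>v\<in>-\<tau>. keys (esgn v \<tau> * (indet v * c (insert v \<tau>) b)))"
    using assms keys_sum[of "\<lambda>v. esgn v \<tau> * (indet v * c (insert v \<tau>) b)" "-\<tau>"]
    by (auto simp: kbd_def bd_def mult.assoc)
  then obtain v where "v \<notin> \<tau>" "m \<in> keys (indet v * c (insert v \<tau>) b)" by auto
  with that show thesis by (blast elim: keys_indet_times)
qed

lemma kbd_kchn:
  assumes "submod M" "c \<in> kchn M s (Suc p) d"
  shows "kbd c \<in> kchn M s p d"
proof -
  have "card \<tau> = p \<and> mdeg m + p + s b = d" if "m \<in> keys (kbd c \<tau> b)" for \<tau> b m
  proof -
    from that obtain v m' where v: "v \<notin> \<tau>" "m' \<in> keys (c (insert v \<tau>) b)" "m = monom1 v + m'"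
      by (rule keys_kbd)
    then have "card (insert v \<tau>) = Suc p" "mdeg m' + Suc p + s b = d"
      using assms(2) unfolding kchn_def by blast+
    then show ?thesis using v by (simp add: mdeg_add)
  qed
  moreover have "kbd c \<tau> \<in> M" for \<tau> by (rule kbd_in[OF assms(1)]) (use assms(2) in \<open>simp add: kchn_def\<close>)
  ultimately show ?thesis unfolding kchn_def by blast
qed

lemma kchn_diff:
  assumes "submod M" "c \<in> kchn M s p d" "c' \<in> kchn M s p d"
  shows "c - c' \<in> kchn M s p d"
  using assms submod_diff[OF assms(1)] keys_diff unfolding kchn_def by fastforce

lemma kbd_zero_chain:
  assumes "c \<in> kchn M s 0 d"
  shows "kbd c = 0"
proof (intro ext)
  fix \<tau> b
  have "keys (kbd c \<tau> b) = {}"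
  proof (rule equals0I)
    fix m assume "m \<in> keys (kbd c \<tau> b)"
    then obtain v m' where "m' \<in> keys (c (insert v \<tau>) b)" by (rule keys_kbd)
    then have "card (insert v \<tau>) = 0" using assms unfolding kchn_def by blast
    then show False by simp
  qed
  then show "kbd c \<tau> b = 0 \<tau> b" by simp
qed

lemma free_koszul_exact:
  fixes z :: "'v::finite set \<Rightarrow> nat \<Rightarrow> ('v, 'k::field) mpoly"
  assumes "z \<in> kchn (free_module r) s p d" "kbd z = 0" "\<And>b. lookup (z {} b) 0 = 0"
  obtains y where "y \<in> kchn (free_module r) s (Suc p) d" "kbd y = z"
proof -
  have "\<exists>y. bd indet y = (\<lambda>\<tau>. z \<tau> b) \<and>
    (\<forall>\<tau>. \<forall>m\<in>keys (y \<tau>). \<exists>v\<in>\<tau>. monom1 v + m \<in> keys (z (\<tau> - {v}) b))" for b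
  proof -
    have "bd indet (\<lambda>\<tau>. z \<tau> b) = 0" using assms(2) by (simp add: kbd_def fun_eq_iff)
    then show ?thesis using koszul_exact[of "\<lambda>\<tau>. z \<tau> b"] assms(3) by metis
  qed
  then obtain y where y: "\<And>b. bd indet (y b) = (\<lambda>\<tau>. z \<tau> b)"
    "\<And>b \<tau> m. m \<in> keys (y b \<tau>) \<Longrightarrow> \<exists>v\<in>\<tau>. monom1 v + m \<in> keys (z (\<tau> - {v}) b)"
    by metis
  show thesis
  proof
    show "kbd (\<lambda>\<tau> b. y b \<tau>) = z" using y(1) by (simp add: kbd_def)
    have "y b \<tau> = 0" if "b \<ge> r" for b \<tau>
    proof -
      have "z \<sigma> b = 0" for \<sigma> using assms(1) that by (auto simp: kchn_def free_module_def)
      then have "m \<notin> keys (y b \<tau>)" for m using y(2)[of m b \<tau>] by auto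
      then show ?thesis using keys_eq_empty by blast
    qed
    moreover have "card \<tau> = Suc p \<and> mdeg m + Suc p + s b = d" if "m \<in> keys (y b \<tau>)" for m b \<tau>
    proof -
      from y(2)[OF that] obtain v where v: "v \<in> \<tau>" "monom1 v + m \<in> keys (z (\<tau> - {v}) b)" by blast
      then have "card (\<tau> - {v}) = p" "mdeg (monom1 v + m) + p + s b = d"
        using assms(1) unfolding kchn_def by blast+
      then show ?thesis using v(1) card_Suc_Diff1[of \<tau> v] by (simp add: mdeg_add)
    qed
    ultimately show "(\<lambda>\<tau> b. y b \<tau>) \<in> kchn (free_module r) s (Suc p) d"
      unfolding kchn_def free_module_def by blast
  qed
qed

subsection \<open>Homogeneous parts\<close>

definition prestr :: "'a set \<Rightarrow> ('a \<Rightarrow>\<^sub>0 'k::zero) \<Rightarrow> 'a \<Rightarrow>\<^sub>0 'k" where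
  "prestr S f = Poly_Mapping.Abs_poly_mapping (\<lambda>m. if m \<in> S then lookup f m else 0)"

lemma lookup_prestr: "lookup (prestr S f) m = (if m \<in> S then lookup f m else 0)"
proof -
  have "finite {m. (if m \<in> S then lookup f m else 0) \<noteq> 0}"
    by (rule finite_subset[OF _ finite_keys[of f]]) (auto simp: in_keys_iff)
  then show ?thesis unfolding prestr_def by simp
qed

lemma keys_prestr: "keys (prestr S f) = keys f \<inter> S"
  by (auto simp: in_keys_iff lookup_prestr split: if_splits)

lemma prestr_id: "keys f \<subseteq> S \<Longrightarrow> prestr S f = f"
  by (rule poly_mapping_eqI) (auto simp: lookup_prestr in_keys_iff)

lemma prestr_sum: "prestr S (\<Sum>x\<in>X. f x) = (\<Sum>x\<in>X. prestr S (f x))"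
  by (rule poly_mapping_eqI) (simp add: lookup_prestr lookup_sum)

lemma prestr_mult_homog:
  fixes f g :: "('v::finite \<Rightarrow>\<^sub>0 nat) \<Rightarrow>\<^sub>0 'k::comm_ring_1"
  assumes "\<And>m. m \<in> keys g \<Longrightarrow> mdeg m + s = s'"
  shows "prestr {m. mdeg m + s = d} (g * f) = g * prestr {m. mdeg m + s' = d} f"
proof (rule poly_mapping_eqI)
  fix n
  have "lookup (g * prestr {m. mdeg m + s' = d} f) n =
    (\<Sum>m\<in>keys g. \<Sum>m'\<in>keys f \<inter> {m. mdeg m + s' = d}. if m + m' = n then lookup g m * lookup f m' else 0)"
    unfolding lookup_times keys_prestr by (intro sum.cong) (auto simp: lookup_prestr)
  also have "\<dots> = (\<Sum>m\<in>keys g. \<Sum>m'\<in>keys f. if mdeg m' + s' = d \<and> m + m' = n then lookup g m * lookup f m' else 0)"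
    by (intro sum.cong sum.mono_neutral_cong_left) auto
  also have "\<dots> = (\<Sum>m\<in>keys g. \<Sum>m'\<in>keys f. if mdeg n + s = d \<and> m + m' = n then lookup g m * lookup f m' else 0)"
  proof (intro sum.cong refl if_cong)
    fix m m' assume "m \<in> keys g" "m' \<in> keys f"
    then show "(mdeg m' + s' = d \<and> m + m' = n) = (mdeg n + s = d \<and> m + m' = n)"
      using assms[of m] by (auto simp: mdeg_add)
  qed
  also have "\<dots> = lookup (prestr {m. mdeg m + s = d} (g * f)) n"
    by (simp add: lookup_prestr lookup_times)
  finally show "lookup (prestr {m. mdeg m + s = d} (g * f)) n = lookup (g * prestr {m. mdeg m + s' = d} f) n"
    by simp
qed

definition dpart :: "(nat \<Rightarrow> nat) \<Rightarrow> nat \<Rightarrow> (nat \<Rightarrow> ('v::finite, 'k::field) mpoly) \<Rightarrow> nat \<Rightarrow> ('v, 'k) mpoly" where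
  "dpart s d u b = prestr {m. mdeg m + s b = d} (u b)"

lemma dpart_id: "(\<And>b m. m \<in> keys (u b) \<Longrightarrow> mdeg m + s b = d) \<Longrightarrow> dpart s d u = u"
  by (rule ext) (auto simp: dpart_def intro!: prestr_id)

lemma dpart_zero [simp]: "dpart s d 0 = 0"
  by (rule dpart_id) simp

lemma dpart_free: "u \<in> free_module r \<Longrightarrow> dpart s d u \<in> free_module r"
  by (auto simp: free_module_def dpart_def intro: prestr_id)

lemma keys_dpart: "m \<in> keys (dpart s d u b) \<longleftrightarrow> m \<in> keys (u b) \<and> mdeg m + s b = d"
  by (simp add: dpart_def keys_prestr)

subsection \<open>Maps of free modules\<close>

definition gmap :: "nat \<Rightarrow> nat \<Rightarrow> (nat \<Rightarrow> nat \<Rightarrow> 'r::comm_ring_1) \<Rightarrow> (nat \<Rightarrow> 'r) \<Rightarrow> nat \<Rightarrow> 'r" where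
  "gmap r r' G u a = (if a < r then \<Sum>b<r'. G a b * u b else 0)"

definition gker :: "nat \<Rightarrow> nat \<Rightarrow> (nat \<Rightarrow> nat \<Rightarrow> 'r::comm_ring_1) \<Rightarrow> (nat \<Rightarrow> 'r) set" where
  "gker r r' G = {u \<in> free_module r'. gmap r r' G u = 0}"

definition gimg :: "nat \<Rightarrow> nat \<Rightarrow> (nat \<Rightarrow> nat \<Rightarrow> 'r::comm_ring_1) \<Rightarrow> (nat \<Rightarrow> 'r) set" where
  "gimg r r' G = gmap r r' G ` free_module r'"

lemma gmap_add: "gmap r r' G (u + u') = gmap r r' G u + gmap r r' G u'"
  by (auto simp: gmap_def fun_eq_iff distrib_left sum.distrib)

lemma gmap_diff: "gmap r r' G (u - u') = gmap r r' G u - gmap r r' G u'"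
  by (auto simp: gmap_def fun_eq_iff right_diff_distrib sum_subtractf)

lemma gmap_zero [simp]: "gmap r r' G 0 = 0"
  by (auto simp: gmap_def fun_eq_iff)

lemma gmap_scale: "gmap r r' G (\<lambda>b. f * u b) = (\<lambda>a. f * gmap r r' G u a)"
  by (auto simp: gmap_def fun_eq_iff sum_distrib_left mult_ac)

lemma submod_gker: "submod (gker r r' G)"
  using submod_free[of r'] unfolding submod_def gker_def
  by (auto simp: gmap_add gmap_scale)

lemma kbd_gmap: "kbd (\<lambda>\<tau>. gmap r r' G (c \<tau>)) = (\<lambda>\<tau>. gmap r r' G (kbd c \<tau>))"
proof (intro ext)
  fix \<tau> a
  have "(\<Sum>b<r'. G a b * (\<Sum>v\<in>-\<tau>. esgn v \<tau> * indet v * c (insert v \<tau>) b)) =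
    (\<Sum>v\<in>-\<tau>. esgn v \<tau> * indet v * (\<Sum>b<r'. G a b * c (insert v \<tau>) b))"
    unfolding sum_distrib_left by (subst sum.swap) (simp add: mult_ac)
  then show "kbd (\<lambda>\<tau>. gmap r r' G (c \<tau>)) \<tau> a = gmap r r' G (kbd c \<tau>) a"
    by (simp add: kbd_def bd_def gmap_def)
qed

locale homog_map =
  fixes r r' :: nat and s s' :: "nat \<Rightarrow> nat" and G :: "nat \<Rightarrow> nat \<Rightarrow> ('v::finite, 'k::field) mpoly"
  assumes hom: "\<And>a b m. a < r \<Longrightarrow> b < r' \<Longrightarrow> m \<in> keys (G a b) \<Longrightarrow> mdeg m + s a = s' b"
begin

abbreviation "\<phi> \<equiv> gmap r r' G"

lemma dpart_gmap: "dpart s d (\<phi> u) = \<phi> (dpart s' d u)"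
proof
  fix a
  show "dpart s d (\<phi> u) a = \<phi> (dpart s' d u) a"
  proof (cases "a < r")
    case True
    then show ?thesis using prestr_mult_homog[of "G a _" "s a" "s' _" d, OF hom[OF True]]
      by (auto simp: dpart_def gmap_def prestr_sum intro!: sum.cong)
  next
    case False
    then show ?thesis by (simp add: dpart_def gmap_def) (rule prestr_id, simp)
  qed
qed

text \<open>Preimages chosen separately for each \<tau> need not be homogeneous; as \<phi> commutes
  with \<open>dpart\<close>, cutting them down to the right degree keeps them preimages.\<close>

lemma lift_kchn:
  assumes "c \<in> kchn (gimg r r' G) s p d"
  obtains e where "e \<in> kchn (free_module r') s' p d" "(\<lambda>\<tau>. \<phi> (e \<tau>)) = c"
proof -
  have "c \<tau> \<in> \<phi> ` free_module r'" for \<tau> using assms by (simp add: kchn_def gimg_def)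
  then have "\<forall>\<tau>. \<exists>u\<in>free_module r'. \<phi> u = c \<tau>" by (auto simp: image_iff) metis
  then obtain f where f: "\<And>\<tau>. f \<tau> \<in> free_module r'" "\<And>\<tau>. \<phi> (f \<tau>) = c \<tau>" by metis
  \<comment> \<open>The test \<open>p \<le> d\<close> protects the truncated difference
    \<open>d - p\<close>.\<close>
  define e where "e \<tau> = (if card \<tau> = p \<and> p \<le> d then dpart s' (d - p) (f \<tau>) else 0)" for \<tau>
  have "\<phi> (e \<tau>) = c \<tau>" for \<tau>
  proof (cases "card \<tau> = p \<and> p \<le> d")
    case True
    have "dpart s (d - p) (c \<tau>) = c \<tau>"
    proof (rule dpart_id)
      fix b m assume "m \<in> keys (c \<tau> b)"
      then have "mdeg m + p + s b = d" using assms unfolding kchn_def by blast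
      then show "mdeg m + s b = d - p" by simp
    qed
    then show ?thesis using True f(2)[of \<tau>] by (simp add: e_def dpart_gmap[symmetric])
  next
    case False
    have "keys (c \<tau> b) = {}" for b
    proof (rule equals0I)
      fix m assume "m \<in> keys (c \<tau> b)"
      then have "card \<tau> = p \<and> mdeg m + p + s b = d" using assms unfolding kchn_def by blast
      then show False using False by simp
    qed
    then have "c \<tau> = 0" by (auto simp: fun_eq_iff)
    moreover have "e \<tau> = 0" unfolding e_def using False by (rule if_not_P)
    ultimately show ?thesis by simp
  qed
  moreover have "e \<in> kchn (free_module r') s' p d"
  proof -
    have "e \<tau> \<in> free_module r'" for \<tau>
      using f(1)[of \<tau>] dpart_free submod_free[of r', unfolded submod_def] by (auto simp: e_def)
    then show ?thesis
      by (auto simp: kchn_def e_def keys_dpart split: if_splits)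
  qed
  ultimately show thesis using that by blast
qed

lemma push_kchn:
  assumes "e \<in> kchn (free_module r') s' p d"
  shows "(\<lambda>\<tau>. \<phi> (e \<tau>)) \<in> kchn (gimg r r' G) s p d"
proof -
  have "card \<tau> = p \<and> mdeg m + p + s a = d" if "m \<in> keys (\<phi> (e \<tau>) a)" for m \<tau> a
  proof -
    have a: "a < r" and "m \<in> (\<Union>b<r'. keys (G a b * e \<tau> b))"
      using that keys_sum[of "\<lambda>b. G a b * e \<tau> b" "{..<r'}"]
      by (auto simp: gmap_def split: if_splits)
    then obtain b where b: "b < r'" "m \<in> keys (G a b * e \<tau> b)" by blast
    then obtain m1 m2 where m: "m = m1 + m2" "m1 \<in> keys (G a b)" "m2 \<in> keys (e \<tau> b)"
      using keys_mult by blast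
    have "card \<tau> = p \<and> mdeg m2 + p + s' b = d" using assms m(3) unfolding kchn_def by blast
    then show ?thesis using hom[OF a b(1) m(2)] m(1) by (simp add: mdeg_add)
  qed
  then show ?thesis using assms unfolding kchn_def gimg_def by blast
qed

end

text \<open>Minimality says that the kernel lies in the maximal ideal times the free module. In this
  form it can be required of a single map, before a next matrix has been chosen.\<close>

locale minimal_map = homog_map +
  assumes minimal: "\<And>u b. u \<in> gker r r' G \<Longrightarrow> lookup (u b) 0 = 0"
begin

text \<open>
  The long exact sequence of \<open>0 \<rightarrow> ker \<rightarrow> F \<rightarrow> im \<rightarrow> 0\<close>, where the Koszul homology of \<open>F\<close> is
  concentrated in degree \<open>0\<close>, and the kernel maps to zero there by minimality.
\<close>

lemma knz_shift: "knz (gimg r r' G) s (Suc p) d \<longleftrightarrow> knz (gker r r' G) s' p d"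
proof
  assume "knz (gimg r r' G) s (Suc p) d"
  then obtain z where z: "z \<in> kchn (gimg r r' G) s (Suc p) d" "kbd z = 0"
    "\<And>y. y \<in> kchn (gimg r r' G) s (Suc (Suc p)) d \<Longrightarrow> kbd y \<noteq> z" unfolding knz_def by blast
  from z(1) obtain c where c: "c \<in> kchn (free_module r') s' (Suc p) d" "(\<lambda>\<tau>. \<phi> (c \<tau>)) = z"
    by (rule lift_kchn)
  \<comment> \<open>The connecting map: the boundary of a lift of the cycle \<open>z\<close> lies in
    the kernel.\<close>
  have "\<phi> (kbd c \<tau>) = 0" for \<tau> using kbd_gmap[of r r' G c] c(2) z(2) by (auto simp: fun_eq_iff)
  then have n: "kbd c \<in> kchn (gker r r' G) s' p d"
    using kbd_kchn[OF submod_free c(1)] by (auto simp: kchn_def gker_def)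
  show "knz (gker r r' G) s' p d" unfolding knz_def
  proof (intro bexI[OF _ n] conjI ballI notI)
    show "kbd (kbd c) = 0" by (rule kbd_kbd)
    fix y assume y: "y \<in> kchn (gker r r' G) s' (Suc p) d" "kbd y = kbd c"
    then have y': "y \<in> kchn (free_module r') s' (Suc p) d" by (auto simp: kchn_def gker_def)
    have cy: "c - y \<in> kchn (free_module r') s' (Suc p) d" by (rule kchn_diff[OF submod_free c(1) y'])
    have "kbd (c - y) = 0" by (simp add: kbd_diff y(2))
    moreover have "lookup ((c - y) {} b) 0 = 0" for b
    proof (rule ccontr)
      assume "lookup ((c - y) {} b) 0 \<noteq> 0"
      then have "0 \<in> keys ((c - y) {} b)" by (simp add: in_keys_iff)
      then have "card ({} :: 'a set) = Suc p" using cy unfolding kchn_def by blast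
      then show False by simp
    qed
    ultimately obtain e where e: "e \<in> kchn (free_module r') s' (Suc (Suc p)) d" "kbd e = c - y"
      using free_koszul_exact[OF cy] by blast
    have "\<phi> (y \<tau>) = 0" for \<tau> using y(1) by (auto simp: kchn_def gker_def)
    then have "kbd (\<lambda>\<tau>. \<phi> (e \<tau>)) = z"
      by (simp add: kbd_gmap e(2) gmap_diff flip: c(2))
    then show False using z(3) push_kchn[OF e(1)] by blast
  qed
next
  assume "knz (gker r r' G) s' p d"
  then obtain n where n: "n \<in> kchn (gker r r' G) s' p d" "kbd n = 0"
    "\<And>y. y \<in> kchn (gker r r' G) s' (Suc p) d \<Longrightarrow> kbd y \<noteq> n" unfolding knz_def by blast
  have n': "n \<in> kchn (free_module r') s' p d" using n(1) by (auto simp: kchn_def gker_def)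
  \<comment> \<open>By minimality the constant terms vanish, which removes the only obstruction to
    bounding \<open>n\<close> in the free module.\<close>
  have "lookup (n {} b) 0 = 0" for b using n(1) by (intro minimal) (simp add: kchn_def)
  from free_koszul_exact[OF n' n(2) this] obtain e
    where e: "e \<in> kchn (free_module r') s' (Suc p) d" "kbd e = n" by blast
  have n0: "\<phi> (n \<tau>) = 0" for \<tau> using n(1) by (auto simp: kchn_def gker_def)
  show "knz (gimg r r' G) s (Suc p) d" unfolding knz_def
  proof (intro bexI[OF _ push_kchn[OF e(1)]] conjI ballI notI)
    show "kbd (\<lambda>\<tau>. \<phi> (e \<tau>)) = 0" by (auto simp: kbd_gmap e(2) n0 fun_eq_iff)
    fix y assume y: "y \<in> kchn (gimg r r' G) s (Suc (Suc p)) d" "kbd y = (\<lambda>\<tau>. \<phi> (e \<tau>))"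
    from y(1) obtain g where g: "g \<in> kchn (free_module r') s' (Suc (Suc p)) d" "(\<lambda>\<tau>. \<phi> (g \<tau>)) = y"
      by (rule lift_kchn)
    have eg: "e - kbd g \<in> kchn (free_module r') s' (Suc p) d"
      by (rule kchn_diff[OF submod_free e(1) kbd_kchn[OF submod_free g(1)]])
    have "\<phi> (kbd g \<tau>) = \<phi> (e \<tau>)" for \<tau> using kbd_gmap[of r r' G g] g(2) y(2) by (simp add: fun_eq_iff)
    then have "e - kbd g \<in> kchn (gker r r' G) s' (Suc p) d"
      using eg by (simp add: kchn_def gker_def gmap_diff)
    moreover have "kbd (e - kbd g) = n" by (simp add: kbd_diff kbd_kbd e(2))
    ultimately show False using n(3) by blast
  qed
qed

text \<open>Index 0 of Koszul homology is the image modulo the maximal ideal. If the image of a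
  basis vector vanished there, a kernel element would have constant term 1; conversely a chain
  without constant terms is a boundary.\<close>

lemma knz_generators: "knz (gimg r r' G) s 0 d \<longleftrightarrow> (\<exists>b<r'. s' b = d)"
proof
  assume "\<exists>b<r'. s' b = d"
  then obtain b where b: "b < r'" "s' b = d" by blast
  define e :: "'a set \<Rightarrow> nat \<Rightarrow> ('a, 'b) mpoly" where "e \<tau> b' = (if \<tau> = {} \<and> b' = b then 1 else 0)" for \<tau> b'
  have e: "e \<in> kchn (free_module r') s' 0 d"
    using b by (auto simp: kchn_def free_module_def e_def split: if_splits)
  show "knz (gimg r r' G) s 0 d" unfolding knz_def
  proof (intro bexI[OF _ push_kchn[OF e]] conjI ballI notI)
    show "kbd (\<lambda>\<tau>. \<phi> (e \<tau>)) = 0" by (rule kbd_zero_chain[OF push_kchn[OF e]])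
    fix y assume y: "y \<in> kchn (gimg r r' G) s (Suc 0) d" "kbd y = (\<lambda>\<tau>. \<phi> (e \<tau>))"
    from y(1) obtain g where g: "g \<in> kchn (free_module r') s' (Suc 0) d" "(\<lambda>\<tau>. \<phi> (g \<tau>)) = y"
      by (rule lift_kchn)
    have "kchn (free_module r') s' 0 d \<subseteq> {c. \<forall>\<tau>. c \<tau> \<in> free_module r'}" by (auto simp: kchn_def)
    then have "e {} - kbd g {} \<in> free_module r'"
      using e kbd_kchn[OF submod_free g(1)] submod_diff[OF submod_free] by blast
    moreover have "\<phi> (kbd g {}) = \<phi> (e {})" using kbd_gmap[of r r' G g] g(2) y(2) by (simp add: fun_eq_iff)
    ultimately have "lookup ((e {} - kbd g {}) b) 0 = 0"
      by (intro minimal[of "e {} - kbd g {}"]) (simp add: gker_def gmap_diff)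
    moreover have "0 \<notin> keys (kbd g {} b)"
    proof
      assume "0 \<in> keys (kbd g {} b)"
      then obtain v m' where "v \<notin> ({} :: 'a set)" "m' \<in> keys (g (insert v {}) b)" "0 = monom1 v + m'"
        by (rule keys_kbd)
      then have "mdeg (monom1 v + m') = 0" by (metis mdeg_zero)
      then show False by (simp add: mdeg_add)
    qed
    ultimately show False by (simp add: e_def lookup_minus in_keys_iff)
  qed
next
  assume "knz (gimg r r' G) s 0 d"
  then obtain z where z: "z \<in> kchn (gimg r r' G) s 0 d"
    "\<And>y. y \<in> kchn (gimg r r' G) s (Suc 0) d \<Longrightarrow> kbd y \<noteq> z" unfolding knz_def by blast
  from z(1) obtain c where c: "c \<in> kchn (free_module r') s' 0 d" "(\<lambda>\<tau>. \<phi> (c \<tau>)) = z"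
    by (rule lift_kchn)
  show "\<exists>b<r'. s' b = d"
  proof (rule ccontr)
    assume no: "\<not> ?thesis"
    have "lookup (c {} b) 0 = 0" for b
    proof (rule ccontr)
      assume nz: "lookup (c {} b) 0 \<noteq> 0"
      have "c {} \<in> free_module r'" using c(1) by (simp add: kchn_def)
      then have "c {} b = 0" if "r' \<le> b" using that by (simp add: free_module_def)
      then have "b < r'" using nz by (cases "b < r'") simp_all
      moreover have "0 \<in> keys (c {} b)" using nz by (simp add: in_keys_iff)
      then have "mdeg (0 :: 'a \<Rightarrow>\<^sub>0 nat) + 0 + s' b = d" using c(1) unfolding kchn_def by blast
      ultimately show False using no by simp
    qed
    from free_koszul_exact[OF c(1) kbd_zero_chain[OF c(1)] this] obtain y
      where y: "y \<in> kchn (free_module r') s' (Suc 0) d" "kbd y = c" by blast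
    have "kbd (\<lambda>\<tau>. \<phi> (y \<tau>)) = z" by (simp add: kbd_gmap y(2) c(2))
    then show False using z(2) push_kchn[OF y(1)] by blast
  qed
qed

end


section \<open>Koszul homology of monomial ideals\<close>

definition mono_ideal :: "('v \<Rightarrow> nat) set \<Rightarrow> ('v, 'k::field) mpoly set" where
  "mono_ideal A = {f. \<forall>m\<in>keys f. lookup m \<in> A}"

text \<open>An ideal viewed inside the free module of rank one, so that ideals and syzygies are
  handled alike.\<close>

definition emb :: "'a::zero set \<Rightarrow> (nat \<Rightarrow> 'a) set" where
  "emb J = {u. u 0 \<in> J \<and> (\<forall>b\<ge>1. u b = 0)}"

definition embc :: "('b \<Rightarrow> 'a::zero) \<Rightarrow> 'b \<Rightarrow> nat \<Rightarrow> 'a" where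
  "embc c \<tau> b = (if b = 0 then c \<tau> else 0)"

text \<open>Integer exponents, because lower corners of cubes can be negative; such vectors never
  belong to the ideal.\<close>

definition ints :: "('v \<Rightarrow> nat) set \<Rightarrow> ('v \<Rightarrow> int) set" where
  "ints A = {x. (\<forall>v. 0 \<le> x v) \<and> (\<lambda>v. nat (x v)) \<in> A}"

text \<open>For an up-set: the ideal is generated by monomials with exponents at most
  \<open>B\<close>.\<close>

definition bounded_by :: "('v \<Rightarrow> nat) \<Rightarrow> ('v \<Rightarrow> nat) set \<Rightarrow> bool" where
  "bounded_by B A \<longleftrightarrow> (\<forall>x\<in>A. (\<lambda>v. min (x v) (B v)) \<in> A)"

text \<open>For a natural exponent this is the upper Koszul simplicial complex of the monomial ideal
  in that degree.\<close>

abbreviation ucube :: "('v::finite \<Rightarrow> nat) set \<Rightarrow> ('v \<Rightarrow> int) \<Rightarrow> 'v set set" where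
  "ucube A a \<equiv> cube (ints A) (\<lambda>v. a v - 1) a"

lemma upset_ints:
  assumes "upset A"
  shows "upset (ints A)"
  unfolding upset_def
proof (intro ballI allI impI)
  fix x y :: "'a \<Rightarrow> int" assume x: "x \<in> ints A" and "\<forall>v. x v \<le> y v"
  then have le: "x v \<le> y v" for v by blast
  have "(\<lambda>v. nat (x v)) \<in> A" using x by (simp add: ints_def)
  then have "(\<lambda>v. nat (y v)) \<in> A" by (rule upsetD[OF assms]) (rule nat_mono[OF le])
  moreover have "0 \<le> x v" for v using x by (simp add: ints_def)
  then have "0 \<le> y v" for v using le order_trans by blast
  ultimately show "y \<in> ints A" by (simp add: ints_def)
qed

lemma ucube_iff:
  "\<tau> \<in> ucube A (\<lambda>v. int (a v)) \<longleftrightarrow> (\<forall>v\<in>\<tau>. a v \<ge> 1) \<and> lower \<tau> a \<in> A"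
proof -
  have "(\<lambda>v. nat (if v \<in> \<tau> then int (a v) - 1 else int (a v))) = lower \<tau> a"
    by (auto simp: lower_def fun_eq_iff)
  then show ?thesis by (auto simp: cube_def ints_def)
qed

lemma sum_raise: "(\<Sum>v\<in>UNIV. raise \<tau> x v) = (\<Sum>v\<in>UNIV. x v) + card (\<tau> :: 'v::finite set)"
proof -
  have "(\<Sum>v\<in>UNIV. raise \<tau> x v) = (\<Sum>v\<in>UNIV. x v + (if v \<in> \<tau> then 1 else 0))"
    by (rule sum.cong) (auto simp: raise_def)
  also have "\<dots> = (\<Sum>v\<in>UNIV. x v) + card \<tau>" by (simp add: sum.distrib sum.If_cases)
  finally show ?thesis .
qed

lemma kbd_embc: "kbd (embc c) = embc (bd indet c)"
  by (auto simp: kbd_def embc_def fun_eq_iff bd_def)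

lemma kchn_embE:
  assumes "z \<in> kchn (emb J) s p d"
  obtains c where "z = embc c"
proof
  show "z = embc (\<lambda>\<tau>. z \<tau> 0)"
    using assms by (auto simp: kchn_def emb_def embc_def fun_eq_iff Suc_le_eq)
qed

lemma embc_kchn_iff:
  "embc c \<in> kchn (emb (mono_ideal A)) (\<lambda>_. 0) p d \<longleftrightarrow>
    (\<forall>a. mpart c a \<in> chn (ucube A (\<lambda>v. int (a v))) p \<and> (mpart c a \<noteq> 0 \<longrightarrow> (\<Sum>v\<in>UNIV. a v) = d))"
  (is "?L \<longleftrightarrow> ?R")
proof -
  have L: "?L \<longleftrightarrow> (\<forall>\<tau>. \<forall>m\<in>keys (c \<tau>). lookup m \<in> A \<and> card \<tau> = p \<and> mdeg m + p = d)"
    by (auto simp: kchn_def emb_def mono_ideal_def embc_def)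
  show ?thesis
  proof
    assume ?L
    have "\<tau> \<in> ucube A (\<lambda>v. int (a v)) \<and> card \<tau> = p \<and> (\<Sum>v\<in>UNIV. a v) = d" if "mpart c a \<tau> \<noteq> 0" for a \<tau>
    proof -
      have 1: "\<forall>v\<in>\<tau>. a v \<ge> 1" "mon (lower \<tau> a) \<in> keys (c \<tau>)"
        using that by (auto simp: mpart_def in_keys_iff split: if_splits)
      then have 2: "lower \<tau> a \<in> A" "card \<tau> = p" "(\<Sum>v\<in>UNIV. lower \<tau> a v) + p = d"
        using \<open>?L\<close>[unfolded L] by (fastforce simp: mdeg_alt)+
      have "raise \<tau> (lower \<tau> a) = a" using 1 by (intro raise_lower) auto
      then show ?thesis using sum_raise[of \<tau> "lower \<tau> a"] 1 2 by (simp add: ucube_iff)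
    qed
    then show ?R by (fastforce simp: chn_def fun_eq_iff)
  next
    assume R: ?R
    have "lookup m \<in> A \<and> card \<tau> = p \<and> mdeg m + p = d" if "m \<in> keys (c \<tau>)" for m \<tau>
    proof -
      define a where "a = raise \<tau> (lookup m)"
      have nz: "mpart c a \<tau> \<noteq> 0" using that by (simp add: a_def lookup_mpart[symmetric] in_keys_iff)
      then have "\<tau> \<in> ucube A (\<lambda>v. int (a v))" "card \<tau> = p" using R by (auto simp: chn_def)
      moreover have "(\<Sum>v\<in>UNIV. a v) = d" using R nz by (metis zero_fun_apply)
      ultimately show ?thesis by (simp add: ucube_iff a_def sum_raise mdeg_alt)
    qed
    then show ?L by (simp add: L)
  qed
qed

lemma chn_zero: "0 \<in> chn D i"
  by (simp add: chn_def)

text \<open>The Koszul complex of a monomial ideal is the direct sum of its multigraded parts, and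
  the part in degree \<open>a\<close> is the chain complex of \<open>ucube\<close>.\<close>

theorem knz_mono_ideal:
  "knz (emb (mono_ideal A :: ('v::finite, 'k::field) mpoly set)) (\<lambda>_. 0) p d \<longleftrightarrow>
    (\<exists>a. (\<Sum>v\<in>UNIV. a v) = d \<and> hnz TYPE('k) (ucube A (\<lambda>v. int (a v))) p)"
    (is "knz ?M _ p d \<longleftrightarrow> _")
proof
  assume "knz ?M (\<lambda>_. 0) p d"
  then obtain z where z: "z \<in> kchn ?M (\<lambda>_. 0) p d" "kbd z = 0"
    "\<And>y. y \<in> kchn ?M (\<lambda>_. 0) (Suc p) d \<Longrightarrow> kbd y \<noteq> z" unfolding knz_def by blast
  from z(1) obtain c where c: "z = embc c" by (rule kchn_embE)
  have cc: "mpart c a \<in> chn (ucube A (\<lambda>v. int (a v))) p" "mpart c a \<noteq> 0 \<Longrightarrow> (\<Sum>v\<in>UNIV. a v) = d" for a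
    using z(1) unfolding c embc_kchn_iff by blast+
  have "bd indet c = 0"
  proof
    fix \<tau> show "bd indet c \<tau> = 0 \<tau>"
      using fun_cong[OF fun_cong[OF z(2)], of \<tau> 0] by (simp add: c kbd_embc embc_def)
  qed
  moreover have "mpart 0 a = 0" for a :: "'v \<Rightarrow> nat" by (auto simp: mpart_def fun_eq_iff)
  ultimately have cyc: "bd 1 (mpart c a) = 0" for a by (simp flip: mpart_bd)
  show "\<exists>a. (\<Sum>v\<in>UNIV. a v) = d \<and> hnz TYPE('k) (ucube A (\<lambda>v. int (a v))) p"
  proof (rule ccontr)
    assume no: "\<not> ?thesis"
    \<comment> \<open>Zero components get the filling 0, so that only finitely many fillings are
      nonzero and \<open>unpart\<close> applies.\<close>
    have "\<exists>y\<in>chn (ucube A (\<lambda>v. int (a v))) (Suc p). bd 1 y = mpart c a \<and> (mpart c a = 0 \<longrightarrow> y = 0)" for a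
    proof (cases "mpart c a = 0")
      case True
      then show ?thesis using chn_zero by (intro bexI[of _ 0]) auto
    next
      case False
      then have "\<not> hnz TYPE('k) (ucube A (\<lambda>v. int (a v))) p" using no cc(2) by blast
      then show ?thesis using cc(1) cyc False unfolding hnz_def by blast
    qed
    then obtain g where g: "\<And>a. g a \<in> chn (ucube A (\<lambda>v. int (a v))) (Suc p)"
      "\<And>a. bd 1 (g a) = mpart c a" "\<And>a. mpart c a = 0 \<Longrightarrow> g a = 0" by metis
    have fin: "finite {a. g a \<noteq> 0}" by (rule finite_subset[OF _ finite_mpart[of c]]) (use g(3) in auto)
    have "a v \<ge> 1" if "g a \<tau> \<noteq> 0" "v \<in> \<tau>" for a \<tau> v
    proof -
      have "\<tau> \<in> ucube A (\<lambda>v. int (a v))" using g(1)[of a] that(1) by (auto simp: chn_def)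
      then show ?thesis using that(2) by (simp add: ucube_iff)
    qed
    then have mp: "mpart (unpart g) a = g a" for a by (rule mpart_unpart[OF fin])
    have "embc (unpart g) \<in> kchn ?M (\<lambda>_. 0) (Suc p) d"
      unfolding embc_kchn_iff mp using g(1,3) cc(2) by blast
    moreover have "bd indet (unpart g) = c"
      by (rule mpart_inject) (simp add: mpart_bd mp g(2))
    then have "kbd (embc (unpart g)) = z" by (simp add: kbd_embc c)
    ultimately show False using z(3) by blast
  qed
next
  assume "\<exists>a. (\<Sum>v\<in>UNIV. a v) = d \<and> hnz TYPE('k) (ucube A (\<lambda>v. int (a v))) p"
  then obtain a where a: "(\<Sum>v\<in>UNIV. a v) = d" "hnz TYPE('k) (ucube A (\<lambda>v. int (a v))) p" by blast
  then obtain \<zeta> :: "'v set \<Rightarrow> 'k" where \<zeta>: "\<zeta> \<in> chn (ucube A (\<lambda>v. int (a v))) p" "bd 1 \<zeta> = 0"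
    "\<And>y. y \<in> chn (ucube A (\<lambda>v. int (a v))) (Suc p) \<Longrightarrow> bd 1 y \<noteq> \<zeta>" unfolding hnz_def by blast
  define g where "g a' = (if a' = a then \<zeta> else 0)" for a'
  have fin: "finite {a. g a \<noteq> 0}" by (rule finite_subset[of _ "{a}"]) (auto simp: g_def split: if_splits)
  have "a' v \<ge> 1" if "g a' \<tau> \<noteq> 0" "v \<in> \<tau>" for a' \<tau> v
  proof -
    have "a' = a" "\<zeta> \<tau> \<noteq> 0" using that(1) by (auto simp: g_def split: if_splits)
    then have "\<tau> \<in> ucube A (\<lambda>v. int (a' v))" using \<zeta>(1) by (auto simp: chn_def)
    then show ?thesis using that(2) by (simp add: ucube_iff)
  qed
  then have mp: "mpart (unpart g) a = g a" for a by (rule mpart_unpart[OF fin])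
  have k: "embc (unpart g) \<in> kchn ?M (\<lambda>_. 0) p d"
    unfolding embc_kchn_iff mp using a(1) \<zeta>(1) by (simp add: g_def chn_zero)
  show "knz ?M (\<lambda>_. 0) p d" unfolding knz_def
  proof (intro bexI[OF _ k] conjI ballI notI)
    have "bd indet (unpart g) = 0"
    proof (rule mpart_inject)
      fix a'
      show "mpart (bd indet (unpart g)) a' = mpart 0 a'"
        by (auto simp: mpart_bd mp g_def \<zeta>(2)) (auto simp: mpart_def fun_eq_iff)
    qed
    then show "kbd (embc (unpart g)) = 0" by (simp add: kbd_embc) (auto simp: embc_def fun_eq_iff)
    fix y assume y: "y \<in> kchn ?M (\<lambda>_. 0) (Suc p) d" "kbd y = embc (unpart g)"
    from y(1) obtain c where c: "y = embc c" by (rule kchn_embE)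
    have "bd indet c = unpart g"
    proof
      fix \<tau> show "bd indet c \<tau> = unpart g \<tau>"
        using fun_cong[OF fun_cong[OF y(2)], of \<tau> 0] by (simp add: c kbd_embc embc_def)
    qed
    then have "bd 1 (mpart c a) = \<zeta>" using mpart_bd[of c a] mp[of a] by (simp add: g_def)
    moreover have "mpart c a \<in> chn (ucube A (\<lambda>v. int (a v))) (Suc p)"
      using y(1) unfolding c embc_kchn_iff by blast
    ultimately show False using \<zeta>(3) by blast
  qed
qed

text \<open>If \<open>a v\<close> exceeds \<open>B v\<close>, lowering coordinate \<open>v\<close>
  by one does not leave \<open>A\<close>, and the complex is a cone over \<open>v\<close>.\<close>

lemma hnz_ucube_bounded:
  assumes A: "upset A" "bounded_by B A" and "hnz TYPE('k::field) (ucube A (\<lambda>v. int (a v))) p"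
  shows "a v \<le> B v"
proof (rule ccontr)
  assume v: "\<not> a v \<le> B v"
  have "\<not> hnz TYPE('k) (ucube A (\<lambda>v. int (a v))) p"
  proof (rule hnz_cone)
    fix \<tau> assume "\<tau> \<in> ucube A (\<lambda>v. int (a v))"
    then have \<tau>: "\<forall>v\<in>\<tau>. a v \<ge> 1" "lower \<tau> a \<in> A" by (simp_all add: ucube_iff)
    have "(\<lambda>v. min (lower \<tau> a v) (B v)) \<in> A" using A(2) \<tau>(2) by (simp add: bounded_by_def)
    then have "lower (insert v \<tau>) a \<in> A"
      by (rule upsetD[OF A(1)]) (use v in \<open>auto simp: lower_def\<close>)
    then show "insert v \<tau> \<in> ucube A (\<lambda>v. int (a v))" using \<tau>(1) v by (auto simp: ucube_iff)
  qed
  then show False using assms(3) by blast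
qed

lemma knz_mono_ideal_bounded:
  assumes "upset A" "bounded_by B A"
    and "knz (emb (mono_ideal A :: ('v::finite, 'k::field) mpoly set)) (\<lambda>_. 0) p d"
  shows "d \<le> (\<Sum>v\<in>UNIV. B v)"
  using assms(3) hnz_ucube_bounded[OF assms(1,2)] unfolding knz_mono_ideal by (auto intro!: sum_mono)


section \<open>Minimal generators of graded submodules\<close>

lemma sum_fun_apply: "(\<Sum>x\<in>X. f x) b = (\<Sum>x\<in>X. f x b)"
  by (induct X rule: infinite_finite_induct) simp_all

lemma finite_bounded_monomials: "finite {m :: 'v::finite \<Rightarrow>\<^sub>0 nat. mdeg m \<le> d}"
proof -
  have "{m :: 'v \<Rightarrow>\<^sub>0 nat. mdeg m \<le> d} \<subseteq> mon ` (PiE UNIV (\<lambda>_. {..d}))"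
  proof
    fix m :: "'v \<Rightarrow>\<^sub>0 nat" assume "m \<in> {m. mdeg m \<le> d}"
    then have "lookup m v \<le> d" for v
      using member_le_sum[of v UNIV "lookup m"] by (simp add: mdeg_alt)
    then have "lookup m \<in> PiE UNIV (\<lambda>_. {..d})" by (simp add: PiE_def)
    then show "m \<in> mon ` (PiE UNIV (\<lambda>_. {..d}))" by (metis imageI mon_lookup)
  qed
  then show ?thesis by (rule finite_subset) (intro finite_imageI finite_PiE; simp)
qed

lemma vector_module: "module (\<lambda>(f :: 'a::comm_ring_1) (u :: nat \<Rightarrow> 'a) b. f * u b)"
  by unfold_locales (auto simp: fun_eq_iff algebra_simps)

lemma vector_vector_space:
  "vector_space (\<lambda>(c :: 'k::field) (u :: nat \<Rightarrow> ('v, 'k) mpoly) b. Poly_Mapping.single 0 c * u b)"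
  by unfold_locales
    (auto simp: fun_eq_iff distrib_left single_add distrib_right mult_single simp flip: mult.assoc)

abbreviation "vspan \<equiv> module.span (\<lambda>(f :: 'a::comm_ring_1) (u :: nat \<Rightarrow> 'a) b. f * u b)"

definition homog :: "(nat \<Rightarrow> nat) \<Rightarrow> nat \<Rightarrow> (nat \<Rightarrow> ('v, 'k::field) mpoly) \<Rightarrow> bool" where
  "homog s d u \<longleftrightarrow> (\<forall>b. \<forall>m\<in>keys (u b). mdeg m + s b = d)"

text \<open>The last clause stands in for finite generation of all syzygies: it gives finitely many
  generators at \<open>p = 0\<close>, and by the dimension shift it passes to the kernel of a
  minimal map.\<close>

definition good_module :: "nat \<Rightarrow> (nat \<Rightarrow> nat) \<Rightarrow> (nat \<Rightarrow> ('v::finite, 'k::field) mpoly) set \<Rightarrow> bool" where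
  "good_module r s M \<longleftrightarrow> submod M \<and> M \<subseteq> free_module r \<and> (\<forall>u\<in>M. \<forall>d. dpart s d u \<in> M) \<and>
     (\<forall>p. \<exists>D. \<forall>d. knz M s p d \<longrightarrow> d \<le> D)"

text \<open>A fixed degree of a free module of finite rank has finite dimension over the field, with
  the monomial vectors \<open>W\<close> spanning it; \<open>T\<close> is a basis of the part in
  \<open>M\<close>.\<close>

lemma finite_homogeneous_part:
  fixes M :: "(nat \<Rightarrow> ('v::finite, 'k::field) mpoly) set"
  assumes "M \<subseteq> free_module r"
  obtains T where "finite T" "T \<subseteq> {u \<in> M. homog s d u}" "{u \<in> M. homog s d u} \<subseteq> vspan T"
proof -
  interpret V: vector_space "\<lambda>(c :: 'k) (u :: nat \<Rightarrow> ('v, 'k) mpoly) b. Poly_Mapping.single 0 c * u b"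
    by (rule vector_vector_space)
  interpret R: module "\<lambda>(f :: ('v, 'k) mpoly) (u :: nat \<Rightarrow> ('v, 'k) mpoly) b. f * u b"
    by (rule vector_module)
  define W :: "(nat \<Rightarrow> ('v, 'k) mpoly) set" where
    "W = (\<lambda>(m, b) b'. if b' = b then Poly_Mapping.single m 1 else 0) ` ({m. mdeg m \<le> d} \<times> {..<r})"
  have finW: "finite W" unfolding W_def by (intro finite_imageI finite_cartesian_product finite_bounded_monomials) simp
  obtain T where T: "T \<subseteq> {u \<in> M. homog s d u}" "V.independent T" "{u \<in> M. homog s d u} \<subseteq> V.span T"
    using V.maximal_independent_subset by blast
  have "{u \<in> M. homog s d u} \<subseteq> V.span W"
  proof
    fix u assume u: "u \<in> {u \<in> M. homog s d u}"
    have "u = (\<Sum>b<r. \<Sum>m\<in>keys (u b). (\<lambda>b'. Poly_Mapping.single 0 (lookup (u b) m) *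
        (if b' = b then Poly_Mapping.single m 1 else 0)))"
    proof
      fix b'
      have "(\<Sum>b<r. \<Sum>m\<in>keys (u b). Poly_Mapping.single 0 (lookup (u b) m) *
        (if b' = b then Poly_Mapping.single m 1 else 0)) = (\<Sum>b<r. if b' = b then u b else 0)"
        using poly_expand[of "u _"] by (intro sum.cong) (auto simp: mult_single)
      also have "\<dots> = u b'" using u assms by (auto simp: free_module_def)
      finally show "u b' = (\<Sum>b<r. \<Sum>m\<in>keys (u b). (\<lambda>b'. Poly_Mapping.single 0 (lookup (u b) m) *
        (if b' = b then Poly_Mapping.single m 1 else 0))) b'" by (simp add: sum_fun_apply)
    qed
    also have "\<dots> \<in> V.span W"
    proof (intro V.span_sum V.span_scale V.span_base)
      fix b m assume "b \<in> {..<r}" "m \<in> keys (u b)"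
      moreover have "mdeg m + s b = d" using u \<open>m \<in> keys (u b)\<close> by (simp add: homog_def)
      then have "mdeg m \<le> d" by simp
      ultimately show "(\<lambda>b'. if b' = b then Poly_Mapping.single m 1 else 0) \<in> W"
        unfolding W_def by (auto intro!: image_eqI[of _ _ "(m, b)"])
    qed
    finally show "u \<in> V.span W" .
  qed
  then have "finite T" using V.independent_span_bound[OF finW T(2)] T(1) by blast
  moreover have "V.span T \<subseteq> R.span T"
  proof
    fix x assume "x \<in> V.span T"
    then show "x \<in> R.span T"
    proof (induct rule: V.span_induct_alt)
      case base
      show ?case by (rule R.span_zero)
    next
      case (step c x y)
      show ?case by (intro R.span_add R.span_scale R.span_base step)
    qed
  qed
  ultimately show thesis using that T by blast
qed

lemma homog_sum_parts:
  fixes u :: "nat \<Rightarrow> ('v::finite, 'k::field) mpoly"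
  assumes "u \<in> free_module r"
  shows "u = (\<Sum>d\<in>(\<Union>b<r. (\<lambda>m. mdeg m + s b) ` keys (u b)). dpart s d u)"
proof
  fix b
  let ?S = "\<Union>b<r. (\<lambda>m. mdeg m + s b) ` keys (u b)"
  have fin: "finite ?S" by simp
  show "u b = (\<Sum>d\<in>?S. dpart s d u) b"
  proof (rule poly_mapping_eqI)
    fix m
    have "lookup ((\<Sum>d\<in>?S. dpart s d u) b) m = (\<Sum>d\<in>?S. if mdeg m + s b = d then lookup (u b) m else 0)"
      by (simp add: sum_fun_apply lookup_sum dpart_def lookup_prestr)
    also have "\<dots> = lookup (u b) m"
    proof (cases "m \<in> keys (u b)")
      case True
      then have "b < r" using assms by (cases "b < r") (auto simp: free_module_def)
      then show ?thesis using True by (subst sum.delta'[OF fin]) auto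
    next
      case False
      then show ?thesis by (simp add: in_keys_iff)
    qed
    finally show "lookup (u b) m = lookup ((\<Sum>d\<in>?S. dpart s d u) b) m" by simp
  qed
qed

lemma submod_vspan: "submod M \<Longrightarrow> T \<subseteq> M \<Longrightarrow> vspan T \<subseteq> M"
  by (rule module.span_minimal[OF vector_module])
     (auto simp: submod_def module.subspace_def[OF vector_module])

text \<open>Graded Nakayama: beyond the bound \<open>D\<close> on index 0 Koszul homology no new
  generators occur, and each lower degree contributes finitely many.\<close>

lemma good_module_finite_gen:
  fixes M :: "(nat \<Rightarrow> ('v::finite, 'k::field) mpoly) set"
  assumes "good_module r s M"
  obtains T where "finite T" "\<forall>t\<in>T. \<exists>d. homog s d t" "vspan T = M"
proof -
  interpret R: module "\<lambda>(f :: ('v, 'k) mpoly) (u :: nat \<Rightarrow> ('v, 'k) mpoly) b. f * u b"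
    by (rule vector_module)
  have M: "submod M" "M \<subseteq> free_module r" "\<And>u d. u \<in> M \<Longrightarrow> dpart s d u \<in> M"
    using assms by (auto simp: good_module_def)
  obtain D where D: "\<And>d. knz M s 0 d \<Longrightarrow> d \<le> D" using assms unfolding good_module_def by blast
  have "\<forall>d. \<exists>T. finite T \<and> T \<subseteq> {u \<in> M. homog s d u} \<and> {u \<in> M. homog s d u} \<subseteq> vspan T"
    (is "\<forall>d. \<exists>T. ?P d T")
  proof
    fix d
    show "\<exists>T. ?P d T" by (rule finite_homogeneous_part[OF M(2), of s d]) (intro exI conjI)
  qed
  from choice[OF this] obtain T where "\<forall>d. ?P d (T d)" ..
  then have T: "finite (T d)" "T d \<subseteq> {u \<in> M. homog s d u}"
    "{u \<in> M. homog s d u} \<subseteq> vspan (T d)" for d by blast+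
  define T' where "T' = (\<Union>d\<le>D. T d)"
  have hom: "u \<in> R.span T'" if "u \<in> M" "homog s d u" for u d
    using that
  proof (induct d arbitrary: u rule: less_induct)
    case (less d)
    show ?case
    proof (cases "d \<le> D")
      case True
      then have "T d \<subseteq> T'" by (auto simp: T'_def)
      then show ?thesis using T(3)[of d] less(2,3) R.span_mono by blast
    next
      case False
      then have nz: "\<not> knz M s 0 d" using D by auto
      \<comment> \<open>As a cycle of index 0, \<open>u\<close> is a boundary, that is, a
        combination of variables times elements of \<open>M\<close> of degree
        \<open>d - 1\<close>.\<close>
      define z where "z \<tau> = (if \<tau> = {} then u else 0)" for \<tau> :: "'v set"
      have "0 \<in> M" using M(1) by (simp add: submod_def)
      then have z: "z \<in> kchn M s 0 d" using less(2,3) by (auto simp: kchn_def z_def homog_def)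
      then obtain y where y: "y \<in> kchn M s (Suc 0) d" "kbd y = z"
        using nz kbd_zero_chain[OF z] unfolding knz_def by blast
      have "y {v} \<in> R.span T'" for v
      proof (cases "d \<ge> 1")
        case True
        have "homog s (d - 1) (y {v})" unfolding homog_def
        proof (intro allI ballI)
          fix b m assume "m \<in> keys (y {v} b)"
          then have "mdeg m + Suc 0 + s b = d" using y(1) unfolding kchn_def by blast
          then show "mdeg m + s b = d - 1" by simp
        qed
        moreover have "y {v} \<in> M" using y(1) by (simp add: kchn_def)
        ultimately show ?thesis using True by (intro less(1)[of "d - 1"]) auto
      qed (use False in simp)
      then have "(\<Sum>v\<in>UNIV. (\<lambda>b. (esgn v {} * indet v) * y {v} b)) \<in> R.span T'"
        by (intro R.span_sum R.span_scale)
      also have "(\<Sum>v\<in>UNIV. (\<lambda>b. (esgn v {} * indet v) * y {v} b)) = kbd y {}"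
        by (auto simp: kbd_def bd_def sum_fun_apply fun_eq_iff)
      finally show ?thesis by (simp add: y(2) z_def)
    qed
  qed
  have "vspan T' = M"
  proof
    show "vspan T' \<subseteq> M" using T(2) by (intro submod_vspan[OF M(1)]) (auto simp: T'_def)
    show "M \<subseteq> vspan T'"
    proof
      fix u assume u: "u \<in> M"
      have "(\<Sum>d\<in>(\<Union>b<r. (\<lambda>m. mdeg m + s b) ` keys (u b)). dpart s d u) \<in> R.span T'"
        by (intro R.span_sum hom[OF M(3)[OF u]]) (auto simp: homog_def keys_dpart)
      then show "u \<in> vspan T'" using homog_sum_parts[of u r s] u M(2) by auto
    qed
  qed
  moreover have "finite T'" using T(1) by (simp add: T'_def)
  moreover have "\<forall>t\<in>T'. \<exists>d. homog s d t" using T(2) by (fastforce simp: T'_def)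
  ultimately show thesis using that by blast
qed

text \<open>Homogeneous generators of least number are used: a relation with a nonzero constant
  coefficient would make one of them redundant.\<close>

lemma good_module_minimal_map:
  fixes M :: "(nat \<Rightarrow> ('v::finite, 'k::field) mpoly) set"
  assumes "good_module r s M"
  obtains r' s' G where "minimal_map r r' s s' G" "gimg r r' G = M"
proof -
  interpret R: module "\<lambda>(f :: ('v, 'k) mpoly) (u :: nat \<Rightarrow> ('v, 'k) mpoly) b. f * u b"
    by (rule vector_module)
  define P where "P T \<longleftrightarrow> finite T \<and> (\<forall>t\<in>T. \<exists>d. homog s d t) \<and> vspan T = M" for T
  obtain T where T: "P T" "\<And>T'. P T' \<Longrightarrow> card T \<le> card T'"
    using good_module_finite_gen[OF assms] ex_has_least_nat[of P _ card] unfolding P_def by metis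
  have fin: "finite T" and span: "vspan T = M" using T(1) by (auto simp: P_def)
  obtain dg where dg: "\<And>t. t \<in> T \<Longrightarrow> homog s (dg t) t" using T(1) unfolding P_def by metis
  define n where "n = card T"
  obtain h where h: "bij_betw h {..<n} T"
    using ex_bij_betw_nat_finite[OF fin] by (auto simp: n_def atLeast0LessThan)
  have hT: "b < n \<Longrightarrow> h b \<in> T" for b using h by (auto simp: bij_betw_def)
  define G where "G a b = h b a" for a b
  define s' where "s' b = dg (h b)" for b
  have TM: "T \<subseteq> M" using span R.span_superset by blast
  have Mfree: "M \<subseteq> free_module r" using assms by (simp add: good_module_def)
  have gm: "gmap r n G u = (\<Sum>b<n. (\<lambda>a. u b * h b a))" for u
  proof
    fix a
    have "h b a = 0" if "b < n" "\<not> a < r" for b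
      using hT[OF that(1)] TM Mfree that(2) by (force simp: free_module_def)
    then show "gmap r n G u a = (\<Sum>b<n. (\<lambda>a. u b * h b a)) a"
      by (auto simp: gmap_def G_def sum_fun_apply mult.commute)
  qed
  interpret homog_map r n s s' G
    by unfold_locales (use dg hT in \<open>auto simp: G_def s'_def homog_def\<close>)
  have img: "gimg r n G = M"
  proof
    have "(\<Sum>b<n. (\<lambda>a. u b * h b a)) \<in> R.span T" for u
      by (intro R.span_sum R.span_scale R.span_base) (auto intro: hT)
    then show "gimg r n G \<subseteq> M" by (auto simp: gimg_def gm span)
    show "M \<subseteq> gimg r n G"
    proof
      fix x assume "x \<in> M"
      then obtain q where q: "x = (\<Sum>t\<in>T. (\<lambda>b. q t * t b))"
        using R.span_finite[OF fin] span by auto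
      define u where "u b = (if b < n then q (h b) else 0)" for b
      have "x = (\<Sum>b<n. (\<lambda>a. q (h b) * h b a))"
        unfolding q by (rule sum.reindex_bij_betw[OF h, symmetric])
      also have "\<dots> = gmap r n G u" unfolding gm by (rule sum.cong) (auto simp: u_def)
      finally show "x \<in> gimg r n G" by (auto simp: gimg_def u_def free_module_def)
    qed
  qed
  have "lookup (u b0) 0 = 0" if u: "u \<in> gker r n G" for u b0
  proof (rule ccontr)
    assume nz: "lookup (u b0) 0 \<noteq> 0"
    have ufree: "u \<in> free_module n" "gmap r n G u = 0" using u by (auto simp: gker_def)
    then have b0: "b0 < n" using nz by (cases "b0 < n") (auto simp: free_module_def)
    \<comment> \<open>In the degree of generator \<open>h b0\<close>, the coefficient at
      \<open>b0\<close> of the relation is reduced to its nonzero constant \<open>c\<close>, which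
      can be divided out.\<close>
    define u' where "u' = dpart s' (s' b0) u"
    define c where "c = lookup (u b0) 0"
    have "u' b0 = Poly_Mapping.single 0 c"
      by (rule poly_mapping_eqI) (auto simp: u'_def dpart_def lookup_prestr c_def lookup_single when_def)
    have "gmap r n G u' = 0" using dpart_gmap[of "s' b0" u] ufree(2) by (simp add: u'_def)
    then have "0 = (\<Sum>b<n. (\<lambda>a. u' b * h b a))" by (simp add: gm)
    also have "\<dots> = (\<lambda>a. u' b0 * h b0 a) + (\<Sum>b\<in>{..<n} - {b0}. (\<lambda>a. u' b * h b a))"
      using b0 by (intro sum.remove) auto
    finally have e: "(\<lambda>a. u' b0 * h b0 a) = - (\<Sum>b\<in>{..<n} - {b0}. (\<lambda>a. u' b * h b a))"
      by (simp add: eq_neg_iff_add_eq_0)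
    have "(\<Sum>b\<in>{..<n} - {b0}. (\<lambda>a. u' b * h b a)) \<in> R.span (T - {h b0})"
    proof (intro R.span_sum R.span_scale R.span_base)
      fix b assume "b \<in> {..<n} - {b0}"
      then show "h b \<in> T - {h b0}" using h b0 hT by (auto simp: bij_betw_def inj_on_def)
    qed
    then have "(\<lambda>a. u' b0 * h b0 a) \<in> R.span (T - {h b0})" unfolding e by (rule R.span_neg)
    then have "(\<lambda>a. Poly_Mapping.single 0 (1 / c) * (u' b0 * h b0 a)) \<in> R.span (T - {h b0})"
      by (rule R.span_scale)
    moreover have "Poly_Mapping.single 0 (1 / c) * u' b0 = 1"
      using nz \<open>u' b0 = _\<close> by (simp add: mult_single c_def)
    ultimately have "h b0 \<in> R.span (T - {h b0})" by (simp flip: mult.assoc)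
    then have "R.span (insert (h b0) (T - {h b0})) = R.span (T - {h b0})"       unfolding R.span_def by (rule hull_redundant)
    then have "P (T - {h b0})" using T(1) hT[OF b0] by (auto simp: P_def insert_absorb)
    then have "card T \<le> card (T - {h b0})" by (rule T(2))
    then show False using fin hT[OF b0] by (metis card_Diff1_less not_less)
  qed
  then have "minimal_map r n s s' G"
    by (intro minimal_map.intro homog_map_axioms minimal_map_axioms.intro)
  then show thesis using that img by blast
qed

lemma good_module_kernel:
  assumes "good_module r s (gimg r r' G)" "minimal_map r r' s s' G"
  shows "good_module r' s' (gker r r' G)"
proof -
  interpret minimal_map r r' s s' G by fact
  have "dpart s' d u \<in> gker r r' G" if "u \<in> gker r r' G" for u d
    using that dpart_gmap[of d u] dpart_free[of u r' s' d] by (simp add: gker_def)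
  moreover have "\<exists>D. \<forall>d. knz (gker r r' G) s' p d \<longrightarrow> d \<le> D" for p
    using assms(1) unfolding good_module_def knz_shift[symmetric] by blast
  ultimately show ?thesis by (auto simp: good_module_def submod_gker) (auto simp: gker_def)
qed


section \<open>Minimal resolutions and regularity of monomial ideals\<close>

lemma ring_module: "module ((*) :: 'a::comm_ring_1 \<Rightarrow> 'a \<Rightarrow> 'a)"
  by unfold_locales (auto simp: algebra_simps)

lemma is_ideal_iff:
  "is_ideal K \<longleftrightarrow> 0 \<in> K \<and> (\<forall>f\<in>K. \<forall>g\<in>K. f + g \<in> K) \<and> (\<forall>h. \<forall>f\<in>K. h * f \<in> K)"
  unfolding is_ideal_def module.subspace_def[OF ring_module] by blast

lemma is_ideal_mono_ideal:
  assumes "upset A"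
  shows "is_ideal (mono_ideal A :: ('v, 'k::field) mpoly set)"
  unfolding is_ideal_iff
proof (intro conjI ballI allI)
  show "0 \<in> (mono_ideal A :: ('v, 'k) mpoly set)" by (simp add: mono_ideal_def)
  fix f :: "('v, 'k) mpoly" assume f: "f \<in> mono_ideal A"
  show "f + g \<in> mono_ideal A" if "g \<in> mono_ideal A" for g
    using f that keys_add[of f g] by (auto simp: mono_ideal_def)
  show "h * f \<in> mono_ideal A" for h
    unfolding mono_ideal_def
  proof clarify
    fix m assume "m \<in> keys (h * f)"
    then obtain m1 m2 where m: "m = m1 + m2" "m2 \<in> keys f" using keys_mult by blast
    then have "lookup m2 \<in> A" using f by (simp add: mono_ideal_def)
    then show "lookup m \<in> A" by (rule upsetD[OF assms(1)]) (simp add: m(1) lookup_add)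
  qed
qed

lemma irrelevant_ideal_iff:
  fixes f :: "('v::finite, 'k::field) mpoly"
  shows "f \<in> ideal_gen (range indet) \<longleftrightarrow> lookup f 0 = 0"
proof -
  interpret R: module "(*) :: ('v, 'k) mpoly \<Rightarrow> _ \<Rightarrow> _" by (rule ring_module)
  have no: "lookup (indet v * f) 0 = 0" for v and f :: "('v, 'k) mpoly"
  proof (rule ccontr)
    assume "lookup (indet v * f) 0 \<noteq> 0"
    then have "0 \<in> keys (indet v * f)" by (simp add: in_keys_iff)
    then obtain m where "m \<in> keys f" "0 = monom1 v + m" by (rule keys_indet_times)
    then have "mdeg (monom1 v + m) = 0" by (metis mdeg_zero)
    then show False by (simp add: mdeg_add)
  qed
  show ?thesis
  proof
    assume "f \<in> ideal_gen (range indet)"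
    then have "f \<in> R.span (range indet)" by (simp add: ideal_gen_def)
    then show "lookup f 0 = 0"
      by (induct rule: R.span_induct_alt) (auto simp: lookup_add mult.commute[of _ "indet _"] no)
  next
    assume f: "lookup f 0 = 0"
    have "(\<Sum>m\<in>keys f. Poly_Mapping.single m (lookup f m)) \<in> R.span (range indet)"
    proof (rule R.span_sum)
      fix m assume "m \<in> keys f"
      then have "m \<noteq> 0" using f by (auto simp: in_keys_iff)
      then obtain v where v: "lookup m v \<ge> 1" by (auto simp: poly_mapping_eq_iff fun_eq_iff Suc_le_eq)
      have "monom1 v + mon ((lookup m)(v := lookup m v - 1)) = m"
        using v by (intro poly_mapping_eqI) (auto simp: lookup_add lookup_single when_def)
      then have "Poly_Mapping.single m (lookup f m) =
          Poly_Mapping.single (mon ((lookup m)(v := lookup m v - 1))) (lookup f m) * indet v"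
        by (simp add: indet_def mult_single add.commute)
      then show "Poly_Mapping.single m (lookup f m) \<in> R.span (range indet)"
        by (simp add: R.span_scale R.span_base)
    qed
    then show "f \<in> ideal_gen (range indet)" using poly_expand[of f] by (simp add: ideal_gen_def)
  qed
qed

text \<open>Level 0 is the ring itself, in rank one and degree 0, so that the augmentation becomes
  the first matrix and all levels obey the same conditions.\<close>

definition lvl_rk :: "'r graded_free_complex \<Rightarrow> nat \<Rightarrow> nat" where
  "lvl_rk F i = (case i of 0 \<Rightarrow> 1 | Suc j \<Rightarrow> rk F j)"

definition lvl_sh :: "'r graded_free_complex \<Rightarrow> nat \<Rightarrow> nat \<Rightarrow> nat" where
  "lvl_sh F i = (case i of 0 \<Rightarrow> (\<lambda>_. 0) | Suc j \<Rightarrow> sh F j)"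

definition lvl_mat :: "'r graded_free_complex \<Rightarrow> nat \<Rightarrow> nat \<Rightarrow> nat \<Rightarrow> 'r" where
  "lvl_mat F i = (case i of 0 \<Rightarrow> (\<lambda>_ b. aug F b) | Suc j \<Rightarrow> mat F j)"

abbreviation "lvl_img F i \<equiv> gimg (lvl_rk F i) (rk F i) (lvl_mat F i)"
abbreviation "lvl_ker F i \<equiv> gker (lvl_rk F i) (rk F i) (lvl_mat F i)"



lemma lvl_img_0: "lvl_img F 0 = emb (aug_map F ` free_module (rk F 0))"
proof -
  have g: "gmap (Suc 0) (rk F 0) (\<lambda>_. aug F) u = (\<lambda>b. if b = 0 then aug_map F u else 0)" for u
    by (auto simp: gmap_def aug_map_def fun_eq_iff mult.commute)
  show ?thesis
  proof
    show "lvl_img F 0 \<subseteq> emb (aug_map F ` free_module (rk F 0))"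
      by (auto simp: gimg_def lvl_rk_def lvl_mat_def g emb_def)
    show "emb (aug_map F ` free_module (rk F 0)) \<subseteq> lvl_img F 0"
    proof
      fix x assume "x \<in> emb (aug_map F ` free_module (rk F 0))"
      then obtain u where u: "u \<in> free_module (rk F 0)" "x 0 = aug_map F u" "\<forall>b\<ge>1. x b = 0"
        by (auto simp: emb_def)
      then have "x = gmap (Suc 0) (rk F 0) (\<lambda>_. aug F) u" by (auto simp: g fun_eq_iff Suc_le_eq)
      then show "x \<in> lvl_img F 0" using u(1) by (auto simp: gimg_def lvl_rk_def lvl_mat_def)
    qed
  qed
qed

lemma lvl_ker_0: "lvl_ker F 0 = {u \<in> free_module (rk F 0). aug_map F u = 0}"
  by (auto simp: gker_def lvl_rk_def lvl_mat_def gmap_def aug_map_def fun_eq_iff mult.commute)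

lemma lvl_img_Suc: "lvl_img F (Suc i) = diff_map F i ` free_module (rk F (Suc i))"
  by (auto simp: gimg_def lvl_rk_def lvl_mat_def gmap_def diff_map_def image_def fun_eq_iff)

lemma lvl_ker_Suc: "lvl_ker F (Suc i) = {u \<in> free_module (rk F (Suc i)). diff_map F i u = (\<lambda>_. 0)}"
  by (auto simp: gker_def lvl_rk_def lvl_mat_def gmap_def diff_map_def fun_eq_iff)

lemma emb_inject: "emb J = emb J' \<longleftrightarrow> J = J'"
proof
  assume e: "emb J = emb J'"
  have "x \<in> J \<longleftrightarrow> (\<lambda>b. if b = 0 then x else 0) \<in> emb J" for x and J :: "'a set" by (auto simp: emb_def)
  then show "J = J'" using e by blast
qed simp

lemma homog_map_lvl:
  "(\<forall>i. homog_map (lvl_rk F i) (rk F i) (lvl_sh F i) (sh F i) (lvl_mat F i)) \<longleftrightarrow>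
    (\<forall>b<rk F 0. \<forall>m\<in>keys (aug F b). mdeg m = sh F 0 b) \<and>
    (\<forall>i. \<forall>a<rk F i. \<forall>b<rk F (Suc i). \<forall>m\<in>keys (mat F i a b). mdeg m + sh F i a = sh F (Suc i) b)"
proof -
  have "(\<forall>i. homog_map (lvl_rk F i) (rk F i) (lvl_sh F i) (sh F i) (lvl_mat F i)) \<longleftrightarrow>
     homog_map (lvl_rk F 0) (rk F 0) (lvl_sh F 0) (sh F 0) (lvl_mat F 0) \<and>
     (\<forall>i. homog_map (lvl_rk F (Suc i)) (rk F (Suc i)) (lvl_sh F (Suc i)) (sh F (Suc i)) (lvl_mat F (Suc i)))"
    by (metis not0_implies_Suc)
  then show ?thesis by (simp add: homog_map_def lvl_rk_def lvl_sh_def lvl_mat_def) blast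
qed

lemma graded_free_resolution_iff:
  "graded_free_resolution F J \<longleftrightarrow>
    (\<forall>i. homog_map (lvl_rk F i) (rk F i) (lvl_sh F i) (sh F i) (lvl_mat F i)) \<and>
    lvl_img F 0 = emb J \<and> (\<forall>i. lvl_img F (Suc i) = lvl_ker F i)"
proof -
  have k: "(\<forall>i. lvl_img F (Suc i) = lvl_ker F i) \<longleftrightarrow> lvl_img F (Suc 0) = lvl_ker F 0 \<and>
     (\<forall>i. lvl_img F (Suc (Suc i)) = lvl_ker F (Suc i))"
    by (metis not0_implies_Suc)
  show ?thesis
    unfolding graded_free_resolution_def homog_map_lvl k
    unfolding lvl_img_0 lvl_img_Suc lvl_ker_0 lvl_ker_Suc emb_inject conj_assoc One_nat_def
    by (rule refl)
qed

lemma unit_gmap: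
  assumes "b < r'" "a < r"
  shows "gmap r r' G (\<lambda>b'. if b' = b then 1 else 0) a = G a b"
proof -
  have "(\<Sum>b'<r'. G a b' * (if b' = b then 1 else 0)) = (\<Sum>b'<r'. if b' = b then G a b' else 0)"
    by (rule sum.cong) auto
  then show ?thesis using assms by (simp add: gmap_def)
qed

text \<open>By exactness the kernel at one level is spanned by the columns of the next matrix, which
  are the images of unit vectors. So the kernel has no constant terms exactly if the matrix entries
  have none.\<close>

lemma minimal_graded_free_resolution_iff:
  "minimal_graded_free_resolution F J \<longleftrightarrow>
    (\<forall>i. minimal_map (lvl_rk F i) (rk F i) (lvl_sh F i) (sh F i) (lvl_mat F i)) \<and>
    lvl_img F 0 = emb J \<and> (\<forall>i. lvl_img F (Suc i) = lvl_ker F i)"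
proof -
  have "(\<forall>a<rk F i. \<forall>b<rk F (Suc i). lookup (mat F i a b) 0 = 0) \<longleftrightarrow>
      (\<forall>u a. u \<in> lvl_ker F i \<longrightarrow> lookup (u a) 0 = 0)" (is "?L \<longleftrightarrow> ?R") if *: "lvl_img F (Suc i) = lvl_ker F i" for i
  proof
    assume R: ?R
    show ?L
    proof (intro allI impI)
      fix a b assume ab: "a < rk F i" "b < rk F (Suc i)"
      let ?e = "(\<lambda>b'. if b' = b then 1 else 0) :: nat \<Rightarrow> ('a, 'b) mpoly"
      have "gmap (rk F i) (rk F (Suc i)) (mat F i) ?e \<in> lvl_img F (Suc i)"
        using ab(2) by (auto simp: gimg_def lvl_rk_def lvl_mat_def free_module_def)
      then have "gmap (rk F i) (rk F (Suc i)) (mat F i) ?e \<in> lvl_ker F i" by (simp only: *)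
      then have "lookup (gmap (rk F i) (rk F (Suc i)) (mat F i) ?e a) 0 = 0" using R by blast
      then show "lookup (mat F i a b) 0 = 0" using ab by (simp add: unit_gmap)
    qed
  next
    assume L: ?L
    show ?R
    proof (intro allI impI)
      fix u a assume "u \<in> lvl_ker F i"
      then obtain x where u: "u = gmap (rk F i) (rk F (Suc i)) (mat F i) x"
        unfolding *[symmetric] by (auto simp: gimg_def lvl_rk_def lvl_mat_def)
      have "mat F i a b * x b \<in> ideal_gen (range indet)" if "a < rk F i" "b < rk F (Suc i)" for b
      proof -
        have "mat F i a b \<in> ideal_gen (range indet)" using that L by (simp add: irrelevant_ideal_iff)
        then show ?thesis unfolding ideal_gen_def
          using module.span_scale[OF ring_module, of "mat F i a b" _ "x b"] by (simp add: mult.commute)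
      qed
      then show "lookup (u a) 0 = 0"
        by (auto simp: u gmap_def lookup_sum irrelevant_ideal_iff)
    qed
  qed
  note eq = this
  note unfold = minimal_graded_free_resolution_def graded_free_resolution_iff irrelevant_ideal_iff
      minimal_map_def minimal_map_axioms_def
  show ?thesis
  proof (cases "\<forall>i. lvl_img F (Suc i) = lvl_ker F i")
    case True
    then show ?thesis unfolding unfold using eq by (simp add: all_conj_distrib conj_ac)
  next
    case False
    then show ?thesis unfolding unfold by (simp only: simp_thms)
  qed
qed

text \<open>The dimension shift is iterated down to index 0, where the homology counts generators;
  \<open>p\<close> stays arbitrary because each shift changes it.\<close>

lemma minimal_resolution_knz:
  assumes "minimal_graded_free_resolution F J"
  shows "(\<exists>b<rk F i. sh F i b = d) \<longleftrightarrow> knz (emb J) (\<lambda>_. 0) i d"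
proof -
  have m: "minimal_map (lvl_rk F i) (rk F i) (lvl_sh F i) (sh F i) (lvl_mat F i)"
    and e: "lvl_img F 0 = emb J" and k: "lvl_img F (Suc i) = lvl_ker F i" for i
    using assms by (auto simp: minimal_graded_free_resolution_iff)
  have "knz (lvl_img F 0) (lvl_sh F 0) (p + i) d \<longleftrightarrow> knz (lvl_img F i) (lvl_sh F i) p d" for p
  proof (induct i arbitrary: p)
    case (Suc i)
    have "knz (lvl_img F 0) (lvl_sh F 0) (p + Suc i) d \<longleftrightarrow> knz (lvl_img F i) (lvl_sh F i) (Suc p) d"
      using Suc[of "Suc p"] by simp
    also have "\<dots> \<longleftrightarrow> knz (lvl_ker F i) (sh F i) p d" by (rule minimal_map.knz_shift[OF m])
    also have "\<dots> \<longleftrightarrow> knz (lvl_img F (Suc i)) (lvl_sh F (Suc i)) p d"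
      by (simp add: k) (simp add: lvl_sh_def)
    finally show ?case .
  qed simp
  from this[of 0] show ?thesis
    using minimal_map.knz_generators[OF m, of i d] e by (simp add: lvl_sh_def)
qed

text \<open>Dependent choice of minimal maps, each onto the kernel of the previous one. The complex
  is an infinite sequence, so no statement about its length is required.\<close>

lemma minimal_resolution_exists:
  fixes J :: "('v::finite, 'k::field) mpoly set"
  assumes "good_module 1 (\<lambda>_. 0) (emb J)"
  shows "\<exists>F. minimal_graded_free_resolution F J"
proof -
  define P :: "nat \<Rightarrow> nat \<times> (nat \<Rightarrow> nat) \<times> (nat \<Rightarrow> ('v, 'k) mpoly) set \<Rightarrow> bool" where
    "P n = (\<lambda>(r, s, M). good_module r s M \<and> (n = 0 \<longrightarrow> r = 1 \<and> s = (\<lambda>_. 0) \<and> M = emb J))" for n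
  define Q :: "nat \<times> (nat \<Rightarrow> nat) \<times> (nat \<Rightarrow> ('v, 'k) mpoly) set \<Rightarrow>
      nat \<times> (nat \<Rightarrow> nat) \<times> (nat \<Rightarrow> ('v, 'k) mpoly) set \<Rightarrow> (nat \<Rightarrow> nat \<Rightarrow> ('v, 'k) mpoly) \<Rightarrow> bool" where
    "Q = (\<lambda>(r, s, M) (r', s', M') G. minimal_map r r' s s' G \<and> gimg r r' G = M \<and> gker r r' G = M')"
  have "\<exists>f. \<forall>n. P n (f n) \<and> (\<exists>G. Q (f n) (f (Suc n)) G)"
  proof (rule dependent_nat_choice)
    show "\<exists>x. P 0 x" using assms by (auto simp: P_def)
    fix x n assume Px: "P n x"
    obtain r s M where x: "x = (r, s, M)" by (cases x)
    have "good_module r s M" using Px x by (simp add: P_def)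
    from good_module_minimal_map[OF this] obtain r' s' G
      where G: "minimal_map r r' s s' G" "gimg r r' G = M" by blast
    have "good_module r' s' (gker r r' G)"
      using good_module_kernel[OF _ G(1)] \<open>good_module r s M\<close> G(2) by simp
    then have "P (Suc n) (r', s', gker r r' G) \<and> (\<exists>H. Q x (r', s', gker r r' G) H)"
      using G x by (auto simp: P_def Q_def)
    then show "\<exists>y. P (Suc n) y \<and> (\<exists>G. Q x y G)" by (intro exI[of _ "(r', s', gker r r' G)"])
  qed
  then obtain f where f: "\<forall>n. P n (f n) \<and> (\<exists>G. Q (f n) (f (Suc n)) G)" ..
  then have "\<forall>n. \<exists>G. Q (f n) (f (Suc n)) G" by iprover
  from choice[OF this] obtain G where G: "\<forall>n. Q (f n) (f (Suc n)) (G n)" ..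
  define r where "r n = fst (f n)" for n
  define s where "s n = fst (snd (f n))" for n
  define M where "M n = snd (snd (f n))" for n
  have fe: "f n = (r n, s n, M n)" for n by (simp add: r_def s_def M_def)
  have Q: "minimal_map (r n) (r (Suc n)) (s n) (s (Suc n)) (G n)"
    "gimg (r n) (r (Suc n)) (G n) = M n" "gker (r n) (r (Suc n)) (G n) = M (Suc n)" for n
    using spec[OF G, of n] by (simp_all add: fe Q_def)
  have 0: "r 0 = 1" "s 0 = (\<lambda>_. 0)" "M 0 = emb J" using spec[OF f, of 0] by (simp_all add: fe P_def)
  define F where "F = \<lparr>rk = (\<lambda>i. r (Suc i)), sh = (\<lambda>i. s (Suc i)), aug = G 0 0, mat = (\<lambda>i. G (Suc i))\<rparr>"
  have l: "lvl_rk F i = r i" "lvl_sh F i = s i" for i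
    using 0 by (cases i; simp add: lvl_rk_def lvl_sh_def F_def)+
  \<comment> \<open>At level 0 every row of \<open>lvl_mat\<close> equals \<open>aug\<close>; it
    agrees with \<open>G 0\<close> as a map because the target has rank one.\<close>
  have ge: "gmap (r i) r' (lvl_mat F i) = gmap (r i) r' (G i)" for i r'
    using 0 by (cases i) (auto simp: lvl_mat_def F_def gmap_def fun_eq_iff)
  have "homog_map (r i) (r (Suc i)) (s i) (s (Suc i)) (lvl_mat F i)" for i
    using minimal_map.axioms(1)[OF Q(1)[of i]] 0
    by (cases i) (auto simp: homog_map_def lvl_mat_def F_def)
  then have "minimal_map (r i) (r (Suc i)) (s i) (s (Suc i)) (lvl_mat F i)" for i
    using minimal_map.axioms(2)[OF Q(1)[of i]]
    by (simp add: minimal_map_def minimal_map_axioms_def gker_def ge)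
  moreover have "gimg (r i) (r (Suc i)) (lvl_mat F i) = M i" "gker (r i) (r (Suc i)) (lvl_mat F i) = M (Suc i)" for i
    using Q(2,3)[of i] by (simp_all add: gimg_def gker_def ge)
  moreover have "rk F i = r (Suc i)" "sh F i = s (Suc i)" for i by (simp_all add: F_def)
  ultimately have "minimal_graded_free_resolution F J"
    unfolding minimal_graded_free_resolution_iff by (simp add: l 0(3))
  then show ?thesis by blast
qed

lemma good_module_mono_ideal:
  assumes "upset A" "bounded_by B A"
  shows "good_module 1 (\<lambda>_. 0) (emb (mono_ideal A :: ('v::finite, 'k::field) mpoly set))"
  unfolding good_module_def
proof (intro conjI allI ballI)
  let ?J = "mono_ideal A :: ('v, 'k) mpoly set"
  have J: "is_ideal ?J" by (rule is_ideal_mono_ideal[OF assms(1)])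
  show "submod (emb ?J)" using J by (simp add: is_ideal_iff submod_def emb_def)
  show "emb ?J \<subseteq> free_module 1" by (auto simp: emb_def free_module_def)
  show "dpart (\<lambda>_. 0) d u \<in> emb ?J" if "u \<in> emb ?J" for u d
    using that dpart_free[of u 1 "\<lambda>_. 0" d]
    by (auto simp: emb_def mono_ideal_def keys_dpart free_module_def)
  show "\<exists>D. \<forall>d. knz (emb ?J) (\<lambda>_. 0) p d \<longrightarrow> d \<le> D" for p
    using knz_mono_ideal_bounded[OF assms] by blast
qed

text \<open>Whichever minimal resolution the choice operator picks, the degrees occurring in it are
  those of Koszul homology.\<close>

lemma graded_betti_mono_ideal:
  fixes A :: "('v::finite \<Rightarrow> nat) set"
  assumes "upset A" "bounded_by B A"
  shows "graded_betti (mono_ideal A :: ('v, 'k::field) mpoly set) i j \<noteq> 0 \<longleftrightarrow>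
    (\<exists>a. (\<Sum>v\<in>UNIV. a v) = j \<and> hnz TYPE('k) (ucube A (\<lambda>v. int (a v))) i)"
proof -
  let ?J = "mono_ideal A :: ('v, 'k) mpoly set"
  define F where "F = (SOME F. minimal_graded_free_resolution F ?J)"
  have "minimal_graded_free_resolution F ?J" unfolding F_def
    by (rule someI_ex[OF minimal_resolution_exists[OF good_module_mono_ideal[OF assms]]])
  note minimal_resolution_knz[OF this, of i j]
  moreover have "finite {b. b < rk F i \<and> sh F i b = j}" by simp
  then have "graded_betti ?J i j \<noteq> 0 \<longleftrightarrow> (\<exists>b<rk F i. sh F i b = j)"
    by (auto simp: graded_betti_def F_def[symmetric])
  ultimately show ?thesis by (simp add: knz_mono_ideal)
qed

theorem reg_mono_ideal_le:
  fixes A A' :: "('v::finite \<Rightarrow> nat) set" and N :: "'v \<Rightarrow> nat"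
  assumes A: "upset A" "bounded_by B A" and A': "upset A'" "bounded_by B' A'"
    and BN: "\<And>v. B v \<le> N v"
    and cmp: "\<And>b i. (\<And>v. b v \<le> int (N v)) \<Longrightarrow> hnz TYPE('k::field) (cube (ints A) b (\<lambda>v. int (N v))) i \<Longrightarrow>
      hnz TYPE('k) (cube (ints A') b (\<lambda>v. int (N v))) i"
  shows "reg (mono_ideal A :: ('v, 'k) mpoly set) \<le> reg (mono_ideal A' :: ('v, 'k) mpoly set)"
  unfolding reg_def
proof (rule Sup_least)
  fix x assume "x \<in> {ereal (real j - real i) |i j. graded_betti (mono_ideal A :: ('v, 'k) mpoly set) i j \<noteq> 0}"
  then obtain i j where x: "x = ereal (real j - real i)"
    and "graded_betti (mono_ideal A :: ('v, 'k) mpoly set) i j \<noteq> 0" by blast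
  then obtain a where a: "(\<Sum>v\<in>UNIV. a v) = j" "hnz TYPE('k) (ucube A (\<lambda>v. int (a v))) i"
    using graded_betti_mono_ideal[OF A] by blast
  have "int (a v) \<le> int (N v)" for v using hnz_ucube_bounded[OF A a(2)] BN order_trans by (simp, blast)
  from hnz_unit_to_long[OF upset_ints[OF A(1)] a(2) this] obtain b i' where
    b: "\<forall>v. b v \<le> int (N v)" "hnz TYPE('k) (cube (ints A) b (\<lambda>v. int (N v))) i'"
    "(\<Sum>v\<in>UNIV. b v) + int (card (UNIV :: 'v set)) + int i = (\<Sum>v\<in>UNIV. int (a v)) + int i'" by blast
  have "hnz TYPE('k) (cube (ints A') b (\<lambda>v. int (N v))) i'" using cmp b(1,2) by blast
  from hnz_long_to_unit[OF upset_ints[OF A'(1)] this] b(1) obtain c where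
    c: "\<And>v. b v < c v" "hnz TYPE('k) (ucube A' c) i'" by blast
  \<comment> \<open>A negative coordinate of \<open>c\<close> makes the complex empty, and the empty
    family has no homology; so \<open>c\<close> is a genuine exponent.\<close>
  have c0: "0 \<le> c v" for v
  proof (rule ccontr)
    assume "\<not> 0 \<le> c v"
    then have "ucube A' c = {}" by (auto simp: cube_def ints_def intro!: exI[of _ v])
    then show False using c(2) hnz_cone[of "{}" v i', where 'k = 'k] by simp
  qed
  define a' where "a' v = nat (c v)" for v
  have c_a': "c = (\<lambda>v. int (a' v))" using c0 by (simp add: a'_def)
  have betti: "graded_betti (mono_ideal A' :: ('v, 'k) mpoly set) i' (\<Sum>v\<in>UNIV. a' v) \<noteq> 0"
    using c(2) unfolding graded_betti_mono_ideal[OF A'] c_a' by blast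
  \<comment> \<open>Strict inequality in each coordinate supplies the summand
    \<open>card UNIV\<close>, matching the one produced on the way to the long cube.\<close>
  have "(\<Sum>v\<in>UNIV. b v) + int (card (UNIV :: 'v set)) \<le> (\<Sum>v\<in>UNIV. int (a' v))"
  proof -
    have "(\<Sum>v\<in>UNIV. b v + 1) \<le> (\<Sum>v\<in>UNIV. int (a' v))"
      by (rule sum_mono) (use c(1) in \<open>simp add: c_a' add1_zle_eq\<close>)
    then show ?thesis by (simp add: sum.distrib)
  qed
  moreover have "int j = (\<Sum>v\<in>UNIV. int (a v))" by (simp flip: a(1))
  ultimately have "int j - int i \<le> int (\<Sum>v\<in>UNIV. a' v) - int i'" using b(3) by (simp only: of_nat_sum)
  then have "real j - real i \<le> real (\<Sum>v\<in>UNIV. a' v) - real i'" by linarith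
  then show "x \<le> Sup {ereal (real j - real i) |i j. graded_betti (mono_ideal A' :: ('v, 'k) mpoly set) i j \<noteq> 0}"
    unfolding x
  proof (intro Sup_upper2)
    show "ereal (real (\<Sum>v\<in>UNIV. a' v) - real i') \<in>
        {ereal (real j - real i) |i j. graded_betti (mono_ideal A' :: ('v, 'k) mpoly set) i j \<noteq> 0}"
      using betti by blast
  qed simp
qed


section \<open>Edges and vertex covers\<close>

definition adj :: "('v \<times> 'v) set \<Rightarrow> 'v \<Rightarrow> 'v \<Rightarrow> bool" where
  "adj E u v \<longleftrightarrow> (u, v) \<in> E \<or> (v, u) \<in> E"

text \<open>Says that the monomial of \<open>b\<close> lies in the \<open>k\<close>-th power of the
  edge ideal of the underlying unweighted graph.\<close>

primrec epow :: "('v \<times> 'v) set \<Rightarrow> nat \<Rightarrow> ('v \<Rightarrow> nat) \<Rightarrow> bool" where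
  "epow E 0 b \<longleftrightarrow> True"
| "epow E (Suc k) b \<longleftrightarrow> (\<exists>u v. adj E u v \<and> b u \<ge> 1 \<and> b v \<ge> 1 \<and> epow E k (\<lambda>x. if x = u \<or> x = v then b x - 1 else b x))"

definition vcover :: "('v \<times> 'v) set \<Rightarrow> 'v set \<Rightarrow> bool" where
  "vcover E C \<longleftrightarrow> (\<forall>u v. adj E u v \<longrightarrow> u \<in> C \<or> v \<in> C)"

text \<open>The analogous condition for the \<open>k\<close>-th symbolic power of the unweighted
  edge ideal.\<close>

definition covdeg :: "('v::finite \<times> 'v) set \<Rightarrow> nat \<Rightarrow> ('v \<Rightarrow> nat) \<Rightarrow> bool" where
  "covdeg E k b \<longleftrightarrow> (\<forall>C. vcover E C \<longrightarrow> k \<le> (\<Sum>v\<in>C. b v))"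

lemma adj_sym: "adj E u v \<longleftrightarrow> adj E v u"
  by (auto simp: adj_def)

lemma epow_mono: "epow E k b \<Longrightarrow> (\<And>v. b v \<le> b' v) \<Longrightarrow> epow E k b'"
proof (induct k arbitrary: b b')
  case (Suc k)
  then obtain u v where uv: "adj E u v" "b u \<ge> 1" "b v \<ge> 1"
    "epow E k (\<lambda>x. if x = u \<or> x = v then b x - 1 else b x)" by auto
  have "epow E k (\<lambda>x. if x = u \<or> x = v then b' x - 1 else b' x)"
    by (rule Suc(1)[OF uv(4)]) (use Suc(3) in \<open>auto intro: diff_le_mono\<close>)
  moreover have "1 \<le> b' u" "1 \<le> b' v" using uv(2,3) Suc(3) order_trans by blast+
  ultimately show ?case using uv(1) unfolding epow.simps by blast
qed simp

lemma epow_SucI: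
  assumes "adj E u v" "b u \<ge> 1" "b v \<ge> 1" "epow E k b'"
    "\<And>x. b' x \<le> (if x = u \<or> x = v then b x - 1 else b x)"
  shows "epow E (Suc k) b"
  using assms(1-3) epow_mono[OF assms(4,5)] unfolding epow.simps by blast

lemma epow_oneI: "adj E u v \<Longrightarrow> b u \<ge> 1 \<Longrightarrow> b v \<ge> 1 \<Longrightarrow> epow E 1 b"
  unfolding One_nat_def epow.simps by blast

lemma covdeg_mono: "covdeg E k b \<Longrightarrow> (\<And>v. b v \<le> b' v) \<Longrightarrow> covdeg E k b'"
  unfolding covdeg_def by (meson order_trans sum_mono)

lemma epow_imp_covdeg: "epow E k b \<Longrightarrow> covdeg E k b"
proof (induct k arbitrary: b)
  case (Suc k)
  then obtain u v where uv: "adj E u v" "b u \<ge> 1" "b v \<ge> 1"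
    "covdeg E k (\<lambda>x. if x = u \<or> x = v then b x - 1 else b x)" by auto
  show ?case unfolding covdeg_def
  proof (intro allI impI)
    fix C assume C: "vcover E C"
    then obtain y where y: "y \<in> C" "y = u \<or> y = v" using uv(1) by (auto simp: vcover_def)
    have "k \<le> (\<Sum>x\<in>C. if x = u \<or> x = v then b x - 1 else b x)" using C uv(4) by (simp add: covdeg_def)
    also have "\<dots> < (\<Sum>x\<in>C. b x)"
      by (rule sum_strict_mono_ex1) (use y uv(2,3) in \<open>auto intro!: bexI[of _ y]\<close>)
    finally show "Suc k \<le> (\<Sum>v\<in>C. b v)" by simp
  qed
qed (simp add: covdeg_def)

lemma epow_min: "epow E k b \<Longrightarrow> epow E k (\<lambda>v. min (b v) k)"
proof (induct k arbitrary: b)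
  case (Suc k)
  then obtain u v where uv: "adj E u v" "b u \<ge> 1" "b v \<ge> 1"
    "epow E k (\<lambda>x. min (if x = u \<or> x = v then b x - 1 else b x) k)" by auto
  then show ?case by (intro epow_SucI[OF uv(1) _ _ uv(4)]) auto
qed simp

lemma covdeg_min: "covdeg E k b \<Longrightarrow> covdeg E k (\<lambda>v. min (b v) k)"
  unfolding covdeg_def
proof (intro allI impI)
  fix C assume "\<forall>C. vcover E C \<longrightarrow> k \<le> (\<Sum>v\<in>C. b v)" "vcover E C"
  then have C: "k \<le> (\<Sum>v\<in>C. b v)" by blast
  show "k \<le> (\<Sum>v\<in>C. min (b v) k)"
  proof (cases "\<exists>v\<in>C. b v \<ge> k")
    case True
    then obtain v where v: "v \<in> C" "b v \<ge> k" by blast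
    then show ?thesis using member_le_sum[of v C "\<lambda>v. min (b v) k"] by simp
  next
    case False
    then have "(\<Sum>v\<in>C. min (b v) k) = (\<Sum>v\<in>C. b v)" by (intro sum.cong) auto
    then show ?thesis using C by simp
  qed
qed

lemma epow_repeat: "adj E u v \<Longrightarrow> u \<noteq> v \<Longrightarrow> b u \<ge> k \<Longrightarrow> b v \<ge> k \<Longrightarrow> epow E k b"
proof (induct k arbitrary: b)
  case (Suc k)
  have "epow E k (\<lambda>x. if x = u \<or> x = v then b x - 1 else b x)"
    by (rule Suc(1)) (use Suc(2-) in auto)
  then show ?case by (rule epow_SucI[rotated 3]) (use Suc(2-) in auto)
qed simp

lemma covdeg_one:
  assumes "covdeg E 1 b"
  shows "epow E 1 b"
proof -
  have "\<not> vcover E {v. b v = 0}" using assms by (force simp: covdeg_def)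
  then show ?thesis by (auto simp: vcover_def Suc_le_eq)
qed

text \<open>The corner of a long cube with upper end \<open>k * w v\<close>, after division by the
  weights.\<close>

definition fill :: "nat \<Rightarrow> 'v set \<Rightarrow> ('v \<Rightarrow> nat) \<Rightarrow> 'v \<Rightarrow> nat" where
  "fill k \<tau> \<beta> v = (if v \<in> \<tau> then \<beta> v else k)"

section \<open>Edges against covers at the corners of a long cube\<close>

context
  fixes E :: "('v::finite \<times> 'v) set"
  assumes irrefl: "\<not> adj E v v"
begin

lemma adj_neq: "adj E u v \<Longrightarrow> u \<noteq> v"
  using irrefl by metis

lemma epow_2I:
  assumes "adj E p q" "adj E p' q'" "b p \<ge> 1" "b q \<ge> 1" "b p' \<ge> 1" "b q' \<ge> 1"
    "p \<noteq> p' \<or> b p \<ge> 2" "q \<noteq> q' \<or> b q \<ge> 2" "p \<noteq> q'" "q \<noteq> p'"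
  shows "epow E 2 b"
proof -
  have "epow E 1 (\<lambda>x. if x = p \<or> x = q then b x - 1 else b x)"
    using assms(3-) adj_neq[OF assms(1)] adj_neq[OF assms(2)] by (intro epow_oneI[OF assms(2)]) auto
  then have "epow E (Suc 1) b" by (rule epow_SucI[OF assms(1,3,4)]) simp
  then show ?thesis by (simp only: Suc_1)
qed

text \<open>Edges in the support of \<open>c\<close> meet pairwise, so they form a star or a
  triangle. For a star some vertex of value 1 meets them all: the centre of a path has value 1, and
  a single edge cannot have value 2 at both ends. With the zero set of \<open>c\<close> that vertex
  would be a cover of degree 1.\<close>

lemma covdeg_2_triangle:
  assumes cov: "covdeg E 2 c" and no: "\<not> epow E 2 c"
  obtains x z t where "adj E x z" "adj E z t" "adj E x t" "c x = 1" "c z = 1" "c t = 1"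
proof -
  \<comment> \<open>Zeros of \<open>c\<close> cost nothing in a cover, so a set \<open>X\<close> of
    weight below 2 misses some edge of the support.\<close>
  have edge: "\<exists>p q. adj E p q \<and> p \<notin> X \<and> q \<notin> X \<and> c p \<ge> 1 \<and> c q \<ge> 1" if "(\<Sum>v\<in>X. c v) < 2" for X
  proof -
    have "(\<Sum>v\<in>X \<union> {v. c v = 0}. c v) = (\<Sum>v\<in>X. c v)"
      by (rule sum.mono_neutral_right) auto
    then have "\<not> vcover E (X \<union> {v. c v = 0})" using that cov by (auto simp: covdeg_def not_le)
    then show ?thesis by (auto simp: vcover_def Suc_le_eq)
  qed
  have meet: "p = p' \<or> p = q' \<or> q = p' \<or> q = q'"
    if "adj E p q" "adj E p' q'" "c p \<ge> 1" "c q \<ge> 1" "c p' \<ge> 1" "c q' \<ge> 1" for p q p' q'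
    using that epow_2I[of p q p' q' c] no by blast
  have share: "c z = 1" if "adj E x z" "adj E z t" "x \<noteq> t" "c x \<ge> 1" "c z \<ge> 1" "c t \<ge> 1" for x z t
  proof (rule ccontr)
    assume "c z \<noteq> 1"
    then have "epow E 2 c"
      using that adj_neq[OF that(1)] adj_neq[OF that(2)] by (intro epow_2I[of x z t z]) (auto simp: adj_sym)
    then show False using no by blast
  qed
  obtain x0 z0 where 0: "adj E x0 z0" "c x0 \<ge> 1" "c z0 \<ge> 1" using edge[of "{}"] by auto
  have "\<not> (c x0 \<ge> 2 \<and> c z0 \<ge> 2)" using epow_repeat[OF 0(1) adj_neq[OF 0(1)], of 2 c] no by blast
  then obtain x z where xz: "adj E x z" "c x = 1" "c z \<ge> 1"
  proof (cases "c x0 = 1")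
    case False
    then have "c z0 = 1" using \<open>\<not> (c x0 \<ge> 2 \<and> c z0 \<ge> 2)\<close> 0 by linarith
    then show thesis using 0 by (intro that[of z0 x0]) (auto simp: adj_sym)
  qed (use 0 in \<open>intro that[of x0 z0], auto\<close>)
  obtain p q where pq: "adj E p q" "p \<noteq> x" "q \<noteq> x" "c p \<ge> 1" "c q \<ge> 1"
    using edge[of "{x}"] xz(2) by auto
  have "p = z \<or> q = z" using meet[OF xz(1) pq(1)] xz pq by auto
  then obtain t where t: "adj E z t" "t \<noteq> x" "c t \<ge> 1" using pq by (metis adj_sym)
  have cz: "c z = 1" by (rule share[OF xz(1) t(1)]) (use xz t in auto)
  obtain p' q' where pq': "adj E p' q'" "p' \<noteq> z" "q' \<noteq> z" "c p' \<ge> 1" "c q' \<ge> 1"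
    using edge[of "{z}"] cz by auto
  have "p' = x \<or> q' = x" using meet[OF xz(1) pq'(1)] xz pq' by auto
  moreover have "p' = t \<or> q' = t" using meet[OF t(1) pq'(1)] cz t pq' by auto
  ultimately have xt: "adj E x t" using pq'(1) t(2) by (metis adj_sym)
  have "c t = 1" by (rule share[of x t z]) (use xz cz t xt adj_neq[OF xz(1)] in \<open>auto simp: adj_sym\<close>)
  then show thesis using that xz t(1) xt cz by blast
qed

text \<open>Passing from \<open>C\<close> to \<open>(C - U) \<union> N(U)\<close>, where \<open>U = -\<tau>\<close> is independent.\<close>

lemma neighbour_in_support:
  assumes cov: "covdeg E k (fill k \<tau> \<beta>)" and no: "\<not> covdeg E k \<beta>"
    and ind: "\<And>u v. u \<notin> \<tau> \<Longrightarrow> v \<notin> \<tau> \<Longrightarrow> \<not> adj E u v"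
  obtains u y where "u \<notin> \<tau>" "adj E u y" "y \<in> \<tau>" "\<beta> y \<ge> 1"
proof (rule ccontr)
  assume "\<not> thesis"
  with that have z: "\<beta> y = 0" if "u \<notin> \<tau>" "adj E u y" "y \<in> \<tau>" for u y
    using that by (metis One_nat_def Suc_le_eq not_gr_zero)
  have "covdeg E k \<beta>" unfolding covdeg_def
  proof (intro allI impI)
    fix C assume C: "vcover E C"
    define D where "D = {y \<in> \<tau>. \<exists>u. u \<notin> \<tau> \<and> adj E u y}"
    have "vcover E (C \<inter> \<tau> \<union> D)" unfolding vcover_def
    proof (intro allI impI)
      fix u v assume uv: "adj E u v"
      then have "u \<in> \<tau> \<or> v \<in> \<tau>" using ind by blast
      then show "u \<in> C \<inter> \<tau> \<union> D \<or> v \<in> C \<inter> \<tau> \<union> D"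
        using uv C adj_sym[of E u v] unfolding vcover_def D_def by blast
    qed
    then have "k \<le> (\<Sum>v\<in>C \<inter> \<tau> \<union> D. fill k \<tau> \<beta> v)" using cov by (simp add: covdeg_def)
    also have "\<dots> = (\<Sum>v\<in>C \<inter> \<tau>. fill k \<tau> \<beta> v)"
      by (rule sum.mono_neutral_right) (use z in \<open>auto simp: D_def fill_def\<close>)
    also have "\<dots> = (\<Sum>v\<in>C \<inter> \<tau>. \<beta> v)" by (rule sum.cong) (auto simp: fill_def)
    also have "\<dots> \<le> (\<Sum>v\<in>C. \<beta> v)" by (rule sum_mono2) auto
    finally show "k \<le> (\<Sum>v\<in>C. \<beta> v)" .
  qed
  then show False using no by blast
qed

text \<open>The edge from \<open>u\<close> to \<open>y\<close> is removed, and the value at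
  \<open>u\<close> drops from \<open>Suc k\<close> to \<open>k\<close>. A cover inside \<tau> misses
  \<open>u\<close>, so it contains \<open>y\<close> and loses exactly one; any other cover contains
  a vertex of value \<open>k\<close>.\<close>

lemma peel:
  assumes "u \<notin> \<tau>" "adj E u y" "y \<in> \<tau>" "\<beta> y \<ge> 1"
  shows "epow E k (fill k \<tau> (\<beta>(y := \<beta> y - 1))) \<Longrightarrow> epow E (Suc k) (fill (Suc k) \<tau> \<beta>)"
    and "covdeg E (Suc k) (fill (Suc k) \<tau> \<beta>) \<Longrightarrow> covdeg E k (fill k \<tau> (\<beta>(y := \<beta> y - 1)))"
proof -
  show "epow E (Suc k) (fill (Suc k) \<tau> \<beta>)" if "epow E k (fill k \<tau> (\<beta>(y := \<beta> y - 1)))"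
    by (rule epow_SucI[OF assms(2) _ _ that]) (use assms in \<open>auto simp: fill_def\<close>)
  show "covdeg E k (fill k \<tau> (\<beta>(y := \<beta> y - 1)))" if cov: "covdeg E (Suc k) (fill (Suc k) \<tau> \<beta>)"
    unfolding covdeg_def
  proof (intro allI impI)
    fix C assume C: "vcover E C"
    show "k \<le> (\<Sum>v\<in>C. fill k \<tau> (\<beta>(y := \<beta> y - 1)) v)"
    proof (cases "C \<subseteq> \<tau>")
      case True
      then have "y \<in> C" using C assms(1,2) by (auto simp: vcover_def)
      have "Suc k \<le> (\<Sum>v\<in>C. \<beta> v)"
        using cov C True by (auto simp: covdeg_def fill_def subset_iff cong: sum.cong)
      also have "\<dots> = \<beta> y + (\<Sum>v\<in>C - {y}. \<beta> v)" using \<open>y \<in> C\<close> by (simp add: sum.remove)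
      finally have "k \<le> (\<beta> y - 1) + (\<Sum>v\<in>C - {y}. \<beta> v)" using assms(4) by simp
      also have "\<dots> = (\<Sum>v\<in>C. (\<beta>(y := \<beta> y - 1)) v)"
        using \<open>y \<in> C\<close> by (simp add: sum.remove[of C y])
      also have "\<dots> = (\<Sum>v\<in>C. fill k \<tau> (\<beta>(y := \<beta> y - 1)) v)"
        using True by (intro sum.cong) (auto simp: fill_def)
      finally show ?thesis .
    next
      case False
      then obtain v where "v \<in> C" "v \<notin> \<tau>" by blast
      then show ?thesis using member_le_sum[of v C "fill k \<tau> (\<beta>(y := \<beta> y - 1))"] by (simp add: fill_def)
    qed
  qed
qed

text \<open>An edge off \<tau> can be used twice; otherwise peeling once reduces to
  \<open>k = 1\<close>, where covers and edges agree.\<close>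

lemma covdeg_fill_2:
  assumes "covdeg E 2 (fill 2 \<tau> \<beta>)" "\<not> covdeg E 2 \<beta>"
  shows "epow E 2 (fill 2 \<tau> \<beta>)"
proof (cases "\<exists>u v. u \<notin> \<tau> \<and> v \<notin> \<tau> \<and> adj E u v")
  case True
  then show ?thesis using epow_repeat[of E _ _ 2 "fill 2 \<tau> \<beta>"] adj_neq by (auto simp: fill_def)
next
  case False
  then obtain u y where uy: "u \<notin> \<tau>" "adj E u y" "y \<in> \<tau>" "\<beta> y \<ge> 1"
    using neighbour_in_support[OF assms] by blast
  show ?thesis using peel[where \<beta> = \<beta> and u = u and y = y and \<tau> = \<tau> and k = 1, OF uy] covdeg_one assms(1) unfolding numeral_2_eq_2 One_nat_def by blast
qed

text \<open>No edge lies off \<tau>, since it could be used three times. So peeling applies, and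
  \<open>y\<close> is the vertex peeled off before the triangle of \<open>covdeg_2_triangle\<close>
  appears.\<close>

lemma covdeg_fill_3:
  assumes cov: "covdeg E 3 (fill 3 \<tau> \<beta>)" "\<not> covdeg E 3 \<beta>" and no: "\<not> epow E 3 (fill 3 \<tau> \<beta>)"
  obtains y x z t where "adj E x z" "adj E z t" "adj E x t" "y \<noteq> x" "y \<noteq> z" "y \<noteq> t"
    "\<beta> x \<ge> 1" "\<beta> z \<ge> 1" "\<beta> t \<ge> 1" "\<beta> y \<ge> 1"
proof -
  have "\<not> adj E u v" if "u \<notin> \<tau>" "v \<notin> \<tau>" for u v
    using that no epow_repeat[of E u v 3 "fill 3 \<tau> \<beta>"] adj_neq by (auto simp: fill_def)
  then obtain u y where uy: "u \<notin> \<tau>" "adj E u y" "y \<in> \<tau>" "\<beta> y \<ge> 1"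
    using neighbour_in_support[OF cov] by blast
  define c where "c = fill 2 \<tau> (\<beta>(y := \<beta> y - 1))"
  have 3: "3 = Suc 2" by simp
  have c: "covdeg E 2 c" "\<not> epow E 2 c" using peel[where \<beta> = \<beta> and u = u and y = y and \<tau> = \<tau> and k = 2, OF uy] cov(1) no unfolding c_def 3 by blast+
  then obtain x z t where xzt: "adj E x z" "adj E z t" "adj E x t" "c x = 1" "c z = 1" "c t = 1"
    using covdeg_2_triangle by blast
  have cu: "c u = 2" using uy(1) by (simp add: c_def fill_def)
  \<comment> \<open>If \<open>y\<close> were a triangle vertex \<open>s\<close>, the edges
    \<open>u s\<close> and \<open>p q\<close> would be disjoint, because \<open>c u = 2\<close>
    keeps \<open>u\<close> off the triangle. Then value 1 instead of 2 at \<open>s\<close> places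
    \<open>s\<close> in \<tau>, where \<open>c\<close> agrees with \<beta>.\<close>
  have "y \<noteq> s \<and> \<beta> s \<ge> 1" if s: "c s = 1" "adj E p q" "s \<noteq> p" "s \<noteq> q" "c p = 1" "c q = 1" for s p q
  proof
    show "y \<noteq> s"
    proof
      assume "y = s"
      then have "epow E 2 c" using s uy(2) cu by (intro epow_2I[of u s p q]) auto
      then show False using c(2) by blast
    qed
    then show "\<beta> s \<ge> 1" using s(1) by (auto simp: c_def fill_def split: if_splits)
  qed
  from this[of x z t] this[of z x t] this[of t x z] show thesis
    using that[of x z t y] xzt uy(4) adj_neq adj_sym by metis
qed

text \<open>Covers avoiding \<open>y\<close> do not notice the change. A cover containing
  \<open>y\<close> also contains two vertices of the triangle, and these three values already add up
  to 3.\<close>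

lemma covdeg_fill_cone:
  assumes "adj E x z" "adj E z t" "adj E x t" "y \<noteq> x" "y \<noteq> z" "y \<noteq> t"
    "\<beta> x \<ge> 1" "\<beta> z \<ge> 1" "\<beta> t \<ge> 1" "\<beta> y \<ge> 1" and cov: "covdeg E 3 (fill 3 \<tau> \<beta>)"
  shows "covdeg E 3 (fill 3 (insert y \<tau>) \<beta>)"
  unfolding covdeg_def
proof (intro allI impI)
  fix C assume C: "vcover E C"
  let ?g = "fill 3 (insert y \<tau>) \<beta>"
  show "3 \<le> (\<Sum>v\<in>C. ?g v)"
  proof (cases "y \<in> C")
    case True
    obtain p q where pq: "p \<noteq> q" "p \<noteq> y" "q \<noteq> y" "p \<in> C" "q \<in> C" "\<beta> p \<ge> 1" "\<beta> q \<ge> 1"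
      using C assms adj_neq unfolding vcover_def by metis
    have "3 \<le> (\<Sum>v\<in>{y, p, q}. ?g v)"
      using pq assms(10) by (auto simp: fill_def)
    also have "\<dots> \<le> (\<Sum>v\<in>C. ?g v)" by (rule sum_mono2) (use True pq in auto)
    finally show ?thesis .
  next
    case False
    then have "(\<Sum>v\<in>C. ?g v) = (\<Sum>v\<in>C. fill 3 \<tau> \<beta> v)" by (intro sum.cong) (auto simp: fill_def)
    then show ?thesis using C cov by (simp add: covdeg_def)
  qed
qed

end


section \<open>Monomial ideals and localization\<close>

lemma ideal_gen_least: "S \<subseteq> K \<Longrightarrow> is_ideal K \<Longrightarrow> ideal_gen S \<subseteq> K"
  unfolding ideal_gen_def is_ideal_def by (rule module.span_minimal[OF ring_module])

lemma is_ideal_gen: "is_ideal (ideal_gen S)"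
  unfolding ideal_gen_def is_ideal_def by (rule module.subspace_span[OF ring_module])

lemma ideal_gen_base: "f \<in> S \<Longrightarrow> f \<in> ideal_gen S"
  unfolding ideal_gen_def by (rule module.span_base[OF ring_module])

lemma ideal_sum: "is_ideal K \<Longrightarrow> (\<And>x. x \<in> X \<Longrightarrow> f x \<in> K) \<Longrightarrow> (\<Sum>x\<in>X. f x) \<in> K"
  unfolding is_ideal_def by (rule module.subspace_sum[OF ring_module])

lemma ideal_from_terms:
  assumes "is_ideal K" "\<And>m. m \<in> keys f \<Longrightarrow> Poly_Mapping.single m (lookup f m) \<in> K"
  shows "f \<in> K"
  by (subst poly_expand) (intro ideal_sum assms)

lemma indet_power: "indet v ^ n = (Poly_Mapping.single (Poly_Mapping.single v n) 1 :: ('v, 'k::field) mpoly)"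
proof (induct n)
  case (Suc n)
  then show ?case by (simp add: indet_def mult_single flip: single_add)
qed simp

section \<open>Contraction from the localization at a prime\<close>

lemma frac_eq_imp:
  assumes "is_prime_ideal P" "frac P f 1 = frac P a s" "s \<notin> P"
  obtains u where "u \<notin> P" "u * (a - f * s) = 0"
proof -
  have "1 \<notin> P"
    using assms(1) by (auto simp: is_prime_ideal_def is_ideal_iff) (metis mult.right_neutral)
  then have "(f, 1) \<in> frac P f 1" by (auto simp: frac_def frac_rel_def)
  then have "(f, 1) \<in> frac P a s" by (simp add: assms(2))
  then show thesis using that by (auto simp: frac_def frac_rel_def)
qed

text \<open>The extra multiplier \<open>u\<close> in the equality of fractions is absorbed into
  \<open>s\<close>, since a product of elements outside a prime stays outside.\<close>

lemma loc_contraction_iff: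
  assumes P: "is_prime_ideal P" and K: "is_ideal K"
  shows "f \<in> loc_contraction P (loc_extension P K) \<longleftrightarrow> (\<exists>s. s \<notin> P \<and> s * f \<in> K)"
proof
  assume "f \<in> loc_contraction P (loc_extension P K)"
  then obtain a s where as: "a \<in> K" "s \<notin> P" "frac P f 1 = frac P a s"
    by (auto simp: loc_contraction_def loc_extension_def)
  from frac_eq_imp[OF P as(3,2)] obtain u where u: "u \<notin> P" "u * (a - f * s) = 0" .
  then have "(u * s) * f = u * a" by (simp add: algebra_simps)
  moreover have "u * a \<in> K" using K as(1) by (simp add: is_ideal_iff)
  moreover have "u * s \<notin> P" using P u(1) as(2) by (auto simp: is_prime_ideal_def)
  ultimately show "\<exists>s. s \<notin> P \<and> s * f \<in> K" by metis
next
  assume "\<exists>s. s \<notin> P \<and> s * f \<in> K"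
  then obtain s where s: "s \<notin> P" "s * f \<in> K" by blast
  have "1 \<notin> P"
    using P by (auto simp: is_prime_ideal_def is_ideal_iff) (metis mult.right_neutral)
  have "(\<exists>u. u \<notin> P \<and> u * (f * t - b * 1) = 0) \<longleftrightarrow> (\<exists>u. u \<notin> P \<and> u * ((s * f) * t - b * s) = 0)" for b t
  proof
    assume "\<exists>u. u \<notin> P \<and> u * (f * t - b * 1) = 0"
    then obtain u where u: "u \<notin> P" "u * (f * t - b * 1) = 0" by blast
    have "u * ((s * f) * t - b * s) = s * (u * (f * t - b * 1))" by (simp add: algebra_simps)
    then show "\<exists>u. u \<notin> P \<and> u * ((s * f) * t - b * s) = 0" using u by auto
  next
    assume "\<exists>u. u \<notin> P \<and> u * ((s * f) * t - b * s) = 0"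
    then obtain u where u: "u \<notin> P" "u * ((s * f) * t - b * s) = 0" by blast
    have "(u * s) * (f * t - b * 1) = u * ((s * f) * t - b * s)" by (simp add: algebra_simps)
    moreover have "u * s \<notin> P" using P u(1) s(1) by (auto simp: is_prime_ideal_def)
    ultimately show "\<exists>u. u \<notin> P \<and> u * (f * t - b * 1) = 0" using u(2) by metis
  qed
  then have "frac P f 1 = frac P (s * f) s"
    using s(1) \<open>1 \<notin> P\<close> unfolding frac_def frac_rel_def by fastforce
  then show "f \<in> loc_contraction P (loc_extension P K)"
    using s by (auto simp: loc_contraction_def loc_extension_def)
qed

text \<open>Lexicographically smallest elements; this replaces a monomial order.\<close>

lemma unique_sum:
  fixes X Y :: "('v::finite \<Rightarrow>\<^sub>0 nat) set"
  assumes "X \<noteq> {}" "Y \<noteq> {}"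
  obtains x y where "x \<in> X" "y \<in> Y" "\<And>x' y'. x' \<in> X \<Longrightarrow> y' \<in> Y \<Longrightarrow> x' + y' = x + y \<Longrightarrow> x' = x \<and> y' = y"
proof -
  define Q where "Q T \<longleftrightarrow> (\<exists>X' Y'. X' \<subseteq> X \<and> Y' \<subseteq> Y \<and> X' \<noteq> {} \<and> Y' \<noteq> {} \<and>
    (\<forall>x\<in>X'. \<forall>x'\<in>X'. \<forall>v\<in>T. lookup x v = lookup x' v) \<and> (\<forall>y\<in>Y'. \<forall>y'\<in>Y'. \<forall>v\<in>T. lookup y v = lookup y' v) \<and>
    (\<forall>x\<in>X'. \<forall>y\<in>Y'. \<forall>x'\<in>X. \<forall>y'\<in>Y. x' + y' = x + y \<longrightarrow> x' \<in> X' \<and> y' \<in> Y'))" for T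
  have "finite (UNIV :: 'v set)" by simp
  then have "Q UNIV"
  proof induct
    case empty
    show ?case unfolding Q_def using assms by (intro exI[of _ X] exI[of _ Y]) auto
  next
    case (insert v T)
    then obtain X' Y' where X': "X' \<subseteq> X" "X' \<noteq> {}" "\<forall>x\<in>X'. \<forall>x'\<in>X'. \<forall>v\<in>T. lookup x v = lookup x' v"
      and Y': "Y' \<subseteq> Y" "Y' \<noteq> {}" "\<forall>y\<in>Y'. \<forall>y'\<in>Y'. \<forall>v\<in>T. lookup y v = lookup y' v"
      and u: "\<forall>x\<in>X'. \<forall>y\<in>Y'. \<forall>x'\<in>X. \<forall>y'\<in>Y. x' + y' = x + y \<longrightarrow> x' \<in> X' \<and> y' \<in> Y'"
      unfolding Q_def by blast
    obtain x0 where x0: "x0 \<in> X'" "\<And>x. x \<in> X' \<Longrightarrow> lookup x0 v \<le> lookup x v"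
      using ex_has_least_nat[of "\<lambda>x. x \<in> X'" _ "\<lambda>x. lookup x v"] X'(2) by blast
    obtain y0 where y0: "y0 \<in> Y'" "\<And>y. y \<in> Y' \<Longrightarrow> lookup y0 v \<le> lookup y v"
      using ex_has_least_nat[of "\<lambda>x. x \<in> Y'" _ "\<lambda>x. lookup x v"] Y'(2) by blast
    define X'' where "X'' = {x \<in> X'. lookup x v = lookup x0 v}"
    define Y'' where "Y'' = {y \<in> Y'. lookup y v = lookup y0 v}"
    have "\<forall>x\<in>X''. \<forall>y\<in>Y''. \<forall>x'\<in>X. \<forall>y'\<in>Y. x' + y' = x + y \<longrightarrow> x' \<in> X'' \<and> y' \<in> Y''"
    proof (intro ballI impI)
      fix x y x' y' assume that: "x \<in> X''" "y \<in> Y''" "x' \<in> X" "y' \<in> Y" "x' + y' = x + y"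
      then have xy: "x \<in> X'" "y \<in> Y'" "lookup x v = lookup x0 v" "lookup y v = lookup y0 v"
        by (simp_all add: X''_def Y''_def)
      then have 1: "x' \<in> X'" "y' \<in> Y'" using u that(3-5) by blast+
      have "lookup x' v + lookup y' v = lookup x0 v + lookup y0 v"
        using arg_cong[OF that(5), of "\<lambda>m. lookup m v"] xy by (simp add: lookup_add)
      then show "x' \<in> X'' \<and> y' \<in> Y''"
        using 1 x0(2)[OF 1(1)] y0(2)[OF 1(2)] by (simp add: X''_def Y''_def)
    qed
    moreover have "X'' \<subseteq> X" "Y'' \<subseteq> Y" "X'' \<noteq> {}" "Y'' \<noteq> {}"
      using X'(1) Y'(1) x0(1) y0(1) by (auto simp: X''_def Y''_def)
    moreover have "\<forall>x\<in>X''. \<forall>x'\<in>X''. \<forall>v\<in>insert v T. lookup x v = lookup x' v"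
      using X'(3) by (auto simp: X''_def)
    moreover have "\<forall>y\<in>Y''. \<forall>y'\<in>Y''. \<forall>v\<in>insert v T. lookup y v = lookup y' v"
      using Y'(3) by (auto simp: Y''_def)
    ultimately show ?case unfolding Q_def by - (rule exI[of _ X''], rule exI[of _ Y''], intro conjI)
  qed
  then obtain X' Y' where X': "X' \<subseteq> X" "X' \<noteq> {}" "\<forall>x\<in>X'. \<forall>x'\<in>X'. \<forall>v\<in>UNIV. lookup x v = lookup x' v"
    and Y': "Y' \<subseteq> Y" "Y' \<noteq> {}" "\<forall>y\<in>Y'. \<forall>y'\<in>Y'. \<forall>v\<in>UNIV. lookup y v = lookup y' v"
    and u: "\<forall>x\<in>X'. \<forall>y\<in>Y'. \<forall>x'\<in>X. \<forall>y'\<in>Y. x' + y' = x + y \<longrightarrow> x' \<in> X' \<and> y' \<in> Y'"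
    unfolding Q_def by blast
  obtain x y where xy: "x \<in> X'" "y \<in> Y'" using X'(2) Y'(2) by blast
  show thesis
  proof
    show "x \<in> X" "y \<in> Y" using xy X'(1) Y'(1) by blast+
    fix x' y' assume "x' \<in> X" "y' \<in> Y" "x' + y' = x + y"
    then have "x' \<in> X'" "y' \<in> Y'" using u xy by blast+
    then show "x' = x \<and> y' = y" using X'(3) Y'(3) xy by (blast intro: poly_mapping_eqI)
  qed
qed

lemma lookup_times_unique:
  fixes f g :: "('v::finite, 'k::field) mpoly"
  assumes "x \<in> keys f" "y \<in> keys g"
    "\<And>x' y'. x' \<in> keys f \<Longrightarrow> y' \<in> keys g \<Longrightarrow> x' + y' = x + y \<Longrightarrow> x' = x \<and> y' = y"
  shows "x + y \<in> keys (f * g)"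
proof -
  have "lookup (f * g) (x + y) = (\<Sum>m\<in>keys f. \<Sum>m'\<in>keys g. if m = x \<and> m' = y then lookup f m * lookup g m' else 0)"
    unfolding lookup_times using assms(3) by (intro sum.cong if_cong refl) blast
  also have "\<dots> = (\<Sum>m\<in>keys f. if m = x then lookup f m * lookup g y else 0)"
    using assms(2) by (intro sum.cong) (auto simp: if_distrib cong: if_cong)
  also have "\<dots> = lookup f x * lookup g y" using assms(1) by simp
  finally show ?thesis using assms(1,2) by (simp add: in_keys_iff)
qed

text \<open>The monomial prime generated by the variables in \<open>C\<close>.\<close>

definition face_ideal :: "'v set \<Rightarrow> ('v, 'k::field) mpoly set" where
  "face_ideal C = mono_ideal {x. \<exists>v\<in>C. x v \<ge> 1}"

lemma upset_face: "upset {x :: 'v \<Rightarrow> nat. \<exists>v\<in>C. x v \<ge> 1}"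
  by (auto simp: upset_def intro: order_trans)

text \<open>
  A term of \<open>f\<close> outside \<open>A\<close> of least degree in \<open>C\<close>, times a term of \<open>s\<close> free of \<open>C\<close>, survives in
  \<open>s * f\<close>.
\<close>

lemma mono_ideal_primary:
  fixes f s :: "('v::finite, 'k::field) mpoly"
  assumes A: "upset A" and dep: "\<And>x y. (\<And>v. v \<in> C \<Longrightarrow> x v = y v) \<Longrightarrow> x \<in> A \<Longrightarrow> y \<in> A"
    and s: "s \<notin> face_ideal C" and sf: "s * f \<in> mono_ideal A"
  shows "f \<in> mono_ideal A"
proof (rule ccontr)
  assume "f \<notin> mono_ideal A"
  then obtain m0 where "m0 \<in> keys f" "lookup m0 \<notin> A" by (auto simp: mono_ideal_def)
  define dg where "dg m = (\<Sum>v\<in>C. lookup m v)" for m :: "'v \<Rightarrow>\<^sub>0 nat"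
  obtain m1 where m1: "m1 \<in> keys f \<and> lookup m1 \<notin> A"
    "\<And>m. m \<in> keys f \<and> lookup m \<notin> A \<Longrightarrow> dg m1 \<le> dg m"
    using ex_has_least_nat[of "\<lambda>m. m \<in> keys f \<and> lookup m \<notin> A" m0 dg] \<open>m0 \<in> keys f\<close> \<open>lookup m0 \<notin> A\<close> by blast
  define X where "X = {m \<in> keys f. lookup m \<notin> A \<and> dg m = dg m1}"
  define Y where "Y = {m \<in> keys s. \<forall>v\<in>C. lookup m v = 0}"
  have "X \<noteq> {}" using m1 by (auto simp: X_def)
  have "Y \<noteq> {}" using s by (auto simp: Y_def face_ideal_def mono_ideal_def Suc_le_eq)
  from unique_sum[OF \<open>X \<noteq> {}\<close> this] obtain x y where xy: "x \<in> X" "y \<in> Y"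
    "\<And>x' y'. x' \<in> X \<Longrightarrow> y' \<in> Y \<Longrightarrow> x' + y' = x + y \<Longrightarrow> x' = x \<and> y' = y" by blast
  have y0: "lookup y v = 0" if "v \<in> C" for v using xy(2) that by (simp add: Y_def)
  have "x + y \<in> keys (f * s)"
  proof (rule lookup_times_unique)
    show "x \<in> keys f" "y \<in> keys s" using xy by (auto simp: X_def Y_def)
    fix x' y' assume x'y': "x' \<in> keys f" "y' \<in> keys s" "x' + y' = x + y"
    have sum: "lookup x' v + lookup y' v = lookup x v" if "v \<in> C" for v
      using arg_cong[OF x'y'(3), of "\<lambda>m. lookup m v"] y0[OF that] by (simp add: lookup_add)
    have "lookup x' \<notin> A"
    proof
      assume "lookup x' \<in> A"
      then have "(\<lambda>v. if v \<in> C then lookup x v else lookup x' v) \<in> A"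
        by (rule upsetD[OF A]) (use sum in \<open>fastforce\<close>)
      then have "lookup x \<in> A" by (rule dep[rotated]) simp
      then show False using xy(1) by (simp add: X_def)
    qed
    moreover have dgs: "dg x' + (\<Sum>v\<in>C. lookup y' v) = dg x"
      using sum by (simp add: dg_def sum.distrib[symmetric])
    moreover have "dg x = dg m1" using xy(1) by (simp add: X_def)
    ultimately have "dg x' = dg m1" "(\<Sum>v\<in>C. lookup y' v) = 0"
      using m1(2)[of x'] x'y'(1) by linarith+
    then have "x' \<in> X" "y' \<in> Y" using x'y' \<open>lookup x' \<notin> A\<close> by (auto simp: X_def Y_def)
    then show "x' = x \<and> y' = y" using xy(3) x'y'(3) by blast
  qed
  then have "lookup (x + y) \<in> A" using sf by (simp add: mono_ideal_def mult.commute)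
  then have "lookup x \<in> A" by (rule dep[rotated]) (simp add: lookup_add y0)
  then show False using xy(1) by (simp add: X_def)
qed

lemma face_ideal_prime: "is_prime_ideal (face_ideal C :: ('v::finite, 'k::field) mpoly set)"
  unfolding is_prime_ideal_def
proof (intro conjI allI impI)
  show "is_ideal (face_ideal C :: ('v, 'k) mpoly set)"
    unfolding face_ideal_def by (rule is_ideal_mono_ideal[OF upset_face])
  have "1 \<notin> (face_ideal C :: ('v, 'k) mpoly set)" by (auto simp: face_ideal_def mono_ideal_def)
  then show "face_ideal C \<noteq> (UNIV :: ('v, 'k) mpoly set)" by blast
  fix a b :: "('v, 'k) mpoly" assume ab: "a * b \<in> face_ideal C"
  show "a \<in> face_ideal C \<or> b \<in> face_ideal C"
  proof (cases "a \<in> face_ideal C")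
    case False
    have "b \<in> mono_ideal {x. \<exists>v\<in>C. x v \<ge> 1}"
      by (rule mono_ideal_primary[OF upset_face _ False ab[unfolded face_ideal_def]]) auto
    then show ?thesis by (simp add: face_ideal_def)
  qed simp
qed

lemma prime_ideal_monomial:
  fixes P :: "('v::finite, 'k::field) mpoly set"
  assumes "is_prime_ideal P" "Poly_Mapping.single (mon x) 1 \<in> P"
  shows "\<exists>v. x v \<ge> 1 \<and> indet v \<in> P"
  using assms(2)
proof (induct "\<Sum>v\<in>UNIV. x v" arbitrary: x)
  case 0
  then have "mon x = 0" by (intro poly_mapping_eqI) simp
  then have "1 \<in> P" using 0(2) by simp
  then have "P = UNIV" using assms(1) by (auto simp: is_prime_ideal_def is_ideal_iff) (metis mult.right_neutral)
  then show ?case using assms(1) by (simp add: is_prime_ideal_def)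
next
  case (Suc n)
  then obtain v where v: "x v \<ge> 1" by (metis One_nat_def Suc_le_eq nat.distinct(1) not_gr_zero sum.neutral)
  define x' where "x' = x(v := x v - 1)"
  have "monom1 v + mon x' = mon x"
    using v by (intro poly_mapping_eqI) (auto simp: lookup_add lookup_single when_def x'_def)
  then have "indet v * Poly_Mapping.single (mon x') 1 \<in> P"
    using Suc(3) by (simp add: indet_def mult_single)
  then consider "indet v \<in> P" | "Poly_Mapping.single (mon x') 1 \<in> P"
    using assms(1) by (auto simp: is_prime_ideal_def)
  then show ?case
  proof cases
    case 1 then show ?thesis using v by blast
  next
    case 2
    have "(\<Sum>u\<in>UNIV. x u) = x v + (\<Sum>u\<in>UNIV - {v}. x u)" by (simp add: sum.remove)
    moreover have "(\<Sum>u\<in>UNIV. x' u) = x' v + (\<Sum>u\<in>UNIV - {v}. x u)"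
      by (simp add: sum.remove[of UNIV v] x'_def)
    ultimately have "n = (\<Sum>u\<in>UNIV. x' u)" using Suc(2) v by (simp add: x'_def)
    from Suc(1)[OF this 2] obtain u where "x' u \<ge> 1" "indet u \<in> P" by blast
    then show ?thesis using v by (intro exI[of _ u]) (auto simp: x'_def split: if_splits)
  qed
qed


section \<open>Powers and symbolic powers of edge ideals\<close>

definition wdiv :: "('v \<Rightarrow> nat) \<Rightarrow> ('v \<Rightarrow> nat) \<Rightarrow> 'v \<Rightarrow> nat" where
  "wdiv w x v = x v div w v"

definition pow_exps :: "('v \<times> 'v) set \<Rightarrow> ('v \<Rightarrow> nat) \<Rightarrow> nat \<Rightarrow> ('v \<Rightarrow> nat) set" where
  "pow_exps E w k = {x. epow E k (wdiv w x)}"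

definition sym_exps :: "('v::finite \<times> 'v) set \<Rightarrow> ('v \<Rightarrow> nat) \<Rightarrow> nat \<Rightarrow> ('v \<Rightarrow> nat) set" where
  "sym_exps E w k = {x. covdeg E k (wdiv w x)}"

lemma wdiv_mono: "(\<And>v. x v \<le> y v) \<Longrightarrow> wdiv w x v \<le> wdiv w y v"
  by (simp add: wdiv_def div_le_mono)

lemma upset_pow_exps: "upset (pow_exps E w k)"
  unfolding upset_def pow_exps_def by (auto intro: epow_mono wdiv_mono)

lemma upset_sym_exps: "upset (sym_exps E w k)"
  unfolding upset_def sym_exps_def by (auto intro: covdeg_mono wdiv_mono)

locale sink_weighted_graph =
  fixes E :: "('v::finite \<times> 'v) set" and w :: "'v \<Rightarrow> nat"
  assumes graph: "weighted_oriented_graph E w" and sinks: "\<forall>v\<in>V_plus w. is_sink E v"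
begin

lemma w_pos: "w v \<ge> 1"
  using graph by (simp add: weighted_oriented_graph_def)

lemma w_tail: "(u, v) \<in> E \<Longrightarrow> w u = 1"
  using sinks w_pos[of u] by (force simp: V_plus_def is_sink_def)

lemma irrefl: "\<not> adj E v v"
  using graph by (simp add: weighted_oriented_graph_def adj_def)

lemma adj_distinct: "adj E u v \<Longrightarrow> u \<noteq> v"
  using irrefl by metis

lemma wdiv_ge_1: "wdiv w x v \<ge> 1 \<longleftrightarrow> x v \<ge> w v"
  using w_pos[of v] by (simp add: wdiv_def Suc_le_eq div_greater_zero_iff)

lemma bounded_pow_exps: "bounded_by (\<lambda>v. k * w v) (pow_exps E w k)"
  and bounded_sym_exps: "bounded_by (\<lambda>v. k * w v) (sym_exps E w k)"
proof -
  have "wdiv w (\<lambda>v. min (x v) (k * w v)) = (\<lambda>v. min (wdiv w x v) k)" for x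
  proof
    fix v
    have "w v > 0" using w_pos[of v] by simp
    show "wdiv w (\<lambda>v. min (x v) (k * w v)) v = min (wdiv w x v) k"
    proof (cases "x v \<le> k * w v")
      case True
      then have "x v div w v \<le> k * w v div w v" by (rule div_le_mono)
      then show ?thesis using True \<open>w v > 0\<close> by (simp add: wdiv_def min_def)
    next
      case False
      then have "k * w v div w v \<le> x v div w v" by (intro div_le_mono) simp
      then show ?thesis using False \<open>w v > 0\<close> by (simp add: wdiv_def min_def)
    qed
  qed
  then show "bounded_by (\<lambda>v. k * w v) (pow_exps E w k)" "bounded_by (\<lambda>v. k * w v) (sym_exps E w k)"
    by (simp_all add: bounded_by_def pow_exps_def sym_exps_def epow_min covdeg_min)
qed

text \<open>
  As tails of edges have weight \<open>1\<close>, the generator of an edge is symmetric in its ends.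
\<close>

definition edge_mon :: "'v \<Rightarrow> 'v \<Rightarrow> 'v \<Rightarrow>\<^sub>0 nat" where
  "edge_mon u v = Poly_Mapping.single u (w u) + Poly_Mapping.single v (w v)"

lemma generator_eq:
  assumes "(u, v) \<in> E"
  shows "indet u * indet v ^ w v = (Poly_Mapping.single (edge_mon u v) 1 :: ('v, 'k::field) mpoly)"
  unfolding indet_power by (simp add: indet_def mult_single edge_mon_def w_tail[OF assms])

lemma generators:
  "{indet u * indet v ^ w v | u v. (u, v) \<in> E} =
   {Poly_Mapping.single (edge_mon u v) 1 :: ('v, 'k::field) mpoly | u v. adj E u v}"
proof -
  have sym: "edge_mon u v = edge_mon v u" for u v by (simp add: edge_mon_def add.commute)
  have "(\<exists>u v. f = indet u * indet v ^ w v \<and> (u, v) \<in> E) \<longleftrightarrow>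
      (\<exists>u v. f = Poly_Mapping.single (edge_mon u v) 1 \<and> adj E u v)" for f :: "('v, 'k) mpoly"
  proof
    assume "\<exists>u v. f = indet u * indet v ^ w v \<and> (u, v) \<in> E"
    then obtain u v where "f = indet u * indet v ^ w v" "(u, v) \<in> E" by blast
    then have "f = Poly_Mapping.single (edge_mon u v) 1 \<and> adj E u v"
      by (simp only: generator_eq adj_def simp_thms)
    then show "\<exists>u v. f = Poly_Mapping.single (edge_mon u v) 1 \<and> adj E u v" by blast
  next
    assume "\<exists>u v. f = Poly_Mapping.single (edge_mon u v) 1 \<and> adj E u v"
    then obtain u v where "f = Poly_Mapping.single (edge_mon u v) 1" "(u, v) \<in> E"
      using sym unfolding adj_def by metis
    then have "f = indet u * indet v ^ w v \<and> (u, v) \<in> E" by (simp only: generator_eq simp_thms)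
    then show "\<exists>u v. f = indet u * indet v ^ w v \<and> (u, v) \<in> E" by blast
  qed
  then show ?thesis by (rule Collect_cong)
qed

lemma lookup_edge_mon:
  assumes "u \<noteq> v"
  shows "lookup (edge_mon u v) x = (if x = u \<or> x = v then w x else 0)"
  using assms by (auto simp: edge_mon_def lookup_add lookup_single when_def)

lemma wdiv_edge_mon:
  assumes "adj E u v"
  shows "wdiv w (lookup (edge_mon u v + m)) = (\<lambda>x. if x = u \<or> x = v then Suc (wdiv w (lookup m) x) else wdiv w (lookup m) x)"
proof
  fix x
  have "w x > 0" using w_pos[of x] by simp
  then show "wdiv w (lookup (edge_mon u v + m)) x =
      (if x = u \<or> x = v then Suc (wdiv w (lookup m) x) else wdiv w (lookup m) x)"
    using adj_distinct[OF assms] by (simp add: lookup_add lookup_edge_mon wdiv_def)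
qed

lemma edge_mon_divides:
  assumes "adj E u v" "wdiv w (lookup m) u \<ge> 1" "wdiv w (lookup m) v \<ge> 1"
  obtains m' where "m = edge_mon u v + m'"
    "wdiv w (lookup m') = (\<lambda>x. if x = u \<or> x = v then wdiv w (lookup m) x - 1 else wdiv w (lookup m) x)"
proof
  have ne: "u \<noteq> v" by (rule adj_distinct[OF assms(1)])
  show m: "m = edge_mon u v + mon (\<lambda>x. lookup m x - lookup (edge_mon u v) x)"
    using assms(2,3) unfolding wdiv_ge_1
    by (intro poly_mapping_eqI) (auto simp: lookup_add lookup_edge_mon[OF ne])
  show "wdiv w (lookup (mon (\<lambda>x. lookup m x - lookup (edge_mon u v) x))) =
    (\<lambda>x. if x = u \<or> x = v then wdiv w (lookup m) x - 1 else wdiv w (lookup m) x)"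
    using wdiv_edge_mon[OF assms(1), of "mon (\<lambda>x. lookup m x - lookup (edge_mon u v) x)"]
    unfolding m[symmetric] by (auto simp: fun_eq_iff)
qed

lemma pow_exps_Suc_add:
  assumes "adj E u v" "lookup m \<in> pow_exps E w k"
  shows "lookup (edge_mon u v + m) \<in> pow_exps E w (Suc k)"
  using assms unfolding pow_exps_def mem_Collect_eq wdiv_edge_mon[OF assms(1)]
  by (intro epow_SucI[OF assms(1)]) auto

lemma pow_exps_SucE:
  assumes "lookup m \<in> pow_exps E w (Suc k)"
  obtains u v m' where "adj E u v" "m = edge_mon u v + m'" "lookup m' \<in> pow_exps E w k"
proof -
  obtain u v where uv: "adj E u v" "wdiv w (lookup m) u \<ge> 1" "wdiv w (lookup m) v \<ge> 1"
    "epow E k (\<lambda>x. if x = u \<or> x = v then wdiv w (lookup m) x - 1 else wdiv w (lookup m) x)"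
    using assms by (auto simp: pow_exps_def)
  from edge_mon_divides[OF uv(1-3)] obtain m' where m': "m = edge_mon u v + m'"
    "wdiv w (lookup m') = (\<lambda>x. if x = u \<or> x = v then wdiv w (lookup m) x - 1 else wdiv w (lookup m) x)" .
  then have "lookup m' \<in> pow_exps E w k" using uv(4) by (simp add: pow_exps_def)
  then show thesis using that uv(1) m'(1) by blast
qed

lemma pow_exps_0: "pow_exps E w 0 = UNIV"
  by (simp add: pow_exps_def)

lemma single_factor: "Poly_Mapping.single (m + m') c = Poly_Mapping.single m' (c::'k::field) * Poly_Mapping.single (m :: 'v \<Rightarrow>\<^sub>0 nat) 1"
  by (simp add: mult_single add.commute)

section \<open>The edge ideal and its powers as monomial ideals\<close>

lemma edge_ideal_eq: "(edge_ideal E w :: ('v, 'k::field) mpoly set) = mono_ideal (pow_exps E w 1)"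
proof
  show "edge_ideal E w \<subseteq> (mono_ideal (pow_exps E w 1) :: ('v, 'k) mpoly set)"
    unfolding edge_ideal_def generators
  proof (rule ideal_gen_least[OF _ is_ideal_mono_ideal[OF upset_pow_exps]], clarify)
    fix u v assume "adj E u v"
    then have "lookup (edge_mon u v + 0) \<in> pow_exps E w (Suc 0)"
      by (rule pow_exps_Suc_add) (simp add: pow_exps_0)
    then show "Poly_Mapping.single (edge_mon u v) 1 \<in> (mono_ideal (pow_exps E w 1) :: ('v, 'k) mpoly set)"
      by (simp add: mono_ideal_def)
  qed
  show "mono_ideal (pow_exps E w 1) \<subseteq> (edge_ideal E w :: ('v, 'k) mpoly set)"
  proof
    fix f :: "('v, 'k) mpoly" assume f: "f \<in> mono_ideal (pow_exps E w 1)"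
    show "f \<in> edge_ideal E w" unfolding edge_ideal_def generators
    proof (rule ideal_from_terms[OF is_ideal_gen])
      fix m assume "m \<in> keys f"
      then have "lookup m \<in> pow_exps E w (Suc 0)" using f by (simp add: mono_ideal_def)
      then obtain u v m' where uv: "adj E u v" "m = edge_mon u v + m'" by (rule pow_exps_SucE)
      then have "Poly_Mapping.single (edge_mon u v) 1 \<in>
          ideal_gen {Poly_Mapping.single (edge_mon u v) 1 :: ('v, 'k) mpoly | u v. adj E u v}"
        by (intro ideal_gen_base) blast
      then show "Poly_Mapping.single m (lookup f m) \<in>
          ideal_gen {Poly_Mapping.single (edge_mon u v) 1 :: ('v, 'k) mpoly | u v. adj E u v}"
        unfolding uv(2) single_factor[of "edge_mon u v"]
        using is_ideal_gen unfolding is_ideal_iff by blast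
    qed
  qed
qed

lemma ideal_pow_eq: "ideal_pow (edge_ideal E w :: ('v, 'k::field) mpoly set) k = mono_ideal (pow_exps E w k)"
proof (induct k)
  case 0
  show ?case by (auto simp: pow_exps_0 mono_ideal_def)
next
  case (Suc k)
  let ?I = "edge_ideal E w :: ('v, 'k) mpoly set" and ?K = "mono_ideal (pow_exps E w k) :: ('v, 'k) mpoly set"
  have "ideal_mult ?I ?K = mono_ideal (pow_exps E w (Suc k))"
  proof
    show "ideal_mult ?I ?K \<subseteq> mono_ideal (pow_exps E w (Suc k))"
      unfolding ideal_mult_def
    proof (rule ideal_gen_least[OF _ is_ideal_mono_ideal[OF upset_pow_exps]], clarify)
      fix a b assume ab: "a \<in> ?I" "b \<in> ?K"
      show "a * b \<in> mono_ideal (pow_exps E w (Suc k))" unfolding mono_ideal_def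
      proof clarify
        fix m assume "m \<in> keys (a * b)"
        then obtain m1 m2 where m: "m = m1 + m2" "m1 \<in> keys a" "m2 \<in> keys b" using keys_mult by blast
        have "lookup m1 \<in> pow_exps E w (Suc 0)" using ab(1) m(2) by (simp add: edge_ideal_eq mono_ideal_def)
        then obtain u v m' where uv: "adj E u v" "m1 = edge_mon u v + m'" by (rule pow_exps_SucE)
        have "lookup m2 \<in> pow_exps E w k" using ab(2) m(3) by (simp add: mono_ideal_def)
        then have "lookup (m' + m2) \<in> pow_exps E w k"
          by (rule upsetD[OF upset_pow_exps]) (simp add: lookup_add)
        from pow_exps_Suc_add[OF uv(1) this] show "lookup m \<in> pow_exps E w (Suc k)"
          by (simp add: m(1) uv(2) add.assoc)
      qed
    qed
    show "mono_ideal (pow_exps E w (Suc k)) \<subseteq> ideal_mult ?I ?K"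
    proof
      fix f :: "('v, 'k) mpoly" assume f: "f \<in> mono_ideal (pow_exps E w (Suc k))"
      show "f \<in> ideal_mult ?I ?K" unfolding ideal_mult_def
      proof (rule ideal_from_terms[OF is_ideal_gen], rule ideal_gen_base)
        fix m assume "m \<in> keys f"
        then have "lookup m \<in> pow_exps E w (Suc k)" using f by (simp add: mono_ideal_def)
        then obtain u v m' where uv: "adj E u v" "m = edge_mon u v + m'" "lookup m' \<in> pow_exps E w k"
          by (rule pow_exps_SucE)
        have "Poly_Mapping.single (edge_mon u v) 1 \<in> ?I"
          unfolding edge_ideal_def generators using uv(1) by (intro ideal_gen_base) blast
        moreover have "Poly_Mapping.single m' (lookup f m) \<in> ?K" using uv(3) by (simp add: mono_ideal_def)
        ultimately show "Poly_Mapping.single m (lookup f m) \<in> {a * b | a b. a \<in> ?I \<and> b \<in> ?K}"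
          unfolding uv(2) single_factor[of "edge_mon u v"] mult.commute[of "Poly_Mapping.single m' _"] by blast
      qed
    qed
  qed
  then show ?case by (simp add: Suc)
qed

text \<open>Minimality of a vertex cover in local form: every vertex of \<open>C\<close> has an edge
  that no other vertex of \<open>C\<close> covers.\<close>

definition mcover :: "'v set \<Rightarrow> bool" where
  "mcover C \<longleftrightarrow> vcover E C \<and> (\<forall>v\<in>C. \<exists>u. u \<notin> C \<and> adj E u v)"

lemma mcover_exists:
  assumes "vcover E C"
  obtains C' where "C' \<subseteq> C" "mcover C'"
proof -
  obtain C' where C': "vcover E C' \<and> C' \<subseteq> C" "\<And>D. vcover E D \<and> D \<subseteq> C \<Longrightarrow> card C' \<le> card D"
    using ex_has_least_nat[of "\<lambda>D. vcover E D \<and> D \<subseteq> C" C card] assms by blast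
  have "\<exists>u. u \<notin> C' \<and> adj E u v" if v: "v \<in> C'" for v
  proof (rule ccontr)
    assume no: "\<not> ?thesis"
    have "vcover E (C' - {v})" unfolding vcover_def
    proof (intro allI impI)
      fix a b assume ab: "adj E a b"
      then have "a \<in> C' \<or> b \<in> C'" using C'(1) by (simp add: vcover_def)
      then show "a \<in> C' - {v} \<or> b \<in> C' - {v}"
        using no ab adj_distinct[OF ab] adj_sym[of E a b] by blast
    qed
    then have "card C' \<le> card (C' - {v})" using C' by blast
    then show False using v by (metis card_Diff1_less finite not_less)
  qed
  then show thesis using that C'(1) by (auto simp: mcover_def)
qed

lemma pow_exps_covdeg:
  assumes "x \<in> pow_exps E w k" "vcover E C"
  shows "k \<le> (\<Sum>v\<in>C. wdiv w x v)"
  using epow_imp_covdeg[of E k "wdiv w x"] assms by (simp add: pow_exps_def covdeg_def)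

text \<open>Each unit of weight on \<open>C\<close> is paired with a neighbour off \<open>C\<close>,
  where values of at least \<open>k\<close> do not run out within \<open>k\<close> steps.\<close>

lemma mcover_epow:
  assumes "mcover C" "k \<le> (\<Sum>v\<in>C. b v)" "\<And>u. u \<notin> C \<Longrightarrow> k \<le> b u"
  shows "epow E k b"
  using assms(2,3)
proof (induct k arbitrary: b)
  case (Suc k)
  have "(\<Sum>v\<in>C. b v) \<noteq> 0" using Suc(2) by linarith
  then obtain v where v: "v \<in> C" "b v \<noteq> 0" by (meson sum.not_neutral_contains_not_neutral)
  obtain u where u: "u \<notin> C" "adj E u v" using assms(1) v(1) by (auto simp: mcover_def)
  define b' where "b' x = (if x = u \<or> x = v then b x - 1 else b x)" for x
  have "(\<Sum>x\<in>C - {v}. b' x) = (\<Sum>x\<in>C - {v}. b x)"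
    by (rule sum.cong) (use u(1) in \<open>auto simp: b'_def\<close>)
  then have "(\<Sum>x\<in>C. b' x) = b' v + (\<Sum>x\<in>C - {v}. b x)" using v(1) by (simp add: sum.remove)
  moreover have "(\<Sum>x\<in>C. b x) = b v + (\<Sum>x\<in>C - {v}. b x)" using v(1) by (simp add: sum.remove)
  ultimately have "k \<le> (\<Sum>x\<in>C. b' x)" using Suc(2) v(2) by (simp add: b'_def)
  moreover have "k \<le> b' x" if "x \<notin> C" for x using Suc(3)[OF that] by (auto simp: b'_def)
  ultimately have "epow E k b'" by (rule Suc(1))
  then show ?case by (rule epow_SucI[OF u(2), rotated 2]) (use v Suc(3)[OF u(1)] in \<open>auto simp: b'_def\<close>)
qed simp

lemma in_pow_exps_1: "x \<in> pow_exps E w 1 \<longleftrightarrow> (\<exists>u v. adj E u v \<and> x u \<ge> w u \<and> x v \<ge> w v)"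
  by (simp add: pow_exps_def wdiv_ge_1[unfolded One_nat_def])

text \<open>The prime is the annihilator of the monomial with exponent \<open>x\<close>. On
  \<open>C\<close> this is one below the weight, so that one more unit completes an edge with a
  neighbour off \<open>C\<close>; conversely every edge meets \<open>C\<close> and needs such a
  unit. \<open>W\<close> is just a common upper bound of the weights.\<close>

lemma face_ideal_associated:
  assumes C: "mcover C"
  shows "face_ideal C \<in> Ass_quot (edge_ideal E w :: ('v, 'k::field) mpoly set)"
proof -
  define W where "W = (\<Sum>v\<in>UNIV. w v)"
  have W: "w v \<le> W" for v unfolding W_def by (rule member_le_sum) auto
  define x where "x v = (if v \<in> C then w v - 1 else W)" for v
  have key: "(\<exists>v\<in>C. m v \<ge> 1) \<longleftrightarrow> (\<lambda>v. x v + m v) \<in> pow_exps E w 1" for m :: "'v \<Rightarrow> nat"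
  proof
    assume "\<exists>v\<in>C. m v \<ge> 1"
    then obtain v where v: "v \<in> C" "m v \<ge> 1" by blast
    then obtain u where u: "u \<notin> C" "adj E u v" using C by (auto simp: mcover_def)
    have "w v \<le> x v + m v" using v w_pos[of v] by (simp add: x_def)
    moreover have "w u \<le> x u + m u" using u(1) W[of u] by (simp add: x_def)
    ultimately show "(\<lambda>v. x v + m v) \<in> pow_exps E w 1" using u(2) unfolding in_pow_exps_1 by blast
  next
    assume "(\<lambda>v. x v + m v) \<in> pow_exps E w 1"
    then obtain u v where uv: "adj E u v" "w u \<le> x u + m u" "w v \<le> x v + m v" unfolding in_pow_exps_1 by blast
    then consider "u \<in> C" | "v \<in> C" using C by (auto simp: mcover_def vcover_def)
    then show "\<exists>v\<in>C. m v \<ge> 1"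
    proof cases
      case 1
      then show ?thesis using uv(2) w_pos[of u] by (intro bexI[of _ u]) (auto simp: x_def)
    next
      case 2
      then show ?thesis using uv(3) w_pos[of v] by (intro bexI[of _ v]) (auto simp: x_def)
    qed
  qed
  have "g \<in> face_ideal C \<longleftrightarrow> g * Poly_Mapping.single (mon x) 1 \<in> edge_ideal E w" for g :: "('v, 'k) mpoly"
  proof -
    have "keys (Poly_Mapping.single (mon x) 1 * g) = (\<lambda>m. mon x + m) ` keys g"
    proof
      show "keys (Poly_Mapping.single (mon x) 1 * g) \<subseteq> (\<lambda>m. mon x + m) ` keys g"
        by (auto elim!: keys_single_times)
      show "(\<lambda>m. mon x + m) ` keys g \<subseteq> keys (Poly_Mapping.single (mon x) 1 * g)"
        by (auto simp: in_keys_iff lookup_single_times)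
    qed
    moreover have "lookup (mon x + m) = (\<lambda>v. x v + lookup m v)" for m by (simp add: lookup_add fun_eq_iff)
    ultimately show ?thesis
      unfolding edge_ideal_eq face_ideal_def mono_ideal_def mult.commute[of g]
      by (simp add: key[unfolded One_nat_def])
  qed
  then have "face_ideal C = {g. g * Poly_Mapping.single (mon x) 1 \<in> (edge_ideal E w :: ('v, 'k) mpoly set)}"
    by blast
  then show ?thesis using face_ideal_prime[of C] unfolding Ass_quot_def by blast
qed

text \<open>This excludes embedded primes. Only the variables in \<open>P\<close> are determined,
  from a single term \<open>m\<close> of \<open>F\<close> outside the ideal.\<close>

lemma associated_cover:
  assumes P: "P \<in> Ass_quot (edge_ideal E w :: ('v, 'k::field) mpoly set)"
  shows "mcover {v. indet v \<in> P}"
proof -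
  let ?I = "edge_ideal E w :: ('v, 'k) mpoly set"
  obtain F where prime: "is_prime_ideal P" and F: "P = {g. g * F \<in> ?I}" using P by (auto simp: Ass_quot_def)
  have I: "is_ideal ?I" unfolding edge_ideal_def by (rule is_ideal_gen)
  have IP: "g \<in> P" if "g \<in> ?I" for g
    using I that unfolding F is_ideal_iff by (metis mem_Collect_eq mult.commute)
  have "1 \<notin> P" using prime by (auto simp: is_prime_ideal_def is_ideal_iff) (metis mult.right_neutral)
  then have "F \<notin> ?I" by (simp add: F)
  then obtain m where m: "m \<in> keys F" "lookup m \<notin> pow_exps E w 1"
    by (auto simp: edge_ideal_eq mono_ideal_def)
  have nm: "\<not> (w a \<le> lookup m a \<and> w b \<le> lookup m b)" if "adj E a b" for a b
    using m(2) that unfolding in_pow_exps_1 by blast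
  have cov: "vcover E {v. indet v \<in> P}" unfolding vcover_def
  proof (intro allI impI)
    fix u v assume uv: "adj E u v"
    have "Poly_Mapping.single (edge_mon u v) 1 \<in> ?I"
      unfolding edge_ideal_def generators using uv by (intro ideal_gen_base) blast
    then have "Poly_Mapping.single (mon (lookup (edge_mon u v))) 1 \<in> P" by (simp add: IP)
    from prime_ideal_monomial[OF prime this] obtain y where "lookup (edge_mon u v) y \<ge> 1" "indet y \<in> P" by blast
    then show "u \<in> {v. indet v \<in> P} \<or> v \<in> {v. indet v \<in> P}"
      by (auto simp: lookup_edge_mon[OF adj_distinct[OF uv]] split: if_splits)
  qed
  \<comment> \<open>\<open>indet v * F\<close> lies in the monomial ideal, hence so does its term
    \<open>monom1 v + m\<close>. The edge that becomes available contains \<open>v\<close>, and its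
    other end already reaches its weight in \<open>m\<close>.\<close>
  have step: "\<exists>b. adj E v b \<and> w v \<le> Suc (lookup m v) \<and> w b \<le> lookup m b" if v: "indet v \<in> P" for v
  proof -
    have "monom1 v + m \<in> keys (indet v * F)"
      using m(1) by (simp add: indet_def in_keys_iff lookup_single_times)
    moreover have "indet v * F \<in> ?I" using v by (simp add: F)
    ultimately have "lookup (monom1 v + m) \<in> pow_exps E w 1" by (simp add: edge_ideal_eq mono_ideal_def)
    then obtain a b where ab: "adj E a b" "w a \<le> lookup (monom1 v + m) a" "w b \<le> lookup (monom1 v + m) b"
      unfolding in_pow_exps_1 by blast
    have l: "lookup (monom1 v + m) y = (if y = v then Suc (lookup m y) else lookup m y)" for y
      by (simp add: lookup_add lookup_single when_def)
    consider "a = v" "b \<noteq> v" | "b = v" "a \<noteq> v" | "a \<noteq> v" "b \<noteq> v" using adj_distinct[OF ab(1)] by blast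
    then show ?thesis
    proof cases
      case 1 then show ?thesis using ab by (auto simp: l[unfolded One_nat_def])
    next
      case 2 then show ?thesis using ab adj_sym[of E a b] by (auto simp: l[unfolded One_nat_def])
    next
      case 3 then show ?thesis using ab nm[OF ab(1)] by (simp add: l[unfolded One_nat_def])
    qed
  qed
  have "\<exists>u. u \<notin> {v. indet v \<in> P} \<and> adj E u v" if v: "indet v \<in> P" for v
  proof -
    obtain b where b: "adj E v b" "w b \<le> lookup m b" using step[OF v] by blast
    \<comment> \<open>Otherwise \<open>b\<close> too has a neighbour reaching its weight in
      \<open>m\<close>, and since \<open>b\<close> does so as well, \<open>m\<close> would lie in
      the ideal.\<close>
    have "indet b \<notin> P"
    proof
      assume "indet b \<in> P"
      then obtain c where "adj E b c" "w c \<le> lookup m c" using step by blast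
      then show False using nm b(2) by blast
    qed
    then show ?thesis using b(1) adj_sym[of E v b] by blast
  qed
  then show ?thesis using cov by (simp add: mcover_def)
qed

lemma symbolic_pow_eq:
  "symbolic_pow (edge_ideal E w :: ('v, 'k::field) mpoly set) k = mono_ideal (sym_exps E w k)"
proof -
  let ?I = "edge_ideal E w :: ('v, 'k) mpoly set" and ?K = "mono_ideal (pow_exps E w k) :: ('v, 'k) mpoly set"
  have K: "is_ideal ?K" by (rule is_ideal_mono_ideal[OF upset_pow_exps])
  have sym: "f \<in> symbolic_pow ?I k \<longleftrightarrow> (\<forall>P\<in>Ass_quot ?I. \<exists>s. s \<notin> P \<and> s * f \<in> ?K)" for f
  proof -
    have "f \<in> symbolic_pow ?I k \<longleftrightarrow> (\<forall>P\<in>Ass_quot ?I. f \<in> loc_contraction P (loc_extension P ?K))"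
      by (simp add: symbolic_pow_def ideal_pow_eq)
    also have "\<dots> \<longleftrightarrow> (\<forall>P\<in>Ass_quot ?I. \<exists>s. s \<notin> P \<and> s * f \<in> ?K)"
      by (intro ball_cong refl loc_contraction_iff[OF _ K]) (simp add: Ass_quot_def)
    finally show ?thesis .
  qed
  show ?thesis
  proof
    show "symbolic_pow ?I k \<subseteq> mono_ideal (sym_exps E w k)"
    proof
      fix f assume f: "f \<in> symbolic_pow ?I k"
      have "k \<le> (\<Sum>v\<in>C. wdiv w (lookup m) v)" if m: "m \<in> keys f" and C: "vcover E C" for m C
      proof -
        from mcover_exists[OF C] obtain C' where C': "C' \<subseteq> C" "mcover C'" .
        then have "vcover E C'" by (simp add: mcover_def)
        obtain s where s: "s \<notin> face_ideal C'" "s * f \<in> ?K"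
          using f sym face_ideal_associated[OF C'(2)] by blast
        \<comment> \<open>The condition for the single cover \<open>C'\<close> depends only on
          coordinates in \<open>C'\<close>, so \<open>mono_ideal_primary\<close> cancels the
          multiplier \<open>s\<close>.\<close>
        define A where "A = {x. k \<le> (\<Sum>v\<in>C'. wdiv w x v)}"
        have "s * f \<in> mono_ideal A"
          using s(2) pow_exps_covdeg[OF _ \<open>vcover E C'\<close>] by (auto simp: mono_ideal_def A_def)
        then have "f \<in> mono_ideal A"
        proof (rule mono_ideal_primary[OF _ _ s(1), rotated 2])
          show "upset A" unfolding upset_def A_def
          proof (intro ballI allI impI, unfold mem_Collect_eq)
            fix x y :: "'v \<Rightarrow> nat" assume x: "k \<le> (\<Sum>v\<in>C'. wdiv w x v)" and "\<forall>v. x v \<le> y v"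
            then have "(\<Sum>v\<in>C'. wdiv w x v) \<le> (\<Sum>v\<in>C'. wdiv w y v)" by (intro sum_mono wdiv_mono) blast
            then show "k \<le> (\<Sum>v\<in>C'. wdiv w y v)" using x by simp
          qed
          show "y \<in> A" if "\<And>v. v \<in> C' \<Longrightarrow> x v = y v" "x \<in> A" for x y
            using that by (simp add: A_def wdiv_def)
        qed
        then have "k \<le> (\<Sum>v\<in>C'. wdiv w (lookup m) v)" using m by (simp add: mono_ideal_def A_def)
        also have "\<dots> \<le> (\<Sum>v\<in>C. wdiv w (lookup m) v)" by (rule sum_mono2) (use C' in auto)
        finally show ?thesis .
      qed
      then show "f \<in> mono_ideal (sym_exps E w k)"
        by (simp add: mono_ideal_def sym_exps_def covdeg_def)
    qed
    show "mono_ideal (sym_exps E w k) \<subseteq> symbolic_pow ?I k"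
    proof
      fix f :: "('v, 'k) mpoly" assume f: "f \<in> mono_ideal (sym_exps E w k)"
      have "\<exists>s. s \<notin> P \<and> s * f \<in> ?K" if P: "P \<in> Ass_quot ?I" for P
      proof -
        define C where "C = {v. indet v \<in> P}"
        have C: "mcover C" unfolding C_def by (rule associated_cover[OF P])
        \<comment> \<open>A monomial in the variables outside \<open>P\<close>, large enough to
          provide the value \<open>k\<close> off \<open>C\<close> that \<open>mcover_epow\<close>
          asks for.\<close>
        define x where "x v = (if v \<in> C then 0 else k * w v)" for v
        let ?s = "Poly_Mapping.single (mon x) 1 :: ('v, 'k) mpoly"
        have "?s \<notin> P"
        proof
          assume "?s \<in> P"
          from prime_ideal_monomial[OF _ this] P obtain v where "x v \<ge> 1" "indet v \<in> P"
            by (auto simp: Ass_quot_def)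
          then show False by (simp add: x_def C_def)
        qed
        moreover have "?s * f \<in> ?K" unfolding mono_ideal_def
        proof clarify
          fix m assume "m \<in> keys (?s * f)"
          then obtain m' where m': "m' \<in> keys f" "m = mon x + m'" by (rule keys_single_times)
          have "k \<le> (\<Sum>v\<in>C. wdiv w (lookup m') v)"
            using f m'(1) C by (simp add: mono_ideal_def sym_exps_def covdeg_def mcover_def)
          also have "\<dots> \<le> (\<Sum>v\<in>C. wdiv w (lookup m) v)"
            by (intro sum_mono wdiv_mono) (simp add: m'(2) lookup_add)
          finally have "k \<le> (\<Sum>v\<in>C. wdiv w (lookup m) v)" .
          moreover have "k \<le> wdiv w (lookup m) v" if "v \<notin> C" for v
          proof -
            have "k * w v div w v \<le> lookup m v div w v"
              by (rule div_le_mono) (use that in \<open>simp add: m'(2) lookup_add x_def\<close>)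
            then show ?thesis using w_pos[of v] by (simp add: wdiv_def)
          qed
          ultimately show "lookup m \<in> pow_exps E w k"
            unfolding pow_exps_def using mcover_epow[OF C] by blast
        qed
        ultimately show ?thesis by blast
      qed
      then show "f \<in> symbolic_pow ?I k" by (simp add: sym)
    qed
  qed
qed

text \<open>Division by the weights turns each corner into \<open>fill k \<tau> \<beta>\<close>. A
  negative \<open>b v\<close> gives \<beta> the value 0 at \<open>v\<close>, so non-negativity on
  \<tau> has to be recorded separately.\<close>

lemma cube_exps:
  fixes b :: "'v \<Rightarrow> int" and Q :: "('v \<Rightarrow> nat) \<Rightarrow> bool"
  defines "\<beta> \<equiv> \<lambda>v. nat (b v) div w v"
  shows "\<tau> \<in> cube (ints {x. Q (wdiv w x)}) b (\<lambda>v. int (k * w v)) \<longleftrightarrow>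
    (\<forall>v\<in>\<tau>. 0 \<le> b v) \<and> Q (fill k \<tau> \<beta>)"
proof -
  have "wdiv w (\<lambda>v. nat (if v \<in> \<tau> then b v else int (k * w v))) = fill k \<tau> \<beta>"
    using w_pos by (auto simp: wdiv_def fill_def \<beta>_def fun_eq_iff nat_mult_distrib Suc_le_eq)
  then show ?thesis by (auto simp: cube_def ints_def simp del: of_nat_mult)
qed

text \<open>
  Unless the complexes of the two ideals agree, the one of the symbolic power is a cone: over any
  vertex if the exponent itself lies in the ideal, and otherwise over the vertex found in
  \<open>covdeg_fill_3\<close>.
\<close>

lemma hnz_compare:
  fixes b :: "'v \<Rightarrow> int"
  assumes k: "k = 2 \<or> k = 3" and bk: "\<And>v. b v \<le> int (k * w v)"
    and nz: "hnz TYPE('k::field) (cube (ints (sym_exps E w k)) b (\<lambda>v. int (k * w v))) i"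
  shows "hnz TYPE('k) (cube (ints (pow_exps E w k)) b (\<lambda>v. int (k * w v))) i"
proof -
  define \<beta> where "\<beta> v = nat (b v) div w v" for v
  let ?S = "cube (ints (sym_exps E w k)) b (\<lambda>v. int (k * w v))"
  let ?P = "cube (ints (pow_exps E w k)) b (\<lambda>v. int (k * w v))"
  have S: "\<tau> \<in> ?S \<longleftrightarrow> (\<forall>v\<in>\<tau>. 0 \<le> b v) \<and> covdeg E k (fill k \<tau> \<beta>)"
    and P: "\<tau> \<in> ?P \<longleftrightarrow> (\<forall>v\<in>\<tau>. 0 \<le> b v) \<and> epow E k (fill k \<tau> \<beta>)" for \<tau>
    unfolding sym_exps_def pow_exps_def cube_exps \<beta>_def by simp_all
  have \<beta>0: "0 \<le> b v" if "\<beta> v \<ge> 1" for v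
    using that by (cases "0 \<le> b v") (simp_all add: \<beta>_def)
  have no: "\<not> covdeg E k \<beta>"
  proof
    assume cov: "covdeg E k \<beta>"
    have "\<beta> v \<le> k" for v
    proof -
      have "nat (b v) \<le> k * w v" using bk[of v] by linarith
      then have "\<beta> v \<le> k * w v div w v" unfolding \<beta>_def by (rule div_le_mono)
      then show ?thesis using w_pos[of v] by simp
    qed
    then have fill: "covdeg E k (fill k \<tau> \<beta>)" for \<tau>
      by (intro covdeg_mono[OF cov]) (simp add: fill_def)
    \<comment> \<open>The whole vertex set is a cover and \<open>k\<close> is positive, so some
      \<beta> value is positive; this supplies a vertex with \<open>0 \<le> b v\<close> as
      apex.\<close>
    have "k \<le> (\<Sum>v\<in>UNIV. \<beta> v)" using cov by (simp add: covdeg_def vcover_def)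
    then have "(\<Sum>v\<in>UNIV. \<beta> v) \<noteq> 0" using k by linarith
    then obtain v where "\<beta> v \<noteq> 0" by (meson sum.not_neutral_contains_not_neutral)
    then have "0 \<le> b v" by (intro \<beta>0) simp
    then have "\<not> hnz TYPE('k) ?S i" by (intro hnz_cone[of _ v]) (simp add: S fill del: of_nat_mult)
    then show False using nz by blast
  qed
  have "covdeg E k (fill k \<tau> \<beta>) \<longrightarrow> epow E k (fill k \<tau> \<beta>)" for \<tau>
  proof (rule ccontr)
    assume neg: "\<not> ?thesis"
    then have "k = 3" using k covdeg_fill_2[OF irrefl, of \<tau> \<beta>] no by blast
    then have "covdeg E 3 (fill 3 \<tau> \<beta>)" "\<not> covdeg E 3 \<beta>" "\<not> epow E 3 (fill 3 \<tau> \<beta>)"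
      using neg no by simp_all
    then obtain y x z t where "adj E x z" "adj E z t" "adj E x t" "y \<noteq> x" "y \<noteq> z" "y \<noteq> t"
      "\<beta> x \<ge> 1" "\<beta> z \<ge> 1" "\<beta> t \<ge> 1" "\<beta> y \<ge> 1"
      by (rule covdeg_fill_3[OF irrefl])
    \<comment> \<open>\<open>y\<close> and the triangle are described through \<beta> alone, so the
      inequality holds for all sets at once: a single bad \<tau> turns the whole complex into a cone
      over \<open>y\<close>.\<close>
    note cone = covdeg_fill_cone[where \<beta> = \<beta>, OF irrefl this] and y = \<open>\<beta> y \<ge> 1\<close>
    have "\<not> hnz TYPE('k) ?S i"
      using cone \<beta>0[OF y] by (intro hnz_cone[of _ y]) (auto simp: S[unfolded \<open>k = 3\<close>] \<open>k = 3\<close> simp del: of_nat_mult)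
    then show False using nz by blast
  qed
  then have "?S = ?P" using epow_imp_covdeg by (auto simp: S P simp del: of_nat_mult)
  then show ?thesis using nz by simp
qed

end

theorem theorem4p3:
  fixes E :: "('v::finite \<times> 'v) set" and w :: "'v \<Rightarrow> nat"
    and I :: "('v, 'k::field) mpoly set" and k :: nat
  assumes "weighted_oriented_graph E w"
    and "\<forall>v\<in>V_plus w. is_sink E v"
    and "I = edge_ideal E w"
    and "k = 2 \<or> k = 3"
  shows "reg (symbolic_pow I k) \<le> reg (ideal_pow I k)"
proof -
  interpret sink_weighted_graph E w by unfold_locales (use assms in auto)
  show ?thesis unfolding assms(3) symbolic_pow_eq ideal_pow_eq
    \<comment> \<open>Through \<open>order_refl\<close> the truncation bound \<open>k * w v\<close>
      of the symbolic exponents also becomes the upper end \<open>N\<close> of the long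
      cubes.\<close>
    by (rule reg_mono_ideal_le[OF upset_sym_exps bounded_sym_exps upset_pow_exps bounded_pow_exps order_refl])
      (rule hnz_compare[OF assms(4)])
qed

end
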